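(* Let $T:\mathscr{S}(\mathbb{R}^d)\to\mathscr{S}'(\mathbb{R}^d)$ be a bounded (continuous linear) map. Assume that $T$ and all possible multiple commutators $$[W_{j_1},[W_{j_2},\dots,[W_{j_m},T]\dots]],\qquad m\geq 1,\quad j_\ell\in\{1,2,\dots,2d\},$$ where $W_k=X_k$ for $1\le k\le d$ and $W_k=D_{k-d}$ for $d+1\le k\le 2d$, can be extended to bounded operators on $L^2(\mathbb{R}^d)$. Then there exists a symbol $a_0(x,\xi)\in S^0_{0,0}(\mathbb{R}^{2d})$ such that for every $\Psi,\Phi\in\mathscr{S}(\mathbb{R}^d)$ $$\langle \Psi,T\Phi\rangle_{L^2(\mathbb{R}^d)}=(2\pi)^{-d}\int_{\mathbb{R}^{d}}\left(\int_{\mathbb{R}^{2d}} e^{i\xi\cdot(x-x')}\,\overline{\Psi(x)}\,a_0\big((x+x')/2,\xi\big)\,\Phi(x')\,dx\,dx'\right)d\xi ,$$ i.e. $T$ is the Weyl quantization of $a_0$.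
   Context: $\mathscr{S}(\mathbb{R}^d)$ is the Schwartz space and $\mathscr{S}'(\mathbb{R}^d)$ the space of tempered distributions. $X_j$ is the operator of multiplication by $x_j$ and $D_j=-i\partial_{x_j}$, $1\le j\le d$; these operators leave $\mathscr{S}(\mathbb{R}^d)$ invariant and act on $\mathscr{S}'(\mathbb{R}^d)$ in the distributional sense, so that $[W,T]=WT-TW$ and the iterated commutators are maps from $\mathscr{S}(\mathbb{R}^d)$ to $\mathscr{S}'(\mathbb{R}^d)$. The scalar product of $L^2(\mathbb{R}^d)$ is linear in the second variable (and antilinear in the first). $S^0_{0,0}(\mathbb{R}^{2d})$ is the Hörmander class of functions $a\in C^\infty(\mathbb{R}^{2d})$ such that $\sup_{(x,\xi)\in\mathbb{R}^{2d}}|\partial_x^\alpha\partial_\xi^\beta a(x,\xi)|<\infty$ for all multi-indices $\alpha,\beta\in\mathbb{N}^d$. *)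

theory Defs
  imports "HOL-Analysis.Analysis"
begin

section \<open>Iterated partial derivatives\<close>

definition partial_deriv ::
  "'a::euclidean_space \<Rightarrow> ('a \<Rightarrow> 'b::real_normed_vector) \<Rightarrow> 'a \<Rightarrow> 'b" where
  "partial_deriv b f x = vector_derivative (\<lambda>t. f (x + t *\<^sub>R b)) (at 0)"

text \<open>
  A multi-index derivative is given by the list of the basis directions in which one
  differentiates successively, e.g. \<open>[b, b, c]\<close> stands for \<open>\<partial>\<^sub>b \<partial>\<^sub>b \<partial>\<^sub>c\<close>. For smooth functions
  the order of the list is irrelevant, so that lists over \<^term>\<open>Basis\<close> and multi-indices
  describe the same derivatives.
\<close>

definition iter_deriv ::
  "'a::euclidean_space list \<Rightarrow> ('a \<Rightarrow> 'b::real_normed_vector) \<Rightarrow> 'a \<Rightarrow> 'b" where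
  "iter_deriv bs f = foldr partial_deriv bs f"

text \<open>
  \<open>C\<^sup>\<infinity>\<close>: all iterated partial derivatives exist and are (totally) differentiable, hence
  continuous. Total differentiability of each of them guarantees that the next partial
  derivatives exist, i.e. that \<^const>\<open>vector_derivative\<close> above is not a junk value.
\<close>

definition smooth :: "('a::euclidean_space \<Rightarrow> 'b::real_normed_vector) \<Rightarrow> bool" where
  "smooth f \<longleftrightarrow> (\<forall>bs. set bs \<subseteq> Basis \<longrightarrow> iter_deriv bs f differentiable_on UNIV)"


section \<open>The Schwartz space\<close>

definition monomial :: "('n::finite \<Rightarrow> nat) \<Rightarrow> real ^ 'n \<Rightarrow> real" where
  "monomial \<alpha> x = (\<Prod>j\<in>UNIV. (x $ j) ^ \<alpha> j)"

definition schwartz :: "(real ^ 'n::finite \<Rightarrow> complex) set" where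
  "schwartz = {f. smooth f \<and>
     (\<forall>\<alpha> bs. set bs \<subseteq> Basis \<longrightarrow> bounded (range (\<lambda>x. monomial \<alpha> x *\<^sub>R iter_deriv bs f x)))}"

definition schwartz_seminorm ::
  "('n::finite \<Rightarrow> nat) \<Rightarrow> (real ^ 'n) list \<Rightarrow> (real ^ 'n \<Rightarrow> complex) \<Rightarrow> real" where
  "schwartz_seminorm \<alpha> bs f = (SUP x. norm (monomial \<alpha> x *\<^sub>R iter_deriv bs f x))"

definition schwartz_topology :: "(real ^ 'n::finite \<Rightarrow> complex) topology" where
  "schwartz_topology = topology_generated_by
     {{g \<in> schwartz. schwartz_seminorm \<alpha> bs (\<lambda>x. g x - f x) < e} |f \<alpha> bs e.
        f \<in> schwartz \<and> set bs \<subseteq> Basis \<and> e > 0}"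

lemma iter_deriv_zero: "iter_deriv bs (\<lambda>x. 0) = (\<lambda>x. 0)"
  by (induction bs) (simp_all add: iter_deriv_def partial_deriv_def fun_eq_iff)

lemma topspace_schwartz_topology: "topspace schwartz_topology = schwartz"
proof -
  have "f \<in> topspace schwartz_topology" if "f \<in> schwartz" for f :: "real ^ 'n \<Rightarrow> complex"
  proof -
    let ?B = "{g \<in> schwartz. schwartz_seminorm (\<lambda>_. 0) [] (\<lambda>x. g x - f x) < 1}"
    have "f \<in> ?B"
      using that by (simp add: schwartz_seminorm_def iter_deriv_zero)
    moreover have "openin schwartz_topology ?B"
      unfolding schwartz_topology_def
      by (rule topology_generated_by_Basis) (use that in \<open>force intro!: exI[of _ "[]"]\<close>)
    ultimately show ?thesis
      using openin_subset by blast
  qed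
  then show ?thesis
    by (auto simp: schwartz_topology_def topology_generated_by_topspace)
qed

definition linear_on_schwartz :: "((real ^ 'n::finite \<Rightarrow> complex) \<Rightarrow> complex) \<Rightarrow> bool" where
  "linear_on_schwartz u \<longleftrightarrow>
     (\<forall>f\<in>schwartz. \<forall>g\<in>schwartz. u (\<lambda>x. f x + g x) = u f + u g) \<and>
     (\<forall>f\<in>schwartz. \<forall>c. u (\<lambda>x. c * f x) = c * u f)"


section \<open>Tempered distributions\<close>

text \<open>
  Tempered distributions are linear (not antilinear) functionals. They are functions
  with domain \<^term>\<open>schwartz\<close>, i.e. \<^const>\<open>undefined\<close> outside, so that equality of
  distributions is equality of HOL functions.
\<close>

type_synonym 'n functional = "(real ^ 'n \<Rightarrow> complex) \<Rightarrow> complex"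

definition tempered :: "'n::finite functional set" where
  "tempered = {u \<in> extensional schwartz. linear_on_schwartz u \<and>
     continuous_map schwartz_topology euclidean u}"

text \<open>The weak-* topology, i.e. the topology of pointwise convergence on \<^term>\<open>schwartz\<close>.\<close>

definition tempered_topology :: "'n::finite functional topology" where
  "tempered_topology = subtopology (product_topology (\<lambda>_. euclidean) schwartz) tempered"

definition continuous_linear_operator ::
  "((real ^ 'n::finite \<Rightarrow> complex) \<Rightarrow> 'n functional) \<Rightarrow> bool" where
  "continuous_linear_operator T \<longleftrightarrow>
     T ` schwartz \<subseteq> tempered \<and>
     (\<forall>\<psi>\<in>schwartz. linear_on_schwartz (\<lambda>\<phi>. T \<phi> \<psi>)) \<and>
     continuous_map schwartz_topology tempered_topology T"


section \<open>Position and momentum operators, commutators\<close>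

text \<open>
  The index set \<open>{1,\<dots>,2d}\<close> is rendered as the sum type \<^typ>\<open>'n + 'n\<close>: \<open>Inl j\<close> stands for
  \<open>X\<^sub>j\<close> and \<open>Inr j\<close> for \<open>D\<^sub>j = -\<i> \<partial>\<^sub>j\<close>.
\<close>

fun W_op :: "'n + 'n \<Rightarrow> (real ^ 'n::finite \<Rightarrow> complex) \<Rightarrow> (real ^ 'n \<Rightarrow> complex)" where
  "W_op (Inl j) f = (\<lambda>x. complex_of_real (x $ j) * f x)"
| "W_op (Inr j) f = (\<lambda>x. - \<i> * partial_deriv (axis j 1) f x)"

text \<open>
  The action on distributions: \<open>(X\<^sub>j u)(\<psi>) = u (X\<^sub>j \<psi>)\<close> and, since the pairing is bilinear,
  \<open>(D\<^sub>j u)(\<psi>) = - u (D\<^sub>j \<psi>)\<close>.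
\<close>

fun W_dist :: "'n + 'n \<Rightarrow> 'n::finite functional \<Rightarrow> 'n functional" where
  "W_dist (Inl j) u = (\<lambda>\<psi>\<in>schwartz. u (W_op (Inl j) \<psi>))"
| "W_dist (Inr j) u = (\<lambda>\<psi>\<in>schwartz. - u (W_op (Inr j) \<psi>))"

definition commutator ::
  "'n + 'n \<Rightarrow> ((real ^ 'n::finite \<Rightarrow> complex) \<Rightarrow> 'n functional) \<Rightarrow>
     (real ^ 'n \<Rightarrow> complex) \<Rightarrow> 'n functional" where
  "commutator k T = (\<lambda>\<phi>. \<lambda>\<psi>\<in>schwartz. W_dist k (T \<phi>) \<psi> - T (W_op k \<phi>) \<psi>)"

text \<open>\<open>multi_commutator [j\<^sub>1, \<dots>, j\<^sub>m] T = [W\<^bsub>j\<^sub>1\<^esub>, [\<dots>, [W\<^bsub>j\<^sub>m\<^esub>, T] \<dots>]]\<close>; the empty list gives \<open>T\<close>.\<close>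

definition multi_commutator ::
  "('n + 'n) list \<Rightarrow> ((real ^ 'n::finite \<Rightarrow> complex) \<Rightarrow> 'n functional) \<Rightarrow>
     (real ^ 'n \<Rightarrow> complex) \<Rightarrow> 'n functional" where
  "multi_commutator ks T = foldr commutator ks T"


section \<open>Bounded operators on the space of square integrable functions\<close>

definition L2 :: "('a::euclidean_space \<Rightarrow> complex) set" where
  "L2 = {f \<in> borel_measurable lborel. integrable lborel (\<lambda>x. (cmod (f x))\<^sup>2)}"

definition L2_inner ::
  "('a::euclidean_space \<Rightarrow> complex) \<Rightarrow> ('a \<Rightarrow> complex) \<Rightarrow> complex" where
  "L2_inner f g = (\<integral>x. cnj (f x) * g x \<partial>lborel)"

definition L2_norm :: "('a::euclidean_space \<Rightarrow> complex) \<Rightarrow> real" where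
  "L2_norm f = sqrt (\<integral>x. (cmod (f x))\<^sup>2 \<partial>lborel)"

text \<open>
  Operators act on representatives, with linearity up to null sets; together with the
  norm bound this implies that almost equal functions have almost equal images.
\<close>

definition bounded_L2_operator ::
  "(('a::euclidean_space \<Rightarrow> complex) \<Rightarrow> ('a \<Rightarrow> complex)) \<Rightarrow> bool" where
  "bounded_L2_operator B \<longleftrightarrow>
     B ` L2 \<subseteq> L2 \<and>
     (\<forall>f\<in>L2. \<forall>g\<in>L2. AE x in lborel. B (\<lambda>y. f y + g y) x = B f x + B g x) \<and>
     (\<forall>f\<in>L2. \<forall>c. AE x in lborel. B (\<lambda>y. c * f y) x = c * B f x) \<and>
     (\<exists>C. \<forall>f\<in>L2. L2_norm (B f) \<le> C * L2_norm f)"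

definition dist_of :: "(real ^ 'n::finite \<Rightarrow> complex) \<Rightarrow> 'n functional" where
  "dist_of g = (\<lambda>\<psi>\<in>schwartz. \<integral>x. g x * \<psi> x \<partial>lborel)"

definition extends_to_bounded_L2_operator ::
  "((real ^ 'n::finite \<Rightarrow> complex) \<Rightarrow> 'n functional) \<Rightarrow> bool" where
  "extends_to_bounded_L2_operator A \<longleftrightarrow>
     (\<exists>B. bounded_L2_operator B \<and> (\<forall>\<phi>\<in>schwartz. A \<phi> = dist_of (B \<phi>)))"

text \<open>The square integrable function (unique almost everywhere) given by a distribution.\<close>

definition L2_function :: "'n::finite functional \<Rightarrow> real ^ 'n \<Rightarrow> complex" where
  "L2_function u = (SOME g. g \<in> L2 \<and> u = dist_of g)"


section \<open>Symbols\<close>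

text \<open>
  The class \<open>S\<^sup>0\<^sub>0\<^sub>,\<^sub>0\<close>; the basis of the product space consists of the \<open>x\<close>- and the
  \<open>\<xi>\<close>-directions.
\<close>

definition S000 :: "((real ^ 'n::finite) \<times> (real ^ 'n) \<Rightarrow> complex) set" where
  "S000 = {a. smooth a \<and> (\<forall>bs. set bs \<subseteq> Basis \<longrightarrow> bounded (range (iter_deriv bs a)))}"

end

theory Submission
  imports Defs "HOL-Probability.Probability"
begin

text \<open>
  Write \<open>w = (q, \<xi>)\<close> and \<open>z\<close> for points of phase space, \<open>tf z\<close> for the shift by \<open>z\<close> in position and
  frequency, and \<open>P\<^sub>w\<close> (\<open>parity w\<close>) for the reflection about \<open>w\<close>, which is
  \<open>(P\<^sub>w f)(x) = e\<^bsup>2i\<xi>(x-q)\<^esup> f (2q - x)\<close>. The Weyl quantization of \<open>a\<close> is \<open>\<pi>\<^bsup>-d\<^esup> \<integral> a(w) P\<^sub>w dw\<close>, and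
  formally its symbol is recovered as \<open>a(w) = 2\<^sup>d Tr (T P\<^sub>w)\<close>. Evaluating this trace with the coherent states
  \<open>g\<^sub>z = tf z g\<close> of one fixed window \<open>g\<close> suggests the symbol
  \<open>a(w) = \<pi>\<^bsup>-d\<^esup> \<parallel>g\<parallel>\<^bsup>-2\<^esup> \<integral> \<langle>g\<^sub>z, T P\<^sub>w g\<^sub>z\<rangle> dz\<close>.

  The integral converges because \<open>P\<^sub>w g\<^sub>z\<close> is, up to a phase, a coherent state at \<open>2w - z\<close>, and because
  \<open>\<langle>tf z f, T (tf z' h)\<rangle>\<close> decays faster than every power of \<open>z - z'\<close> (\<open>tf_matrix_decay\<close>): multiplication by
  a coordinate of \<open>z - z'\<close> amounts to replacing \<open>T\<close> by a commutator or \<open>f\<close>, \<open>h\<close> by other Schwartz functions,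
  and all such matrix elements are bounded. After the substitution \<open>z = w + u\<close> the point \<open>w\<close>
  enters only through the conjugation of \<open>T\<close> by \<open>tf w\<close>. Differentiating in \<open>w\<close> therefore turns the symbol of \<open>T\<close>
  into the symbol of a commutator (\<open>parity_symbol_derivative\<close>), so that all derivatives are bounded.

  That \<open>T\<close> is the quantization of \<open>a\<close> is tested against the Wigner function of \<open>\<Psi>\<close> and \<open>\<Phi>\<close>. By Fubini and
  because \<open>T\<close> commutes with integrals (\<open>L2_pull_out\<close>), the claim reduces to two identities without \<open>T\<close>: the Wigner
  function quantizes to a rank one operator (\<open>wigner_parity_inversion\<close>), and the coherent states resolve the
  identity (\<open>stft_reconstruction\<close>). Both are instances of Fourier inversion. The decay that Fubini requires of
  the Wigner function and of the short-time Fourier transform is the decay theorem once more,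
  applied to the identity operator, all of whose commutators vanish.
\<close>

type_synonym 'n phase_space = "(real ^ 'n) \<times> (real ^ 'n)"

section \<open>Polynomial weights and Lebesgue integrals\<close>

text \<open>
  A product over the coordinates and not a power of \<open>1 + |x|\<^sup>2\<close>: the integral of the inverse factorises, and
  each factor corresponds to multiplication by one squared coordinate.
\<close>
definition weight :: "'a::euclidean_space \<Rightarrow> real" where
  "weight x = (\<Prod>b\<in>Basis. 1 + (x \<bullet> b)\<^sup>2)"

lemma weight_ge_1: "weight x \<ge> 1"
  unfolding weight_def by (rule prod_ge_1) simp

lemma weight_pos [simp]: "weight x > 0"
  using weight_ge_1[of x] by linarith

lemma weight_nonneg [simp]: "weight x \<ge> 0"
  using weight_pos[of x] by linarith

lemma weight_nz [simp]: "weight x \<noteq> 0"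
  using weight_pos[of x] by linarith

lemma weight_minus [simp]: "weight (- x) = weight x"
  by (simp add: weight_def)

lemma weight_minus_commute: "weight (x - y) = weight (y - x)"
  by (metis minus_diff_eq weight_minus)

lemma weight_0 [simp]: "weight 0 = 1"
  by (simp add: weight_def)

lemma continuous_on_weight [continuous_intros]:
  "continuous_on S f \<Longrightarrow> continuous_on S (\<lambda>x. weight (f x))"
  unfolding weight_def by (intro continuous_intros)

lemma measurable_weight [measurable]: "weight \<in> borel_measurable borel"
  unfolding weight_def by measurable

text \<open>
  Peetre's inequality for this weight: decay in \<open>x - y\<close> can be traded for decay in \<open>x\<close> at the price of growth in \<open>y\<close>.
\<close>
lemma weight_add_le: "weight (x + y :: 'a::euclidean_space) \<le> 2 ^ DIM('a) * weight x * weight y"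
proof -
  have *: "1 + (s + t)\<^sup>2 \<le> 2 * (1 + s\<^sup>2) * (1 + t\<^sup>2)" for s t :: real
  proof -
    have "0 \<le> (s - t)\<^sup>2 + 1 + 2 * s\<^sup>2 * t\<^sup>2" by simp
    then show ?thesis by (simp add: power2_eq_square algebra_simps)
  qed
  have "weight (x + y) \<le> (\<Prod>b\<in>Basis. 2 * (1 + (x \<bullet> b)\<^sup>2) * (1 + (y \<bullet> b)\<^sup>2))"
    unfolding weight_def by (intro prod_mono conjI) (simp, simp only: inner_add_left *)
  also have "\<dots> = 2 ^ DIM('a) * weight x * weight y"
    by (simp only: weight_def prod.distrib prod_constant)
  finally show ?thesis .
qed

lemma weight_le_shift: "weight (x :: 'a::euclidean_space) \<le> 2 ^ DIM('a) * weight y * weight (x - y)"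
  using weight_add_le[of y "x - y"] by simp

lemma inverse_weight_shift:
  "1 / weight (x - y :: 'a::euclidean_space) \<le> 2 ^ DIM('a) * weight y / weight x"
  using weight_le_shift[of x y] by (simp add: field_simps)

lemma weight_scale_le:
  assumes "\<bar>s\<bar> \<le> 1" shows "weight (s *\<^sub>R x) \<le> weight x"
  unfolding weight_def
proof (intro prod_mono conjI)
  fix b
  have "\<bar>s * (x \<bullet> b)\<bar> \<le> \<bar>x \<bullet> b\<bar>"
    using assms by (simp add: abs_mult mult_left_le_one_le)
  then have "(s * (x \<bullet> b))\<^sup>2 \<le> (x \<bullet> b)\<^sup>2" by (simp only: abs_le_square_iff)
  then show "1 + (s *\<^sub>R x \<bullet> b)\<^sup>2 \<le> 1 + (x \<bullet> b)\<^sup>2" by simp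
qed simp

lemma weight_mono_scale: "c \<ge> 1 \<Longrightarrow> weight x \<le> weight (c *\<^sub>R x)"
  using weight_scale_le[of "1 / c" "c *\<^sub>R x"] by simp

lemma prod_Basis_prod:
  "(\<Prod>b\<in>(Basis :: ('a::euclidean_space \<times> 'b::euclidean_space) set). f b) =
   (\<Prod>b\<in>Basis. f (b, 0)) * (\<Prod>b\<in>Basis. f (0, b))"
proof -
  have "(\<Prod>b\<in>(Basis :: ('a \<times> 'b) set). f b)
      = (\<Prod>b\<in>(\<lambda>b. (b, 0)) ` Basis \<union> (\<lambda>b. (0, b)) ` Basis. f b)"
    by (simp add: Basis_prod_def)
  also have "\<dots> = (\<Prod>b\<in>(\<lambda>b. (b, 0)) ` Basis. f b) * (\<Prod>b\<in>(\<lambda>b. (0, b)) ` Basis. f b)"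
    by (rule prod.union_disjoint) auto
  also have "\<dots> = (\<Prod>b\<in>Basis. f (b, 0)) * (\<Prod>b\<in>Basis. f (0, b))"
    by (simp add: prod.reindex inj_on_def)
  finally show ?thesis .
qed

lemma weight_Pair: "weight (x, y) = weight x * weight y"
  unfolding weight_def by (simp add: prod_Basis_prod)

lemma weight_fst_le: "weight (fst z) \<le> weight z"
proof -
  have "weight (fst z) * 1 \<le> weight (fst z) * weight (snd z)"
    by (intro mult_left_mono weight_ge_1) simp
  then show ?thesis using weight_Pair[of "fst z" "snd z"] by simp
qed

lemma abs_component_le_weight:
  assumes "b \<in> Basis" shows "\<bar>x \<bullet> b\<bar> \<le> weight x"
proof -
  have "\<bar>x \<bullet> b\<bar> \<le> 1 + (x \<bullet> b)\<^sup>2"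
  proof -
    have "0 \<le> (\<bar>x \<bullet> b\<bar> - 1)\<^sup>2 + (x \<bullet> b)\<^sup>2 + 1" by simp
    then show ?thesis by (simp add: power2_eq_square algebra_simps)
  qed
  also have "\<dots> \<le> weight x"
  proof -
    have "1 \<le> (\<Prod>b\<in>Basis - {b}. 1 + (x \<bullet> b)\<^sup>2)" by (rule prod_ge_1) simp
    then have "(1 + (x \<bullet> b)\<^sup>2) * 1 \<le> (1 + (x \<bullet> b)\<^sup>2) * (\<Prod>b\<in>Basis - {b}. 1 + (x \<bullet> b)\<^sup>2)"
      by (intro mult_left_mono) auto
    also have "\<dots> = weight x"
      unfolding weight_def using assms by (simp add: prod.remove)
    finally show ?thesis by simp
  qed
  finally show ?thesis .
qed

lemma norm_le_weight: "norm (x::'a::euclidean_space) \<le> DIM('a) * weight x"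
proof -
  have "norm x \<le> (\<Sum>b\<in>Basis. \<bar>x \<bullet> b\<bar>)" by (rule norm_le_l1)
  also have "\<dots> \<le> (\<Sum>b\<in>(Basis::'a set). weight x)"
    by (intro sum_mono abs_component_le_weight)
  finally show ?thesis by simp
qed

lemma integrable_inverse_weight: "integrable lborel (\<lambda>x::'a::euclidean_space. 1 / weight x)"
proof -
  have 1: "integrable lborel (\<lambda>t::real. 1 / (1 + t\<^sup>2))"
    using integrable_inverse_1_plus_square by (simp add: set_integrable_def inverse_eq_divide)
  have "(\<integral>\<^sup>+x. ennreal (1 / weight x) \<partial>(lborel :: 'a measure))
      = (\<integral>\<^sup>+x. (\<Prod>b\<in>Basis. ennreal (1 / (1 + (x \<bullet> b)\<^sup>2))) \<partial>(lborel :: 'a measure))"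
    by (subst prod_ennreal) (simp_all add: weight_def prod_dividef)
  also have "\<dots> = (\<Prod>b\<in>(Basis::'a set). (\<integral>\<^sup>+t. ennreal (1 / (1 + t\<^sup>2)) \<partial>lborel))"
    by (subst nn_integral_lborel_prod) (auto)
  also have "\<dots> < \<infinity>"
    using 1 by (subst nn_integral_eq_integral) (auto simp: prod_ennreal less_top[symmetric] ennreal_power)
  finally show ?thesis
    by (intro integrableI_bounded) (auto simp: less_top[symmetric])
qed

lemma inverse_weight_power_le: "m \<ge> 1 \<Longrightarrow> 1 / weight x ^ m \<le> 1 / weight x"
  using weight_ge_1[of x] self_le_power[of "weight x" m]
  by (intro divide_left_mono mult_pos_pos zero_less_power) auto

lemma integrable_inverse_weight_power:
  assumes "m \<ge> 1" shows "integrable lborel (\<lambda>x::'a::euclidean_space. 1 / weight x ^ m)"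
  by (rule Bochner_Integration.integrable_bound[OF integrable_inverse_weight])
     (use inverse_weight_power_le[OF assms] in auto)

lemma integrable_weight_bound:
  fixes f :: "'a::euclidean_space \<Rightarrow> 'b::{banach, second_countable_topology}"
  assumes "f \<in> borel_measurable borel" "\<And>x. norm (f x) \<le> C / weight x"
  shows "integrable lborel f"
proof (rule Bochner_Integration.integrable_bound)
  show "integrable lborel (\<lambda>x::'a. C * (1 / weight x))"
    using integrable_inverse_weight by (rule integrable_mult_right)
  show "AE x in lborel. norm (f x) \<le> norm (C * (1 / weight x))"
    using assms(2) by (intro AE_I2) (metis abs_ge_self order_trans real_norm_def times_divide_eq_right mult.right_neutral)
qed (use assms(1) in simp)

lemma
  fixes f :: "'a::euclidean_space \<Rightarrow> 'b::{banach, second_countable_topology}"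
  assumes c: "c \<noteq> 0" and f[measurable]: "f \<in> borel_measurable borel"
  shows integral_lborel_affine: "(LBINT x. f (t + c *\<^sub>R x)) = (1 / \<bar>c\<bar> ^ DIM('a)) *\<^sub>R (LBINT x. f x)"
    and integrable_lborel_affine: "integrable lborel (\<lambda>x. f (t + c *\<^sub>R x)) \<longleftrightarrow> integrable lborel f"
proof -
  have eq: "(lborel::'a measure) = density (distr lborel borel (\<lambda>x. t + c *\<^sub>R x)) (\<lambda>_. ennreal (\<bar>c\<bar> ^ DIM('a)))"
    using lborel_affine[OF c, of t] by simp
  have [measurable]: "(\<lambda>x. t + c *\<^sub>R x) \<in> borel_measurable borel" by simp
  have "(LBINT x. f x) = (\<integral>x. f x \<partial>density (distr lborel borel (\<lambda>x. t + c *\<^sub>R x)) (\<lambda>_. ennreal (\<bar>c\<bar> ^ DIM('a))))"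
    using eq by metis
  also have "\<dots> = (\<integral>x. \<bar>c\<bar> ^ DIM('a) *\<^sub>R f x \<partial>distr lborel borel (\<lambda>x. t + c *\<^sub>R x))"
    by (subst integral_density) auto
  also have "\<dots> = \<bar>c\<bar> ^ DIM('a) *\<^sub>R (LBINT x. f (t + c *\<^sub>R x))"
    by (subst integral_distr) auto
  finally show "(LBINT x. f (t + c *\<^sub>R x)) = (1 / \<bar>c\<bar> ^ DIM('a)) *\<^sub>R (LBINT x. f x)"
    using c by simp
  have "integrable lborel f \<longleftrightarrow>
      integrable (density (distr lborel borel (\<lambda>x. t + c *\<^sub>R x)) (\<lambda>_. ennreal (\<bar>c\<bar> ^ DIM('a)))) f"
    using eq by metis
  also have "\<dots> \<longleftrightarrow> integrable (distr lborel borel (\<lambda>x. t + c *\<^sub>R x)) (\<lambda>x. \<bar>c\<bar> ^ DIM('a) *\<^sub>R f x)"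
    by (subst integrable_density) auto
  also have "\<dots> \<longleftrightarrow> integrable lborel (\<lambda>x. f (t + c *\<^sub>R x))"
    using c integrable_scaleR_right[of "1 / \<bar>c\<bar> ^ DIM('a)" lborel "\<lambda>x. \<bar>c\<bar> ^ DIM('a) *\<^sub>R f (t + c *\<^sub>R x)"]
    by (subst integrable_distr_eq) auto
  finally show "integrable lborel (\<lambda>x. f (t + c *\<^sub>R x)) \<longleftrightarrow> integrable lborel f" by simp
qed

section \<open>The Schwartz space\<close>

lemma partial_deriv_eq:
  assumes "(f has_derivative D) (at x)" shows "partial_deriv b f x = D b"
proof -
  have "((\<lambda>t. x + t *\<^sub>R b) has_derivative (\<lambda>t. t *\<^sub>R b)) (at (0::real))"
    by (auto intro!: derivative_eq_intros)
  moreover have "(f has_derivative D) (at (x + 0 *\<^sub>R b))"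
    using assms by simp
  ultimately have "((\<lambda>t. f (x + t *\<^sub>R b)) has_derivative (\<lambda>t. D (t *\<^sub>R b))) (at (0::real))"
    by (rule has_derivative_compose)
  moreover have "D (t *\<^sub>R b) = t *\<^sub>R D b" for t
    using has_derivative_bounded_linear[OF assms] by (simp add: linear_simps)
  ultimately have "((\<lambda>t. f (x + t *\<^sub>R b)) has_vector_derivative D b) (at (0::real))"
    by (simp add: has_vector_derivative_def)
  then show ?thesis
    unfolding partial_deriv_def by (rule vector_derivative_at)
qed

lemma iter_deriv_simps [simp]:
  "iter_deriv [] f = f" "iter_deriv (b # bs) f = partial_deriv b (iter_deriv bs f)"
  by (simp_all add: iter_deriv_def)

lemma iter_deriv_snoc: "iter_deriv (bs @ [b]) f = iter_deriv bs (partial_deriv b f)"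
  by (simp add: iter_deriv_def)

lemma iter_deriv_in:
  assumes "f \<in> A" "\<And>f b. f \<in> A \<Longrightarrow> b \<in> Basis \<Longrightarrow> partial_deriv b f \<in> A" "set bs \<subseteq> Basis"
  shows "iter_deriv bs f \<in> A"
  using assms(3) by (induction bs) (auto intro: assms(1,2))

text \<open>
  Closure properties of the Schwartz space are proved without computing iterated derivatives: it is
  enough to exhibit a class of functions that is closed under first partial derivatives.
\<close>
lemma schwartz_coinduct:
  assumes "f \<in> A"
    and "\<And>f. f \<in> A \<Longrightarrow> f differentiable_on UNIV"
    and "\<And>f b. f \<in> A \<Longrightarrow> b \<in> Basis \<Longrightarrow> partial_deriv b f \<in> A"
    and "\<And>f \<alpha>. f \<in> A \<Longrightarrow> bounded (range (\<lambda>x. monomial \<alpha> x *\<^sub>R f x))"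
  shows "f \<in> schwartz"
  unfolding schwartz_def smooth_def
  using iter_deriv_in[of f A, OF assms(1,3)] assms(2,4) by blast

lemma schwartz_partial: "f \<in> schwartz \<Longrightarrow> b \<in> Basis \<Longrightarrow> partial_deriv b f \<in> schwartz"
  unfolding schwartz_def smooth_def
  by (auto simp flip: iter_deriv_snoc)

lemma schwartz_monomial_bounded:
  assumes "f \<in> schwartz" shows "bounded (range (\<lambda>x. monomial \<alpha> x *\<^sub>R f x))"
proof -
  have "set [] \<subseteq> (Basis :: (real ^ 'a) set)" by simp
  then have "bounded (range (\<lambda>x. monomial \<alpha> x *\<^sub>R iter_deriv [] f x))"
    using assms unfolding schwartz_def by blast
  then show ?thesis by simp
qed

lemma schwartz_differentiable:
  assumes "f \<in> schwartz" shows "f differentiable (at x)"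
proof -
  have "set [] \<subseteq> (Basis :: (real ^ 'a) set)" by simp
  then have "iter_deriv [] f differentiable_on UNIV"
    using assms unfolding schwartz_def smooth_def by blast
  then show ?thesis by (simp add: differentiable_on_def)
qed

lemma schwartz_has_derivative:
  assumes "f \<in> schwartz"
  obtains D where "(f has_derivative D) (at x)" "\<And>b. partial_deriv b f x = D b"
  using schwartz_differentiable[OF assms, of x] partial_deriv_eq
  unfolding differentiable_def by metis

lemma schwartz_continuous: "f \<in> schwartz \<Longrightarrow> continuous_on S f"
  by (intro continuous_at_imp_continuous_on)
     (auto intro: differentiable_imp_continuous_within schwartz_differentiable)

lemma schwartz_continuous_compose [continuous_intros]:
  "f \<in> schwartz \<Longrightarrow> continuous_on S h \<Longrightarrow> continuous_on S (\<lambda>x. f (h x))"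
  by (rule continuous_on_compose2[OF schwartz_continuous[of f UNIV]]) auto

lemma schwartz_measurable [measurable_dest]: "f \<in> schwartz \<Longrightarrow> f \<in> borel_measurable borel"
  by (intro borel_measurable_continuous_onI schwartz_continuous)

lemma schwartz_add:
  assumes "f \<in> schwartz" "g \<in> schwartz" shows "(\<lambda>x. f x + g x) \<in> schwartz"
proof (rule schwartz_coinduct[where A = "{\<lambda>x. f x + g x | f g. f \<in> schwartz \<and> g \<in> schwartz}"])
  fix h :: "real ^ 'a \<Rightarrow> complex" assume "h \<in> {\<lambda>x. f x + g x | f g. f \<in> schwartz \<and> g \<in> schwartz}"
  then obtain f g where h: "h = (\<lambda>x. f x + g x)" and fg: "f \<in> schwartz" "g \<in> schwartz"
    by blast
  show "h differentiable_on UNIV"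
    unfolding h differentiable_on_def using fg
    by (intro ballI differentiable_add schwartz_differentiable)
  show "partial_deriv b h \<in> {\<lambda>x. f x + g x | f g. f \<in> schwartz \<and> g \<in> schwartz}"
    if "b \<in> Basis" for b
  proof -
    have "partial_deriv b h = (\<lambda>x. partial_deriv b f x + partial_deriv b g x)"
    proof
      fix x
      obtain D where D: "(f has_derivative D) (at x)" "\<And>b. partial_deriv b f x = D b"
        using schwartz_has_derivative[OF fg(1)] by blast
      obtain E where E: "(g has_derivative E) (at x)" "\<And>b. partial_deriv b g x = E b"
        using schwartz_has_derivative[OF fg(2)] by blast
      have "(h has_derivative (\<lambda>v. D v + E v)) (at x)"
        unfolding h by (intro derivative_intros D E)
      then show "partial_deriv b h x = partial_deriv b f x + partial_deriv b g x"
        by (simp add: partial_deriv_eq D E)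
    qed
    then show ?thesis using fg that schwartz_partial by blast
  qed
  show "bounded (range (\<lambda>x. monomial \<alpha> x *\<^sub>R h x))" for \<alpha>
    unfolding h scaleR_add_right using fg
    by (intro bounded_plus_comp schwartz_monomial_bounded)
qed (use assms in blast)

text \<open>
  The closure properties below have this shape: differentiating \<open>L f\<close> amounts to applying \<open>L\<close> to another
  Schwartz function, so that the image of the Schwartz space under \<open>L\<close> is closed under derivatives.
\<close>
lemma
  assumes f: "f \<in> schwartz"
    and D: "\<And>f x. f \<in> schwartz \<Longrightarrow> \<exists>D. (L f has_derivative D) (at x) \<and> (\<forall>b. D b = L (M b f) x)"
    and M: "\<And>f b. f \<in> schwartz \<Longrightarrow> b \<in> Basis \<Longrightarrow> M b f \<in> schwartz"
    and bd: "\<And>f \<alpha>. f \<in> schwartz \<Longrightarrow> \<exists>C. \<forall>x. norm (monomial \<alpha> x *\<^sub>R L f x) \<le> C"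
  shows schwartz_operator: "L f \<in> schwartz"
    and partial_deriv_operator: "partial_deriv b (L f) = L (M b f)"
proof -
  have pd: "partial_deriv b (L f) = L (M b f)" if "f \<in> schwartz" for f b
  proof
    fix x
    show "partial_deriv b (L f) x = L (M b f) x" using D[OF that, of x] partial_deriv_eq by metis
  qed
  show "partial_deriv b (L f) = L (M b f)" by (rule pd[OF f])
  show "L f \<in> schwartz"
  proof (rule schwartz_coinduct[where A = "L ` schwartz"])
    fix h assume "h \<in> L ` schwartz"
    then obtain f where h: "h = L f" and f: "f \<in> schwartz" by blast
    show "h differentiable_on UNIV"
      unfolding differentiable_on_def differentiable_def h using D[OF f] by blast
    show "partial_deriv b h \<in> L ` schwartz" if "b \<in> Basis" for b
      unfolding h pd[OF f] using M[OF f that] by blast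
    show "bounded (range (\<lambda>x. monomial \<alpha> x *\<^sub>R h x))" for \<alpha>
      using bd[OF f, of \<alpha>] unfolding bounded_iff h by blast
  qed (use f in blast)
qed

lemma schwartz_monomial_bound: "f \<in> schwartz \<Longrightarrow> \<exists>C. \<forall>x. norm (monomial \<alpha> x *\<^sub>R f x) \<le> C"
  using schwartz_monomial_bounded[of f \<alpha>] by (auto simp: bounded_iff)

lemma schwartz_cmult:
  assumes "f \<in> schwartz" shows "(\<lambda>x. c * f x) \<in> schwartz"
proof (rule schwartz_operator[where M = partial_deriv, OF assms])
  fix f :: "real ^ 'a \<Rightarrow> complex" assume f: "f \<in> schwartz"
  show "\<exists>D. ((\<lambda>x. c * f x) has_derivative D) (at x) \<and> (\<forall>b. D b = c * partial_deriv b f x)" for x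
  proof -
    obtain D where D: "(f has_derivative D) (at x)" "\<And>b. partial_deriv b f x = D b"
      using schwartz_has_derivative[OF f] by blast
    then show ?thesis using has_derivative_mult_right[OF D(1), of c] by auto
  qed
  show "\<exists>C. \<forall>x. norm (monomial \<alpha> x *\<^sub>R (c * f x)) \<le> C" for \<alpha>
  proof -
    obtain C where "\<And>x. norm (monomial \<alpha> x *\<^sub>R f x) \<le> C"
      using schwartz_monomial_bound[OF f] by blast
    from mult_left_mono[OF this norm_ge_zero[of c]] show ?thesis
      by (intro exI[of _ "cmod c * C"]) (simp add: norm_mult mult.left_commute)
  qed
qed (rule schwartz_partial)

lemma schwartz_diff:
  assumes "f \<in> schwartz" "g \<in> schwartz" shows "(\<lambda>x. f x - g x) \<in> schwartz"
  using schwartz_add[OF assms(1) schwartz_cmult[OF assms(2), of "-1"]] by simp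

lemma schwartz_uminus: "f \<in> schwartz \<Longrightarrow> (\<lambda>x. - f x) \<in> schwartz"
  using schwartz_cmult[of f "-1"] by simp

lemma schwartz_0: "(\<lambda>x. 0) \<in> schwartz"
  by (simp add: schwartz_def smooth_def iter_deriv_zero image_constant_conv)

lemma
  assumes f: "f \<in> schwartz"
  shows schwartz_cnj: "(\<lambda>x. cnj (f x)) \<in> schwartz"
    and partial_deriv_cnj: "partial_deriv b (\<lambda>x. cnj (f x)) = (\<lambda>x. cnj (partial_deriv b f x))"
proof -
  have D: "\<exists>D. ((\<lambda>x. cnj (f x)) has_derivative D) (at x) \<and> (\<forall>b. D b = cnj (partial_deriv b f x))"
    if f: "f \<in> schwartz" for f :: "real ^ 'a \<Rightarrow> complex" and x
  proof -
    obtain D where D: "(f has_derivative D) (at x)" "\<And>b. partial_deriv b f x = D b"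
      using schwartz_has_derivative[OF f] by blast
    then show ?thesis using has_derivative_cnj[OF D(1)] by (intro exI[of _ "\<lambda>v. cnj (D v)"]) simp
  qed
  have bd: "\<exists>C. \<forall>x. norm (monomial \<alpha> x *\<^sub>R cnj (f x)) \<le> C"
    if f: "f \<in> schwartz" for f :: "real ^ 'a \<Rightarrow> complex" and \<alpha>
    using schwartz_monomial_bound[OF f, of \<alpha>] by simp
  show "(\<lambda>x. cnj (f x)) \<in> schwartz"
    by (rule schwartz_operator[OF f D schwartz_partial bd])
  show "partial_deriv b (\<lambda>x. cnj (f x)) = (\<lambda>x. cnj (partial_deriv b f x))"
    by (rule partial_deriv_operator[OF f D schwartz_partial bd])
qed

lemma schwartz_reflect:
  assumes "f \<in> schwartz" shows "(\<lambda>x. f (- x)) \<in> schwartz"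
proof (rule schwartz_operator[where M = "\<lambda>b f x. - partial_deriv b f x", OF assms])
  fix f :: "real ^ 'a \<Rightarrow> complex" assume f: "f \<in> schwartz"
  show "\<exists>D. ((\<lambda>x. f (- x)) has_derivative D) (at x) \<and> (\<forall>b. D b = - partial_deriv b f (- x))" for x
  proof -
    obtain D where D: "(f has_derivative D) (at (- x))" "\<And>b. partial_deriv b f (- x) = D b"
      using schwartz_has_derivative[OF f] by blast
    have "((\<lambda>x. - x) has_derivative (\<lambda>v. - v)) (at x)" by (auto intro!: derivative_eq_intros)
    from has_derivative_compose[OF this D(1)] show ?thesis
      using linear_neg[OF has_derivative_linear[OF D(1)]] D(2) by auto
  qed
  show "\<exists>C. \<forall>x. norm (monomial \<alpha> x *\<^sub>R f (- x)) \<le> C" for \<alpha>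
  proof -
    obtain C where "\<And>x. norm (monomial \<alpha> x *\<^sub>R f x) \<le> C"
      using schwartz_monomial_bound[OF f] by blast
    from this[of "- _"] show ?thesis by (auto simp: monomial_def abs_prod power_abs)
  qed
  show "(\<lambda>x. - partial_deriv b f x) \<in> schwartz" if "b \<in> Basis" for b
    by (intro schwartz_uminus schwartz_partial f that)
qed

lemma axis_inner: "x \<bullet> axis j 1 = (x $ j :: real)"
  by (simp add: inner_axis)

lemma axis_in_Basis: "axis j (1::real) \<in> Basis"
  by (simp add: axis_in_Basis_iff)

lemma Basis_axis:
  assumes "b \<in> (Basis :: (real ^ 'n) set)" obtains j where "b = axis j 1"
  using assms by (auto simp: Basis_vec_def)

text \<open>
  The product rule takes \<open>x\<^sub>j f\<close> out of the set of all such products, but not out of the sums of a product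
  and a Schwartz function.
\<close>
lemma schwartz_coord:
  assumes "f \<in> schwartz" shows "(\<lambda>x. complex_of_real (x $ j) * f x) \<in> schwartz"
proof (rule schwartz_coinduct
    [where A = "{\<lambda>x. complex_of_real (x $ j) * f x + g x | f g. f \<in> schwartz \<and> g \<in> schwartz}"])
  fix h :: "real ^ 'a \<Rightarrow> complex"
  assume "h \<in> {\<lambda>x. complex_of_real (x $ j) * f x + g x | f g. f \<in> schwartz \<and> g \<in> schwartz}"
  then obtain f g where h: "h = (\<lambda>x. complex_of_real (x $ j) * f x + g x)"
    and fg: "f \<in> schwartz" "g \<in> schwartz"
    by blast
  have D: "\<exists>D. (h has_derivative D) (at x) \<and> (\<forall>b. D b = complex_of_real (x $ j) * partial_deriv b f x
     + (complex_of_real (b $ j) * f x + partial_deriv b g x))" for x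
  proof -
    obtain D where D: "(f has_derivative D) (at x)" "\<And>b. partial_deriv b f x = D b"
      using schwartz_has_derivative[OF fg(1)] by blast
    obtain E where E: "(g has_derivative E) (at x)" "\<And>b. partial_deriv b g x = E b"
      using schwartz_has_derivative[OF fg(2)] by blast
    have 1: "((\<lambda>x. complex_of_real (x $ j)) has_derivative (\<lambda>v. complex_of_real (v $ j))) (at x)"
      by (intro bounded_linear_imp_has_derivative bounded_linear_compose[OF bounded_linear_of_real]
           bounded_linear_vec_nth)
    show ?thesis
      using has_derivative_add[OF has_derivative_mult[OF 1 D(1)] E(1)] unfolding h
      by (intro exI conjI allI) (assumption, simp add: D(2) E(2))
  qed
  then show "h differentiable_on UNIV"
    unfolding differentiable_on_def differentiable_def by blast
  show "partial_deriv b h \<in> {\<lambda>x. complex_of_real (x $ j) * f x + g x | f g. f \<in> schwartz \<and> g \<in> schwartz}"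
    if "b \<in> Basis" for b
  proof -
    have "partial_deriv b h = (\<lambda>x. complex_of_real (x $ j) * partial_deriv b f x
       + (complex_of_real (b $ j) * f x + partial_deriv b g x))"
    proof
      fix x
      show "partial_deriv b h x = complex_of_real (x $ j) * partial_deriv b f x
         + (complex_of_real (b $ j) * f x + partial_deriv b g x)"
        using D[of x] partial_deriv_eq by metis
    qed
    moreover have "(\<lambda>x. complex_of_real (b $ j) * f x + partial_deriv b g x) \<in> schwartz"
      using fg that by (intro schwartz_add schwartz_cmult schwartz_partial)
    ultimately show ?thesis using schwartz_partial[OF fg(1) that] by auto
  qed
  show "bounded (range (\<lambda>x. monomial \<alpha> x *\<^sub>R h x))" for \<alpha>
  proof -
    have "monomial (\<alpha>(j := Suc (\<alpha> j))) x = monomial \<alpha> x * x $ j" for x :: "real ^ 'a"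
      unfolding monomial_def by (simp add: prod.remove[of UNIV j] mult_ac)
    then have "monomial \<alpha> x *\<^sub>R h x = monomial (\<alpha>(j := Suc (\<alpha> j))) x *\<^sub>R f x + monomial \<alpha> x *\<^sub>R g x" for x
      by (simp add: h scaleR_conv_of_real algebra_simps)
    then show ?thesis using fg
      by (simp only:) (intro bounded_plus_comp schwartz_monomial_bounded)
  qed
qed (use assms schwartz_0 in force)

lemma schwartz_W_op: "f \<in> schwartz \<Longrightarrow> W_op k f \<in> schwartz"
  by (cases k) (simp_all add: schwartz_coord schwartz_cmult schwartz_uminus schwartz_partial axis_in_Basis)

lemma weight_vec: "weight (x :: real ^ 'n) = (\<Prod>j\<in>UNIV. 1 + (x $ j)\<^sup>2)"
proof -
  have "bij_betw (\<lambda>i. axis i 1) UNIV (Basis :: (real ^ 'n) set)"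
    unfolding bij_betw_def by (auto simp: inj_on_def axis_eq_axis Basis_vec_def)
  from prod.reindex_bij_betw[OF this, of "\<lambda>b. 1 + (x \<bullet> b)\<^sup>2"]
  show ?thesis by (simp add: weight_def axis_inner)
qed

text \<open>
  Together with boundedness this gives decay against every power of the weight, a form that is stable under
  translations, unlike the bounds for single monomials.
\<close>
lemma schwartz_weight:
  assumes "f \<in> schwartz" shows "(\<lambda>x. complex_of_real (weight x ^ m) * f x) \<in> schwartz"
proof -
  have 1: "(\<lambda>x. complex_of_real (1 + (x $ j)\<^sup>2) * f x) \<in> schwartz" if "f \<in> schwartz"
    for f :: "real ^ 'a \<Rightarrow> complex" and j
    using schwartz_add[OF that schwartz_coord[OF schwartz_coord[OF that]]]
    by (simp add: power2_eq_square algebra_simps)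
  have "(\<lambda>x. complex_of_real (\<Prod>j\<in>K. 1 + (x $ j)\<^sup>2) * f x) \<in> schwartz" if "f \<in> schwartz" "finite K"
    for f :: "real ^ 'a \<Rightarrow> complex" and K
    using that(2,1)
  proof (induction K)
    case (insert j K)
    show ?case using 1[OF insert.IH[OF insert.prems], of j] insert.hyps by (simp add: mult.assoc)
  qed simp
  then have 2: "(\<lambda>x. complex_of_real (weight x) * f x) \<in> schwartz" if "f \<in> schwartz"
    for f :: "real ^ 'a \<Rightarrow> complex" using that by (simp add: weight_vec)
  show ?thesis
  proof (induction m)
    case (Suc m)
    show ?case using 2[OF Suc] by (simp add: mult.assoc)
  qed (simp add: assms)
qed

lemma schwartz_bound:
  assumes "f \<in> schwartz" obtains C where "C > 0" "\<And>x. cmod (f x) \<le> C / weight x ^ m"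
proof -
  obtain C where C: "\<And>x. norm (monomial (\<lambda>_. 0) x *\<^sub>R (complex_of_real (weight x ^ m) * f x)) \<le> C"
    using schwartz_monomial_bounded[OF schwartz_weight[OF assms, of m], of "\<lambda>_. 0"]
    by (auto simp: bounded_iff)
  have "cmod (f x) \<le> (\<bar>C\<bar> + 1) / weight x ^ m" for x
    using C[of x] by (simp add: monomial_def norm_mult norm_power field_simps)
  then show ?thesis by (intro that[of "\<bar>C\<bar> + 1"]) auto
qed

lemma monomial_le_weight: "\<bar>monomial \<alpha> x\<bar> \<le> weight x ^ (\<Sum>j\<in>UNIV. \<alpha> j)"
proof -
  have "\<bar>monomial \<alpha> x\<bar> = (\<Prod>j\<in>UNIV. \<bar>x $ j\<bar> ^ \<alpha> j)"
    by (simp add: monomial_def abs_prod power_abs)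
  also have "\<dots> \<le> (\<Prod>j\<in>UNIV. weight x ^ \<alpha> j)"
    using abs_component_le_weight[OF axis_in_Basis, of x] by (intro prod_mono) (auto intro!: power_mono simp: axis_inner)
  finally show ?thesis by (simp add: power_sum)
qed

section \<open>Time-frequency shifts\<close>

text \<open>
  Translation by \<open>fst z\<close> followed by modulation with \<open>snd z\<close>. The symmetrising phase of the Weyl operators is left
  out: the phases of the shifts cancel or disappear in absolute values.
\<close>
definition tf :: "'n::finite phase_space \<Rightarrow> (real ^ 'n \<Rightarrow> complex) \<Rightarrow> real ^ 'n \<Rightarrow> complex" where
  "tf z f x = iexp (snd z \<bullet> x) * f (x - fst z)"

lemma cmod_tf: "cmod (tf z f x) = cmod (f (x - fst z))"
  by (simp add: tf_def norm_mult)

lemma tf_bound: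
  fixes f :: "real ^ 'n::finite \<Rightarrow> complex"
  assumes "\<And>x. cmod (f x) \<le> C / weight x ^ m"
  shows "cmod (tf z f x) \<le> C * (2 ^ CARD('n) * weight (fst z)) ^ m / weight x ^ m"
proof -
  have "0 \<le> C / weight (0::real ^ 'n) ^ m" by (rule order_trans[OF norm_ge_zero assms])
  then have "C \<ge> 0" by simp
  have "cmod (tf z f x) \<le> C * (1 / weight (x - fst z)) ^ m"
    using assms[of "x - fst z"] by (simp add: cmod_tf power_divide)
  also have "\<dots> \<le> C * (2 ^ CARD('n) * weight (fst z) / weight x) ^ m"
    using inverse_weight_shift[of x "fst z"] \<open>C \<ge> 0\<close> by (intro mult_left_mono power_mono) auto
  finally show ?thesis by (simp add: power_divide)
qed

lemma tf_has_derivative: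
  assumes "f \<in> schwartz"
  shows "\<exists>D. (tf z f has_derivative D) (at x) \<and>
    (\<forall>b. D b = tf z (\<lambda>x. \<i> * complex_of_real (snd z \<bullet> b) * f x + partial_deriv b f x) x)"
proof -
  obtain D where D: "(f has_derivative D) (at (x - fst z))" "\<And>b. partial_deriv b f (x - fst z) = D b"
    using schwartz_has_derivative[OF assms] by blast
  have "((\<lambda>x. x - fst z) has_derivative (\<lambda>v. v)) (at x)"
    by (auto intro!: derivative_eq_intros)
  from has_derivative_compose[OF this D(1)]
  have 1: "((\<lambda>x. f (x - fst z)) has_derivative D) (at x)" .
  have "((\<lambda>x. \<i> * complex_of_real (snd z \<bullet> x)) has_derivative (\<lambda>v. \<i> * complex_of_real (snd z \<bullet> v))) (at x)"
    by (intro derivative_eq_intros bounded_linear_imp_has_derivative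
         bounded_linear_compose[OF bounded_linear_of_real] bounded_linear_inner_right) auto
  from has_derivative_compose[OF this, of exp, OF DERIV_exp[unfolded has_field_derivative_def]]
  have 2: "((\<lambda>x. iexp (snd z \<bullet> x)) has_derivative
    (\<lambda>v. iexp (snd z \<bullet> x) * (\<i> * complex_of_real (snd z \<bullet> v)))) (at x)" .
  show ?thesis
    using has_derivative_mult[OF 2 1] D(2) unfolding tf_def
    by (intro exI conjI allI) (assumption, simp add: algebra_simps)
qed

text \<open>
  Differentiating the exponential only adds a multiple of \<open>f\<close>. The decay of shifted functions comes from the
  behaviour of the weight under translations.
\<close>
lemma
  assumes f: "f \<in> schwartz"
  shows schwartz_tf: "tf z f \<in> schwartz"
    and partial_deriv_tf:
      "partial_deriv b (tf z f) = tf z (\<lambda>x. \<i> * complex_of_real (snd z \<bullet> b) * f x + partial_deriv b f x)"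
proof -
  have M: "(\<lambda>x. \<i> * complex_of_real (snd z \<bullet> b) * f x + partial_deriv b f x) \<in> schwartz"
    if "f \<in> schwartz" "b \<in> Basis" for f :: "real ^ 'a \<Rightarrow> complex" and b
    using that by (intro schwartz_add schwartz_cmult schwartz_partial)
  have bd: "\<exists>C. \<forall>x. norm (monomial \<alpha> x *\<^sub>R tf z f x) \<le> C"
    if f: "f \<in> schwartz" for f :: "real ^ 'a \<Rightarrow> complex" and \<alpha>
  proof -
    define m where "m = (\<Sum>j\<in>UNIV. \<alpha> j)"
    obtain C where C: "\<And>x. cmod (f x) \<le> C / weight x ^ m"
      using schwartz_bound[OF f] by metis
    have "norm (monomial \<alpha> x *\<^sub>R tf z f x) \<le> C * (2 ^ CARD('a) * weight (fst z)) ^ m" for x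
    proof -
      have "norm (monomial \<alpha> x *\<^sub>R tf z f x)
          \<le> weight x ^ m * (C * (2 ^ CARD('a) * weight (fst z)) ^ m / weight x ^ m)"
        unfolding norm_scaleR m_def
        by (intro mult_mono monomial_le_weight tf_bound[OF C, unfolded m_def]) auto
      then show ?thesis by simp
    qed
    then show ?thesis by blast
  qed
  note op = f tf_has_derivative M bd
  show "tf z f \<in> schwartz" by (rule schwartz_operator[OF op])
  show "partial_deriv b (tf z f) = tf z (\<lambda>x. \<i> * complex_of_real (snd z \<bullet> b) * f x + partial_deriv b f x)"
    by (rule partial_deriv_operator[OF op])
qed

section \<open>Square integrable functions\<close>

lemma L2_measurable [measurable_dest]: "f \<in> L2 \<Longrightarrow> f \<in> borel_measurable borel"
  by (simp add: L2_def)

lemma L2_integrable: "f \<in> L2 \<Longrightarrow> integrable lborel (\<lambda>x. (cmod (f x))\<^sup>2)"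
  by (simp add: L2_def)

lemma L2_norm_nonneg [simp]: "L2_norm f \<ge> 0"
  by (simp add: L2_norm_def)

lemma L2_integrable_mult:
  assumes "f \<in> L2" "g \<in> L2" shows "integrable lborel (\<lambda>x. f x * g x)"
proof (rule Bochner_Integration.integrable_bound)
  show "integrable lborel (\<lambda>x. (cmod (f x))\<^sup>2 + (cmod (g x))\<^sup>2)"
    using assms by (intro Bochner_Integration.integrable_add L2_integrable)
  show "(\<lambda>x. f x * g x) \<in> borel_measurable lborel" using assms by measurable
  have "a * b \<le> a\<^sup>2 + b\<^sup>2" if "a \<ge> 0" "b \<ge> 0" for a b :: real
  proof -
    have "0 \<le> (a - b)\<^sup>2 + a * b" using that by simp
    then show ?thesis by (simp add: power2_eq_square algebra_simps)
  qed
  then show "AE x in lborel. cmod (f x * g x) \<le> norm ((cmod (f x))\<^sup>2 + (cmod (g x))\<^sup>2)"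
    by (auto simp: norm_mult intro!: order_trans[OF _ abs_ge_self])
qed

lemma L2_Cauchy_Schwarz_abs:
  assumes "f \<in> L2" "g \<in> L2"
  shows "(LBINT x. cmod (f x * g x)) \<le> L2_norm f * L2_norm g"
proof -
  note [measurable] = assms[THEN L2_measurable]
  have int: "integrable lborel (\<lambda>x. cmod (f x * g x))"
    by (intro integrable_norm L2_integrable_mult assms)
  let ?I = "\<integral>x. cmod (f x * g x) \<partial>lborel"
  have nn: "(\<integral>\<^sup>+x. (ennreal (cmod (h x)))\<^sup>2 \<partial>lborel) = ennreal ((L2_norm h)\<^sup>2)" if "h \<in> L2"
    for h :: "'a \<Rightarrow> complex"
  proof -
    have "(\<integral>\<^sup>+x. (ennreal (cmod (h x)))\<^sup>2 \<partial>lborel) = (\<integral>\<^sup>+x. ennreal ((cmod (h x))\<^sup>2) \<partial>lborel)"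
      by (simp add: ennreal_power)
    also have "\<dots> = ennreal (LBINT x. (cmod (h x))\<^sup>2)"
      by (intro nn_integral_eq_integral L2_integrable that) auto
    finally show ?thesis by (simp add: L2_norm_def)
  qed
  have "ennreal (?I\<^sup>2) = (ennreal ?I)\<^sup>2"
    by (simp add: ennreal_power)
  also have "ennreal ?I = (\<integral>\<^sup>+x. ennreal (cmod (f x)) * ennreal (cmod (g x)) \<partial>lborel)"
    by (subst nn_integral_eq_integral[OF int, symmetric]) (auto simp: norm_mult ennreal_mult)
  also have "\<dots>\<^sup>2 \<le> ennreal ((L2_norm f)\<^sup>2) * ennreal ((L2_norm g)\<^sup>2)"
    unfolding nn[OF assms(1), symmetric] nn[OF assms(2), symmetric]
    by (rule Cauchy_Schwarz_nn_integral) measurable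
  also have "\<dots> = ennreal ((L2_norm f * L2_norm g)\<^sup>2)"
    by (simp add: ennreal_mult power_mult_distrib)
  finally have "?I\<^sup>2 \<le> (L2_norm f * L2_norm g)\<^sup>2"
    by (simp add: ennreal_le_iff)
  then show ?thesis by (rule power2_le_imp_le) simp
qed

lemma L2_Cauchy_Schwarz:
  "f \<in> L2 \<Longrightarrow> g \<in> L2 \<Longrightarrow> cmod (LBINT x. f x * g x) \<le> L2_norm f * L2_norm g"
  by (rule order_trans[OF integral_norm_bound L2_Cauchy_Schwarz_abs])

lemma
  fixes f :: "'a::euclidean_space \<Rightarrow> complex"
  assumes [measurable]: "f \<in> borel_measurable borel" and f: "\<And>x. cmod (f x) \<le> C / weight x"
  shows L2_weightI: "f \<in> L2"
    and L2_norm_weight_le: "L2_norm f \<le> C * sqrt (LBINT x. 1 / weight (x::'a) ^ 2)"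
proof -
  have "0 \<le> C / weight (0::'a)" by (rule order_trans[OF norm_ge_zero f])
  then have C: "C \<ge> 0" by simp
  have sq: "(cmod (f x))\<^sup>2 \<le> C\<^sup>2 * (1 / (weight x)\<^sup>2)" for x
    using power_mono[OF f norm_ge_zero, of x 2] by (simp add: power_divide)
  have int: "integrable lborel (\<lambda>x::'a. C\<^sup>2 * (1 / (weight x)\<^sup>2))"
    by (intro integrable_mult_right integrable_inverse_weight_power) simp
  have int2: "integrable lborel (\<lambda>x. (cmod (f x))\<^sup>2)"
    using sq by (intro Bochner_Integration.integrable_bound[OF int]) auto
  then show "f \<in> L2" by (simp add: L2_def)
  have "L2_norm f \<le> sqrt (LBINT x. C\<^sup>2 * (1 / weight (x::'a) ^ 2))"
    unfolding L2_norm_def by (intro real_sqrt_le_mono integral_mono int int2 sq)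
  then show "L2_norm f \<le> C * sqrt (LBINT x. 1 / weight (x::'a) ^ 2)"
    using C by (simp only: integral_mult_right_zero real_sqrt_mult real_sqrt_abs abs_of_nonneg)
qed

lemma L2_cmult: "f \<in> L2 \<Longrightarrow> (\<lambda>x. c * f x) \<in> L2"
  by (auto simp: L2_def norm_mult power_mult_distrib)

lemma L2_add:
  assumes "f \<in> L2" "g \<in> L2" shows "(\<lambda>x. f x + g x) \<in> L2"
proof -
  note [measurable] = assms[THEN L2_measurable]
  have "integrable lborel (\<lambda>x. (cmod (f x + g x))\<^sup>2)"
  proof (rule Bochner_Integration.integrable_bound)
    show "integrable lborel (\<lambda>x. 2 * (cmod (f x))\<^sup>2 + 2 * (cmod (g x))\<^sup>2)"
      using assms by (intro Bochner_Integration.integrable_add integrable_mult_right L2_integrable)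
    have "(cmod (a + b))\<^sup>2 \<le> 2 * (cmod a)\<^sup>2 + 2 * (cmod b)\<^sup>2" for a b
    proof -
      have "(cmod (a + b))\<^sup>2 \<le> (cmod a + cmod b)\<^sup>2"
        by (intro power_mono norm_triangle_ineq) simp
      also have "\<dots> \<le> 2 * (cmod a)\<^sup>2 + 2 * (cmod b)\<^sup>2"
        using sum_squares_bound[of "cmod a" "cmod b"] by (simp add: power2_sum)
      finally show ?thesis .
    qed
    then show "AE x in lborel. norm ((cmod (f x + g x))\<^sup>2) \<le> norm (2 * (cmod (f x))\<^sup>2 + 2 * (cmod (g x))\<^sup>2)"
      by (auto intro!: order_trans[OF _ abs_ge_self])
  qed measurable
  moreover have "(\<lambda>x. f x + g x) \<in> borel_measurable lborel" by measurable
  ultimately show ?thesis by (simp add: L2_def)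
qed

text \<open>
  Dominated convergence in the \<open>L\<^sup>2\<close> norm, with the inverse weight as the square integrable majorant.
\<close>
lemma L2_norm_tendsto_0:
  fixes F :: "nat \<Rightarrow> 'a::euclidean_space \<Rightarrow> complex"
  assumes [measurable]: "\<And>n. F n \<in> borel_measurable borel"
    and b: "\<And>n x. cmod (F n x) \<le> C / weight x"
    and lim: "\<And>x. (\<lambda>n. F n x) \<longlonglongrightarrow> 0"
  shows "(\<lambda>n. L2_norm (F n)) \<longlonglongrightarrow> 0"
proof -
  have sq: "(cmod (F n x))\<^sup>2 \<le> C\<^sup>2 * (1 / (weight x)\<^sup>2)" for n x
    using power_mono[OF b norm_ge_zero, of n x 2] by (simp add: power_divide)
  have int: "integrable lborel (\<lambda>x::'a. C\<^sup>2 * (1 / (weight x)\<^sup>2))"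
    by (intro integrable_mult_right integrable_inverse_weight_power) simp
  have "(\<lambda>n. \<integral>x. (cmod (F n x))\<^sup>2 \<partial>lborel) \<longlonglongrightarrow> (\<integral>x. 0 \<partial>(lborel::'a measure))"
  proof (rule integral_dominated_convergence[OF _ _ int])
    have "(\<lambda>n. (cmod (F n x))\<^sup>2) \<longlonglongrightarrow> 0" for x
      using tendsto_power[OF tendsto_norm[OF lim], of x 2] by simp
    then show "AE x in lborel. (\<lambda>n. (cmod (F n x))\<^sup>2) \<longlonglongrightarrow> 0" by simp
  qed (use sq in auto)
  from tendsto_real_sqrt[OF this] show ?thesis by (simp add: L2_norm_def)
qed

lemma L2_norm_cnj: "L2_norm (\<lambda>x. cnj (f x)) = L2_norm f"
  by (simp add: L2_norm_def)

lemma L2_norm_tf: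
  assumes [measurable]: "f \<in> borel_measurable borel"
  shows "L2_norm (tf z f) = L2_norm f"
proof -
  have "(LBINT x. (cmod (f (x - fst z)))\<^sup>2) = (LBINT x. (cmod (f x))\<^sup>2)"
    using integral_lborel_affine[of 1 "\<lambda>x. (cmod (f x))\<^sup>2" "- fst z"] by simp
  then show ?thesis by (simp add: L2_norm_def cmod_tf)
qed

lemma schwartz_L2:
  assumes "f \<in> schwartz" shows "f \<in> L2"
proof -
  obtain C where "\<And>x. cmod (f x) \<le> C / weight x ^ 1" using schwartz_bound[OF assms] by metis
  then show ?thesis using assms by (intro L2_weightI[of f C]) (auto intro: schwartz_measurable)
qed

section \<open>Operators with bounded commutators\<close>

text \<open>
  The bilinear form \<open>(\<phi>, \<psi>) \<mapsto> S \<phi> \<psi>\<close> on Schwartz functions is all that the estimates need to know about a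
  bounded operator. In contrast to the operator on representatives, it is linear everywhere and not only up to
  null sets.
\<close>
definition L2_form :: "((real ^ 'n::finite \<Rightarrow> complex) \<Rightarrow> 'n functional) \<Rightarrow> bool" where
  "L2_form S \<longleftrightarrow>
     (\<forall>\<phi>\<in>schwartz. linear_on_schwartz (S \<phi>)) \<and>
     (\<forall>\<psi>\<in>schwartz. linear_on_schwartz (\<lambda>\<phi>. S \<phi> \<psi>)) \<and>
     (\<exists>C. \<forall>\<phi>\<in>schwartz. \<forall>\<psi>\<in>schwartz. cmod (S \<phi> \<psi>) \<le> C * L2_norm \<phi> * L2_norm \<psi>)"

lemma L2_formD:
  assumes "L2_form S" "\<phi> \<in> schwartz" "\<psi> \<in> schwartz"
  shows L2_form_add_right: "\<psi>' \<in> schwartz \<Longrightarrow> S \<phi> (\<lambda>x. \<psi> x + \<psi>' x) = S \<phi> \<psi> + S \<phi> \<psi>'"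
    and L2_form_cmult_right: "S \<phi> (\<lambda>x. c * \<psi> x) = c * S \<phi> \<psi>"
    and L2_form_add_left: "\<phi>' \<in> schwartz \<Longrightarrow> S (\<lambda>x. \<phi> x + \<phi>' x) \<psi> = S \<phi> \<psi> + S \<phi>' \<psi>"
    and L2_form_cmult_left: "S (\<lambda>x. c * \<phi> x) \<psi> = c * S \<phi> \<psi>"
    and L2_form_diff_right: "\<psi>' \<in> schwartz \<Longrightarrow> S \<phi> (\<lambda>x. \<psi> x - \<psi>' x) = S \<phi> \<psi> - S \<phi> \<psi>'"
    and L2_form_diff_left: "\<phi>' \<in> schwartz \<Longrightarrow> S (\<lambda>x. \<phi> x - \<phi>' x) \<psi> = S \<phi> \<psi> - S \<phi>' \<psi>"
proof -
  have ar: "S \<phi> (\<lambda>x. \<psi> x + \<psi>' x) = S \<phi> \<psi> + S \<phi> \<psi>'" if "\<phi> \<in> schwartz" "\<psi> \<in> schwartz" "\<psi>' \<in> schwartz"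
    for \<phi> \<psi> \<psi>' using assms(1) that by (simp add: L2_form_def linear_on_schwartz_def)
  have cr: "S \<phi> (\<lambda>x. c * \<psi> x) = c * S \<phi> \<psi>" if "\<phi> \<in> schwartz" "\<psi> \<in> schwartz"
    for \<phi> \<psi> c using assms(1) that by (simp add: L2_form_def linear_on_schwartz_def)
  have al: "S (\<lambda>x. \<phi> x + \<phi>' x) \<psi> = S \<phi> \<psi> + S \<phi>' \<psi>" if "\<phi> \<in> schwartz" "\<psi> \<in> schwartz" "\<phi>' \<in> schwartz"
    for \<phi> \<psi> \<phi>' using assms(1) that by (simp add: L2_form_def linear_on_schwartz_def)
  have cl: "S (\<lambda>x. c * \<phi> x) \<psi> = c * S \<phi> \<psi>" if "\<phi> \<in> schwartz" "\<psi> \<in> schwartz"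
    for \<phi> \<psi> c using assms(1) that by (simp add: L2_form_def linear_on_schwartz_def)
  show "\<psi>' \<in> schwartz \<Longrightarrow> S \<phi> (\<lambda>x. \<psi> x + \<psi>' x) = S \<phi> \<psi> + S \<phi> \<psi>'"
    by (rule ar[OF assms(2,3)])
  show "S \<phi> (\<lambda>x. c * \<psi> x) = c * S \<phi> \<psi>"
    by (rule cr[OF assms(2,3)])
  show "\<phi>' \<in> schwartz \<Longrightarrow> S (\<lambda>x. \<phi> x + \<phi>' x) \<psi> = S \<phi> \<psi> + S \<phi>' \<psi>"
    by (rule al[OF assms(2,3)])
  show "S (\<lambda>x. c * \<phi> x) \<psi> = c * S \<phi> \<psi>"
    by (rule cl[OF assms(2,3)])
  show "S \<phi> (\<lambda>x. \<psi> x - \<psi>' x) = S \<phi> \<psi> - S \<phi> \<psi>'" if "\<psi>' \<in> schwartz"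
    using ar[OF assms(2,3) schwartz_cmult[OF that, of "-1"]] cr[OF assms(2) that, of "-1"] by simp
  show "S (\<lambda>x. \<phi> x - \<phi>' x) \<psi> = S \<phi> \<psi> - S \<phi>' \<psi>" if "\<phi>' \<in> schwartz"
    using al[OF assms(2,3) schwartz_cmult[OF that, of "-1"]] cl[OF that assms(3), of "-1"] by simp
qed

lemma L2_form_bound:
  assumes "L2_form S"
  obtains C where "C > 0"
    "\<And>\<phi> \<psi>. \<phi> \<in> schwartz \<Longrightarrow> \<psi> \<in> schwartz \<Longrightarrow> cmod (S \<phi> \<psi>) \<le> C * L2_norm \<phi> * L2_norm \<psi>"
proof -
  obtain C where C: "\<forall>\<phi>\<in>schwartz. \<forall>\<psi>\<in>schwartz. cmod (S \<phi> \<psi>) \<le> C * L2_norm \<phi> * L2_norm \<psi>"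
    using assms unfolding L2_form_def by blast
  show ?thesis
  proof (rule that[of "\<bar>C\<bar> + 1"])
    fix \<phi> \<psi> :: "real ^ 'a \<Rightarrow> complex" assume *: "\<phi> \<in> schwartz" "\<psi> \<in> schwartz"
    have "C * (L2_norm \<phi> * L2_norm \<psi>) \<le> (\<bar>C\<bar> + 1) * (L2_norm \<phi> * L2_norm \<psi>)"
      by (intro mult_right_mono mult_nonneg_nonneg) auto
    moreover have "cmod (S \<phi> \<psi>) \<le> C * (L2_norm \<phi> * L2_norm \<psi>)"
      using C * by (simp add: mult.assoc)
    ultimately show "cmod (S \<phi> \<psi>) \<le> (\<bar>C\<bar> + 1) * L2_norm \<phi> * L2_norm \<psi>"
      unfolding mult.assoc by linarith
  qed simp
qed

lemma dist_of_linear: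
  assumes "g \<in> L2" shows "linear_on_schwartz (dist_of g)"
  unfolding linear_on_schwartz_def
proof (intro conjI ballI allI)
  fix \<phi> \<psi> :: "real ^ 'a \<Rightarrow> complex" assume *: "\<phi> \<in> schwartz" "\<psi> \<in> schwartz"
  show "dist_of g (\<lambda>x. \<phi> x + \<psi> x) = dist_of g \<phi> + dist_of g \<psi>"
    using * assms by (simp add: dist_of_def schwartz_add distrib_left L2_integrable_mult schwartz_L2)
next
  fix \<phi> :: "real ^ 'a \<Rightarrow> complex" and c assume *: "\<phi> \<in> schwartz"
  have "(LBINT x. g x * (c * \<phi> x)) = (LBINT x. c * (g x * \<phi> x))"
    by (simp only: mult.left_commute)
  then show "dist_of g (\<lambda>x. c * \<phi> x) = c * dist_of g \<phi>"
    using * by (simp add: dist_of_def schwartz_cmult)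
qed

lemma
  assumes B: "bounded_L2_operator B" and \<psi>: "\<psi> \<in> L2"
  shows L2_functional_add: "f \<in> L2 \<Longrightarrow> g \<in> L2 \<Longrightarrow>
      (LBINT x. B (\<lambda>y. f y + g y) x * \<psi> x) = (LBINT x. B f x * \<psi> x) + (LBINT x. B g x * \<psi> x)"
    and L2_functional_cmult: "f \<in> L2 \<Longrightarrow>
      (LBINT x. B (\<lambda>y. c * f y) x * \<psi> x) = c * (LBINT x. B f x * \<psi> x)"
proof -
  have BL: "f \<in> L2 \<Longrightarrow> B f \<in> L2" for f
    using B by (auto simp: bounded_L2_operator_def)
  note [measurable] = L2_measurable[OF \<psi>]
  show "(LBINT x. B (\<lambda>y. f y + g y) x * \<psi> x) = (LBINT x. B f x * \<psi> x) + (LBINT x. B g x * \<psi> x)"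
    if fg: "f \<in> L2" "g \<in> L2"
  proof -
    note [measurable] = L2_measurable[OF BL[OF fg(1)]] L2_measurable[OF BL[OF fg(2)]]
      L2_measurable[OF BL[OF L2_add[OF fg]]]
    have "(LBINT x. B (\<lambda>y. f y + g y) x * \<psi> x) = (LBINT x. B f x * \<psi> x + B g x * \<psi> x)"
    proof (rule integral_cong_AE)
      have "AE x in lborel. B (\<lambda>y. f y + g y) x = B f x + B g x"
        using B fg by (auto simp: bounded_L2_operator_def)
      then show "AE x in lborel. B (\<lambda>y. f y + g y) x * \<psi> x = B f x * \<psi> x + B g x * \<psi> x"
        by eventually_elim (simp add: distrib_right)
    qed measurable
    also have "\<dots> = (LBINT x. B f x * \<psi> x) + (LBINT x. B g x * \<psi> x)"
      by (intro Bochner_Integration.integral_add L2_integrable_mult BL fg \<psi>)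
    finally show ?thesis .
  qed
  show "(LBINT x. B (\<lambda>y. c * f y) x * \<psi> x) = c * (LBINT x. B f x * \<psi> x)" if f: "f \<in> L2"
  proof -
    note [measurable] = L2_measurable[OF BL[OF f]] L2_measurable[OF BL[OF L2_cmult[OF f]]]
    have "(LBINT x. B (\<lambda>y. c * f y) x * \<psi> x) = (LBINT x. c * (B f x * \<psi> x))"
    proof (rule integral_cong_AE)
      have "AE x in lborel. B (\<lambda>y. c * f y) x = c * B f x"
        using B f by (auto simp: bounded_L2_operator_def)
      then show "AE x in lborel. B (\<lambda>y. c * f y) x * \<psi> x = c * (B f x * \<psi> x)"
        by eventually_elim simp
    qed measurable
    then show ?thesis by simp
  qed
qed

lemma L2_functional_bound:
  assumes B: "bounded_L2_operator B"
  obtains C where "C \<ge> 0"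
    "\<And>f \<psi>. f \<in> L2 \<Longrightarrow> \<psi> \<in> L2 \<Longrightarrow> cmod (LBINT x. B f x * \<psi> x) \<le> C * L2_norm f * L2_norm \<psi>"
proof -
  obtain C where C: "\<forall>f\<in>L2. L2_norm (B f) \<le> C * L2_norm f"
    using B unfolding bounded_L2_operator_def by blast
  show ?thesis
  proof (rule that[of "\<bar>C\<bar>"])
    fix f \<psi> :: "'a \<Rightarrow> complex" assume *: "f \<in> L2" "\<psi> \<in> L2"
    have "B f \<in> L2" using B * by (auto simp: bounded_L2_operator_def)
    then have "cmod (LBINT x. B f x * \<psi> x) \<le> L2_norm (B f) * L2_norm \<psi>"
      by (intro L2_Cauchy_Schwarz *)
    also have "\<dots> \<le> (\<bar>C\<bar> * L2_norm f) * L2_norm \<psi>"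
    proof (rule mult_right_mono)
      have "L2_norm (B f) \<le> C * L2_norm f" using C * by blast
      also have "\<dots> \<le> \<bar>C\<bar> * L2_norm f" by (intro mult_right_mono) auto
      finally show "L2_norm (B f) \<le> \<bar>C\<bar> * L2_norm f" .
    qed simp
    finally show "cmod (LBINT x. B f x * \<psi> x) \<le> \<bar>C\<bar> * L2_norm f * L2_norm \<psi>" .
  qed simp
qed

lemma extends_imp_L2_form:
  assumes "extends_to_bounded_L2_operator S" shows "L2_form S"
proof -
  obtain B where B: "bounded_L2_operator B" and S: "\<And>\<phi>. \<phi> \<in> schwartz \<Longrightarrow> S \<phi> = dist_of (B \<phi>)"
    using assms by (auto simp: extends_to_bounded_L2_operator_def)
  obtain C where C: "\<And>f \<psi>. f \<in> L2 \<Longrightarrow> \<psi> \<in> L2 \<Longrightarrow> cmod (LBINT x. B f x * \<psi> x) \<le> C * L2_norm f * L2_norm \<psi>"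
    using L2_functional_bound[OF B] by metis
  have Sv: "S \<phi> \<psi> = (LBINT x. B \<phi> x * \<psi> x)" if "\<phi> \<in> schwartz" "\<psi> \<in> schwartz" for \<phi> \<psi>
    using that by (simp add: S dist_of_def)
  have "linear_on_schwartz (\<lambda>\<phi>. S \<phi> \<psi>)" if \<psi>: "\<psi> \<in> schwartz" for \<psi>
    unfolding linear_on_schwartz_def using \<psi>
    by (simp add: Sv schwartz_add schwartz_cmult L2_functional_add[OF B] L2_functional_cmult[OF B] schwartz_L2)
  moreover have "cmod (S \<phi> \<psi>) \<le> C * L2_norm \<phi> * L2_norm \<psi>" if "\<phi> \<in> schwartz" "\<psi> \<in> schwartz" for \<phi> \<psi>
    unfolding Sv[OF that] by (intro C schwartz_L2 that)
  moreover have "linear_on_schwartz (S \<phi>)" if "\<phi> \<in> schwartz" for \<phi>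
  proof -
    have "B \<phi> \<in> L2" using B schwartz_L2[OF that] by (auto simp: bounded_L2_operator_def)
    then show ?thesis unfolding S[OF that] by (rule dist_of_linear)
  qed
  ultimately show ?thesis unfolding L2_form_def by blast
qed

text \<open>
  The hypothesis on \<open>T\<close> in the form in which it is inherited by commutators, as inductions require.
\<close>
definition beals :: "((real ^ 'n::finite \<Rightarrow> complex) \<Rightarrow> 'n functional) \<Rightarrow> bool" where
  "beals S \<longleftrightarrow> (\<forall>ks. L2_form (multi_commutator ks S))"

lemma multi_commutator_simps [simp]:
  "multi_commutator [] S = S"
  "multi_commutator (k # ks) S = commutator k (multi_commutator ks S)"
  by (simp_all add: multi_commutator_def)

lemma beals_L2_form: "beals S \<Longrightarrow> L2_form S"
  unfolding beals_def using multi_commutator_simps(1)[of S] by metis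

lemma beals_commutator:
  assumes "beals S" shows "beals (commutator k S)"
proof -
  have "multi_commutator ks (commutator k S) = multi_commutator (ks @ [k]) S" for ks
    by (simp add: multi_commutator_def)
  with assms show ?thesis by (simp add: beals_def)
qed

lemma commutator_simps:
  assumes "\<psi> \<in> schwartz"
  shows "commutator (Inl j) S \<phi> \<psi> = S \<phi> (W_op (Inl j) \<psi>) - S (W_op (Inl j) \<phi>) \<psi>"
    and "commutator (Inr j) S \<phi> \<psi> = - S \<phi> (W_op (Inr j) \<psi>) - S (W_op (Inr j) \<phi>) \<psi>"
  using assms by (simp_all add: commutator_def)

text \<open>
  The classical observable that belongs to the operator \<open>W_op k\<close>.
\<close>
fun phase_coord :: "'n + 'n \<Rightarrow> 'n::finite phase_space \<Rightarrow> real" where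
  "phase_coord (Inl j) z = fst z $ j"
| "phase_coord (Inr j) z = snd z $ j"

lemma phase_coord_diff: "phase_coord k (z - z') = phase_coord k z - phase_coord k z'"
  by (cases k) auto

lemma phase_coord_0 [simp]: "phase_coord k 0 = 0"
  by (cases k) auto

text \<open>
  A shift by \<open>z\<close> conjugates \<open>W_op k\<close> into \<open>W_op k\<close> plus the number \<open>phase_coord k z\<close>.
\<close>
lemma W_op_tf:
  assumes "f \<in> schwartz"
  shows "W_op k (tf z f) = tf z (\<lambda>x. complex_of_real (phase_coord k z) * f x + W_op k f x)"
  by (cases k)
     (auto simp: partial_deriv_tf[OF assms] axis_inner fun_eq_iff tf_def algebra_simps)

lemma W_op_cnj:
  assumes "f \<in> schwartz"
  shows "W_op (Inl j) (\<lambda>x. cnj (f x)) = (\<lambda>x. cnj (W_op (Inl j) f x))"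
    and "W_op (Inr j) (\<lambda>x. cnj (f x)) = (\<lambda>x. - cnj (W_op (Inr j) f x))"
  by (auto simp: partial_deriv_cnj[OF assms] fun_eq_iff)

text \<open>
  The matrix element \<open>\<langle>tf z f, S (tf z' h)\<rangle>\<close>. The conjugation appears because the pairing of distributions with
  functions is bilinear.
\<close>
definition tf_matrix :: "((real ^ 'n::finite \<Rightarrow> complex) \<Rightarrow> 'n functional) \<Rightarrow>
    (real ^ 'n \<Rightarrow> complex) \<Rightarrow> (real ^ 'n \<Rightarrow> complex) \<Rightarrow>
    'n phase_space \<Rightarrow> 'n phase_space \<Rightarrow> complex" where
  "tf_matrix S f h z z' = S (tf z' h) (\<lambda>x. cnj (tf z f x))"

lemmas schwartz_intros = schwartz_tf schwartz_cnj schwartz_W_op schwartz_cmult schwartz_add schwartz_diff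
  schwartz_uminus schwartz_reflect

lemma tf_linear:
  "tf z (\<lambda>x. f x + g x) = (\<lambda>x. tf z f x + tf z g x)"
  "tf z (\<lambda>x. f x - g x) = (\<lambda>x. tf z f x - tf z g x)"
  "tf z (\<lambda>x. c * f x) = (\<lambda>x. c * tf z f x)"
  by (auto simp: tf_def algebra_simps)

text \<open>
  The source of all decay. In the matrix element of the commutator, \<open>W_op k\<close> acts on both entries, and moving it
  past the shifts produces the numbers \<open>phase_coord k z\<close> and \<open>phase_coord k z'\<close> with opposite signs.
\<close>
lemma tf_matrix_commutator:
  assumes S: "L2_form S" and f: "f \<in> schwartz" and h: "h \<in> schwartz"
  shows "complex_of_real (phase_coord k (z - z')) * tf_matrix S f h z z' =
    tf_matrix (commutator k S) f h z z' - tf_matrix S (W_op k f) h z z' + tf_matrix S f (W_op k h) z z'"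
proof -
  note I = schwartz_intros f h
  have 1: "S (W_op k (tf z' h)) \<psi> = phase_coord k z' * S (tf z' h) \<psi> + S (tf z' (W_op k h)) \<psi>"
    if "\<psi> \<in> schwartz" for \<psi>
    unfolding W_op_tf[OF h] tf_linear using that
    by (simp add: L2_form_add_left[OF S] L2_form_cmult_left[OF S] I)
  have 2: "S (tf z' h) (\<lambda>x. cnj (W_op k (tf z f) x)) =
      phase_coord k z * S (tf z' h) (\<lambda>x. cnj (tf z f x)) + S (tf z' h) (\<lambda>x. cnj (tf z (W_op k f) x))"
    unfolding W_op_tf[OF f] tf_linear complex_cnj_add complex_cnj_mult complex_cnj_complex_of_real
    by (simp add: L2_form_add_right[OF S] L2_form_cmult_right[OF S] I)
  have 3: "commutator k S (tf z' h) (\<lambda>x. cnj (tf z f x)) =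
      S (tf z' h) (\<lambda>x. cnj (W_op k (tf z f) x)) - S (W_op k (tf z' h)) (\<lambda>x. cnj (tf z f x))"
  proof (cases k)
    case (Inl j)
    then show ?thesis
      by (simp add: commutator_simps I W_op_cnj del: W_op.simps)
  next
    case (Inr j)
    have "S (tf z' h) (\<lambda>x. - cnj (W_op k (tf z f) x)) = - S (tf z' h) (\<lambda>x. cnj (W_op k (tf z f) x))"
      using L2_form_cmult_right[OF S, of "tf z' h" "\<lambda>x. cnj (W_op k (tf z f) x)" "-1"]
      by (simp add: I)
    then show ?thesis
      by (simp add: Inr commutator_simps I W_op_cnj del: W_op.simps)
  qed
  show ?thesis
    unfolding tf_matrix_def 3 2 phase_coord_diff
    by (simp add: 1 I algebra_simps)
qed

lemma tf_0 [simp]: "tf 0 f = f"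
  by (rule ext) (simp add: tf_def)

lemma tf_tf: "tf w (tf v f) = (\<lambda>x. exp (- \<i> * complex_of_real (snd v \<bullet> fst w)) * tf (w + v) f x)"
  by (rule ext) (simp add: tf_def algebra_simps inner_add_left inner_diff_right flip: exp_add)

lemma tf_matrix_tf:
  assumes S: "L2_form S" and f: "f \<in> schwartz" and h: "h \<in> schwartz"
  shows "tf_matrix S (tf u f) (tf u' h) w w' =
    iexp (snd u \<bullet> fst w - snd u' \<bullet> fst w') * tf_matrix S f h (w + u) (w' + u')"
proof -
  have "S (tf w' (tf u' h)) (\<lambda>x. cnj (tf w (tf u f) x)) =
     exp (- \<i> * complex_of_real (snd u' \<bullet> fst w')) * (cnj (exp (- \<i> * complex_of_real (snd u \<bullet> fst w))) *
      S (tf (w' + u') h) (\<lambda>x. cnj (tf (w + u) f x)))"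
    unfolding tf_tf complex_cnj_mult
    by (simp only: L2_form_cmult_left[OF S] L2_form_cmult_right[OF S] schwartz_intros f h)
  also have "cnj (exp (- \<i> * complex_of_real (snd u \<bullet> fst w))) = iexp (snd u \<bullet> fst w)"
    by (simp add: exp_cnj)
  finally show ?thesis
    by (simp add: tf_matrix_def right_diff_distrib exp_diff exp_minus field_simps)
qed

lemma tf_matrix_diag_tf:
  assumes "L2_form S" "f \<in> schwartz" "h \<in> schwartz"
  shows "tf_matrix S (tf u f) (tf u h) w w = tf_matrix S f h (w + u) (w + u)"
  unfolding tf_matrix_tf[OF assms] by simp

lemma tf_matrix_bounded:
  assumes S: "L2_form S" and f: "f \<in> schwartz" and h: "h \<in> schwartz"
  shows "\<exists>C. \<forall>z z'. cmod (tf_matrix S f h z z') \<le> C"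
proof -
  obtain C where C: "\<And>\<phi> \<psi>. \<phi> \<in> schwartz \<Longrightarrow> \<psi> \<in> schwartz \<Longrightarrow> cmod (S \<phi> \<psi>) \<le> C * L2_norm \<phi> * L2_norm \<psi>"
    using L2_form_bound[OF S] by metis
  have "cmod (tf_matrix S f h z z') \<le> C * L2_norm h * L2_norm f" for z z'
    using C[OF schwartz_tf[OF h, of z'] schwartz_cnj[OF schwartz_tf[OF f, of z]]]
    by (simp add: tf_matrix_def L2_norm_cnj L2_norm_tf schwartz_measurable f h)
  then show ?thesis by blast
qed

section \<open>Derivatives of time-frequency shifts\<close>

lemma L2_norm_tf_tendsto:
  assumes f: "f \<in> schwartz" and Z: "Z \<longlonglongrightarrow> z"
  shows "(\<lambda>n. L2_norm (\<lambda>x. tf (Z n) f x - tf z f x)) \<longlonglongrightarrow> 0"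
proof -
  obtain C where C: "C > 0" "\<And>x. cmod (f x) \<le> C / weight x ^ 1"
    using schwartz_bound[OF f] by metis
  have "(\<lambda>n. weight (fst (Z n))) \<longlonglongrightarrow> weight (fst z)"
    by (rule continuous_on_tendsto_compose[where f = "\<lambda>z. weight (fst z)" and s = UNIV, OF _ Z])
       (auto intro!: continuous_intros)
  then have "Bseq (\<lambda>n. weight (fst (Z n)))" by (intro convergent_imp_Bseq convergentI)
  then obtain K where K: "\<And>n. weight (fst (Z n)) \<le> K"
    by (auto simp: Bseq_def)
  define M where "M = C * 2 ^ CARD('a) * K + C * 2 ^ CARD('a) * weight (fst z)"
  have 1: "cmod (tf v f x) \<le> C * 2 ^ CARD('a) * weight (fst v) / weight x" for v x
    using tf_bound[OF C(2), of v x] by (simp add: mult_ac)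
  show ?thesis
  proof (rule L2_norm_tendsto_0[where C = M])
    show "(\<lambda>x. tf (Z n) f x - tf z f x) \<in> borel_measurable borel" for n
      by (intro schwartz_measurable schwartz_intros f)
    show "cmod (tf (Z n) f x - tf z f x) \<le> M / weight x" for n x
    proof -
      have "cmod (tf (Z n) f x - tf z f x) \<le> cmod (tf (Z n) f x) + cmod (tf z f x)"
        by (rule norm_triangle_ineq4)
      also have "\<dots> \<le> C * 2 ^ CARD('a) * weight (fst (Z n)) / weight x + C * 2 ^ CARD('a) * weight (fst z) / weight x"
        by (intro add_mono 1)
      also have "\<dots> \<le> C * 2 ^ CARD('a) * K / weight x + C * 2 ^ CARD('a) * weight (fst z) / weight x"
        using K[of n] C(1) by (intro add_mono divide_right_mono mult_left_mono) auto
      finally show ?thesis by (simp add: M_def add_divide_distrib)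
    qed
    show "(\<lambda>n. tf (Z n) f x - tf z f x) \<longlonglongrightarrow> 0" for x
    proof -
      have "continuous_on UNIV (\<lambda>z. tf z f x)"
        unfolding tf_def using f by (intro continuous_intros)
      from continuous_on_tendsto_compose[OF this Z]
      show ?thesis by (simp add: LIM_zero_iff)
    qed
  qed
qed

text \<open>
  Continuity is needed for joint measurability in Fubini's theorem.
\<close>
lemma continuous_on_tf_matrix:
  assumes S: "L2_form S" and f: "f \<in> schwartz" and h: "h \<in> schwartz"
  shows "continuous_on UNIV (\<lambda>p. tf_matrix S f h (fst p) (snd p))"
proof (rule continuous_on_sequentiallyI)
  fix U :: "nat \<Rightarrow> ('a phase_space) \<times> ('a phase_space)" and p
  assume U: "U \<longlonglongrightarrow> p"
  obtain C where C: "\<And>\<phi> \<psi>. \<phi> \<in> schwartz \<Longrightarrow> \<psi> \<in> schwartz \<Longrightarrow> cmod (S \<phi> \<psi>) \<le> C * L2_norm \<phi> * L2_norm \<psi>"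
    using L2_form_bound[OF S] by metis
  let ?d1 = "\<lambda>n x. tf (fst (U n)) f x - tf (fst p) f x"
  let ?d2 = "\<lambda>n x. tf (snd (U n)) h x - tf (snd p) h x"
  have lim: "(\<lambda>n. L2_norm (?d1 n)) \<longlonglongrightarrow> 0" "(\<lambda>n. L2_norm (?d2 n)) \<longlonglongrightarrow> 0"
    by (intro L2_norm_tf_tendsto f h tendsto_fst tendsto_snd U)+
  have eq: "tf_matrix S f h (fst (U n)) (snd (U n)) - tf_matrix S f h (fst p) (snd p) =
      S (tf (snd (U n)) h) (\<lambda>x. cnj (?d1 n x)) + S (?d2 n) (\<lambda>x. cnj (tf (fst p) f x))" for n
    unfolding complex_cnj_diff
    by (simp add: tf_matrix_def L2_form_diff_left[OF S] L2_form_diff_right[OF S] schwartz_intros f h)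
  have "(\<lambda>n. tf_matrix S f h (fst (U n)) (snd (U n)) - tf_matrix S f h (fst p) (snd p)) \<longlonglongrightarrow> 0"
  proof (rule Lim_null_comparison[OF always_eventually[OF allI]])
    fix n
    have "cmod (S (tf (snd (U n)) h) (\<lambda>x. cnj (?d1 n x)) + S (?d2 n) (\<lambda>x. cnj (tf (fst p) f x))) \<le>
       C * L2_norm (tf (snd (U n)) h) * L2_norm (\<lambda>x. cnj (?d1 n x)) +
       C * L2_norm (?d2 n) * L2_norm (\<lambda>x. cnj (tf (fst p) f x))"
      by (rule order_trans[OF norm_triangle_ineq]) (intro add_mono C schwartz_intros f h)
    then show "cmod (tf_matrix S f h (fst (U n)) (snd (U n)) - tf_matrix S f h (fst p) (snd p))
      \<le> C * L2_norm h * L2_norm (?d1 n) + C * L2_norm (?d2 n) * L2_norm f"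
      unfolding eq L2_norm_cnj by (simp add: L2_norm_tf f h schwartz_measurable)
  next
    have "(\<lambda>n. C * L2_norm h * L2_norm (?d1 n) + C * L2_norm (?d2 n) * L2_norm f)
      \<longlonglongrightarrow> C * L2_norm h * 0 + C * 0 * L2_norm f"
      by (intro tendsto_intros lim)
    then show "(\<lambda>n. C * L2_norm h * L2_norm (?d1 n) + C * L2_norm (?d2 n) * L2_norm f) \<longlonglongrightarrow> 0"
      by simp
  qed
  then show "(\<lambda>n. tf_matrix S f h (fst (U n)) (snd (U n))) \<longlonglongrightarrow> tf_matrix S f h (fst p) (snd p)"
    by (simp add: LIM_zero_iff)
qed

lemma continuous_on_tf_matrix_compose [continuous_intros]:
  assumes "L2_form S" "f \<in> schwartz" "h \<in> schwartz" "continuous_on A u" "continuous_on A v"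
  shows "continuous_on A (\<lambda>x. tf_matrix S f h (u x) (v x))"
  using continuous_on_compose2[OF continuous_on_tf_matrix[OF assms(1-3)] continuous_on_Pair[OF assms(4,5)]]
  by simp

text \<open>
  The direction in phase space in which \<open>W_op k\<close> generates the shifts: positions generate modulations and
  momenta generate translations. Accordingly \<open>tf (t *\<^sub>R phase_dir k)\<close> has the generator \<open>gen_factor k * W_op k\<close>.
\<close>
fun phase_dir :: "'n + 'n \<Rightarrow> 'n::finite phase_space" where
  "phase_dir (Inl j) = (0, axis j 1)"
| "phase_dir (Inr j) = (axis j 1, 0)"

fun gen_factor :: "'n + 'n \<Rightarrow> complex" where
  "gen_factor (Inl j) = \<i>"
| "gen_factor (Inr j) = - \<i>"

lemma cnj_gen_factor: "cnj (gen_factor k) = - gen_factor k"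
  by (cases k) auto

lemma cmod_gen_factor: "cmod (gen_factor k) = 1"
  by (cases k) auto

lemma tf_flow_derivative:
  assumes f: "f \<in> schwartz"
  shows "((\<lambda>t. tf (t *\<^sub>R phase_dir k) f x) has_vector_derivative
    tf (s *\<^sub>R phase_dir k) (\<lambda>x. gen_factor k * W_op k f x) x) (at s within A)"
proof (rule has_vector_derivative_at_within, cases k)
  case (Inl j)
  have "((\<lambda>t. iexp (t * x $ j) * f x) has_vector_derivative
      iexp (s * x $ j) * (\<i> * complex_of_real (x $ j)) * f x) (at s)"
    by (rule has_vector_derivative_real_field derivative_eq_intros refl | simp)+
  then show "((\<lambda>t. tf (t *\<^sub>R phase_dir k) f x) has_vector_derivative
    tf (s *\<^sub>R phase_dir k) (\<lambda>x. gen_factor k * W_op k f x) x) (at s)"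
    by (simp add: Inl tf_def inner_axis' mult_ac)
next
  case (Inr j)
  obtain D where D: "(f has_derivative D) (at (x - s *\<^sub>R axis j 1))"
    "\<And>b. partial_deriv b f (x - s *\<^sub>R axis j 1) = D b"
    using schwartz_has_derivative[OF f] by blast
  have "((\<lambda>t. x - t *\<^sub>R axis j 1) has_derivative (\<lambda>t. - (t *\<^sub>R axis j 1))) (at s)"
    by (auto intro!: derivative_eq_intros)
  from has_derivative_compose[OF this D(1)]
  have "((\<lambda>t. f (x - t *\<^sub>R axis j 1)) has_derivative (\<lambda>t. D (- (t *\<^sub>R axis j 1)))) (at s)" .
  moreover have "D (- (t *\<^sub>R axis j 1)) = t *\<^sub>R (- D (axis j 1))" for t
    using has_derivative_bounded_linear[OF D(1)] by (simp add: linear_simps)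
  ultimately have "((\<lambda>t. f (x - t *\<^sub>R axis j 1)) has_vector_derivative (- D (axis j 1))) (at s)"
    by (simp add: has_vector_derivative_def)
  then show "((\<lambda>t. tf (t *\<^sub>R phase_dir k) f x) has_vector_derivative
    tf (s *\<^sub>R phase_dir k) (\<lambda>x. gen_factor k * W_op k f x) x) (at s)"
    by (simp add: Inr tf_def D(2) flip: mult.assoc)
qed

lemma tf_flow_bound:
  assumes f: "f \<in> schwartz"
  shows "\<exists>C. \<forall>t x. \<bar>t\<bar> \<le> 1 \<longrightarrow> cmod (tf (t *\<^sub>R phase_dir k) f x) \<le> C / weight x"
proof -
  obtain C where C: "C > 0" "\<And>x. cmod (f x) \<le> C / weight x ^ 1"
    using schwartz_bound[OF f] by metis
  have "cmod (tf (t *\<^sub>R phase_dir k) f x) \<le> C * (2 ^ CARD('a) * weight (fst (phase_dir k :: (real^'a)\<times>_))) / weight x"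
    if "\<bar>t\<bar> \<le> 1" for t x
  proof -
    have "cmod (tf (t *\<^sub>R phase_dir k) f x) \<le> C * (2 ^ CARD('a) * weight (t *\<^sub>R fst (phase_dir k :: (real^'a)\<times>_))) / weight x"
      using tf_bound[OF C(2), of "t *\<^sub>R phase_dir k" x] by simp
    also have "\<dots> \<le> C * (2 ^ CARD('a) * weight (fst (phase_dir k :: (real^'a)\<times>_))) / weight x"
      using C(1) that by (intro divide_right_mono mult_left_mono weight_scale_le) auto
    finally show ?thesis .
  qed
  then show ?thesis by blast
qed

lemma vector_derivative_first_order_bound:
  fixes r :: "real \<Rightarrow> 'b::real_normed_vector"
  assumes d: "\<And>s. (r has_vector_derivative r1 s) (at s)"
    and b: "\<And>s. \<bar>s\<bar> \<le> \<bar>t\<bar> \<Longrightarrow> norm (r1 s) \<le> M"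
  shows "norm (r t - r 0) \<le> M * \<bar>t\<bar>"
proof -
  have "norm (r t - r 0) \<le> M * norm (t - 0)"
  proof (rule differentiable_bound)
    show "convex (closed_segment 0 t)" by (rule convex_closed_segment)
    fix s assume s: "s \<in> closed_segment 0 t"
    show "(r has_derivative (\<lambda>h. h *\<^sub>R r1 s)) (at s within closed_segment 0 t)"
      using d[of s] unfolding has_vector_derivative_def by (rule has_derivative_at_withinI)
    have "\<bar>s\<bar> \<le> \<bar>t\<bar>" using s by (auto simp: closed_segment_eq_real_ivl split: if_splits)
    from mult_right_mono[OF b[OF this] abs_ge_zero]
    show "onorm (\<lambda>h. h *\<^sub>R r1 s) \<le> M"
      by (intro onorm_le) (simp add: mult.commute)
  qed auto
  then show ?thesis by simp
qed

lemma vector_derivative_second_order_bound: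
  fixes r :: "real \<Rightarrow> 'b::real_normed_vector"
  assumes d1: "\<And>s. (r has_vector_derivative r1 s) (at s)"
    and d2: "\<And>s. (r1 has_vector_derivative r2 s) (at s)"
    and b: "\<And>s. \<bar>s\<bar> \<le> \<bar>t\<bar> \<Longrightarrow> norm (r2 s) \<le> M"
  shows "norm (r t - r 0 - t *\<^sub>R r1 0) \<le> M * t\<^sup>2"
proof -
  have M: "M \<ge> 0" using order_trans[OF norm_ge_zero b[of 0]] by simp
  have "norm ((r t - t *\<^sub>R r1 0) - (r 0 - 0 *\<^sub>R r1 0)) \<le> (M * \<bar>t\<bar>) * \<bar>t\<bar>"
  proof (rule vector_derivative_first_order_bound)
    show "((\<lambda>s. r s - s *\<^sub>R r1 0) has_vector_derivative r1 s - r1 0) (at s)" for s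
      using d1 by (auto intro!: derivative_eq_intros)
    fix s assume s: "\<bar>s\<bar> \<le> \<bar>t\<bar>"
    have "norm (r1 s - r1 0) \<le> M * \<bar>s\<bar>"
      by (rule vector_derivative_first_order_bound[OF d2]) (use s in \<open>auto intro: b\<close>)
    also have "\<dots> \<le> M * \<bar>t\<bar>" using s M by (rule mult_left_mono)
    finally show "norm (r1 s - r1 0) \<le> M * \<bar>t\<bar>" .
  qed
  moreover have "(r t - t *\<^sub>R r1 0) - (r 0 - 0 *\<^sub>R r1 0) = r t - r 0 - t *\<^sub>R r1 0"
    by simp
  moreover have "(M * \<bar>t\<bar>) * \<bar>t\<bar> = M * t\<^sup>2"
    by (simp add: power2_eq_square mult.assoc)
  ultimately show ?thesis by (simp only:)
qed

text \<open>
  The remainder is controlled pointwise, since the second derivative in \<open>t\<close> is a shift of the Schwartz function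
  obtained by applying the generator twice. The inverse weight makes the bound square integrable.
\<close>
lemma tf_flow_taylor:
  assumes f: "f \<in> schwartz"
  shows "\<exists>C. \<forall>t x. \<bar>t\<bar> \<le> 1 \<longrightarrow>
    cmod (tf (t *\<^sub>R phase_dir k) f x - f x - complex_of_real t * (gen_factor k * W_op k f x)) \<le> C * t\<^sup>2 / weight x"
proof -
  let ?A = "\<lambda>f x. gen_factor k * W_op k f x"
  have A: "?A f \<in> schwartz" "?A (?A f) \<in> schwartz" by (intro schwartz_intros f)+
  obtain C where C: "\<And>t x. \<bar>t\<bar> \<le> 1 \<Longrightarrow> cmod (tf (t *\<^sub>R phase_dir k) (?A (?A f)) x) \<le> C / weight x"
    using tf_flow_bound[OF A(2)] by blast
  have "cmod (tf (t *\<^sub>R phase_dir k) f x - tf (0 *\<^sub>R phase_dir k) f x - t *\<^sub>R tf (0 *\<^sub>R phase_dir k) (?A f) x)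
      \<le> C / weight x * t\<^sup>2" if "\<bar>t\<bar> \<le> 1" for t x
    by (rule vector_derivative_second_order_bound[OF tf_flow_derivative[OF f] tf_flow_derivative[OF A(1)]])
       (use that C in simp)
  then show ?thesis by (intro exI[of _ C]) (simp add: scaleR_conv_of_real)
qed

lemma L2_tf_flow_taylor:
  assumes f: "f \<in> schwartz"
  shows "\<exists>C. \<forall>t. \<bar>t\<bar> \<le> 1 \<longrightarrow>
    L2_norm (\<lambda>x. tf (t *\<^sub>R phase_dir k) f x - f x - complex_of_real t * (gen_factor k * W_op k f x)) \<le> C * t\<^sup>2"
proof -
  obtain C where C: "\<And>t x. \<bar>t\<bar> \<le> 1 \<Longrightarrow>
     cmod (tf (t *\<^sub>R phase_dir k) f x - f x - complex_of_real t * (gen_factor k * W_op k f x)) \<le> C * t\<^sup>2 / weight x"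
    using tf_flow_taylor[OF f] by blast
  have "L2_norm (\<lambda>x. tf (t *\<^sub>R phase_dir k) f x - f x - complex_of_real t * (gen_factor k * W_op k f x))
      \<le> C * t\<^sup>2 * sqrt (LBINT x. 1 / weight (x::real^'a) ^ 2)" if "\<bar>t\<bar> \<le> 1" for t
    by (intro L2_norm_weight_le C that schwartz_measurable schwartz_intros f)
  then show ?thesis
    by (intro exI[of _ "C * sqrt (LBINT x. 1 / weight (x::real^'a) ^ 2)"]) (simp add: mult_ac)
qed

text \<open>
  The product rule for a bilinear form, where shifts by \<open>w\<close> preserve all norms, whence the uniformity in \<open>w\<close>. The
  two first order terms combine to a commutator because on the diagonal the contributions of
  \<open>phase_coord k w\<close> cancel.
\<close>
lemma tf_matrix_diag_taylor:
  assumes S: "L2_form S" and f: "f \<in> schwartz" and h: "h \<in> schwartz"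
  shows "\<exists>C. \<forall>w t. \<bar>t\<bar> \<le> 1 \<longrightarrow>
    cmod (tf_matrix S f h (w + t *\<^sub>R phase_dir k) (w + t *\<^sub>R phase_dir k) - tf_matrix S f h w w
      + complex_of_real t * (gen_factor k * tf_matrix (commutator k S) f h w w)) \<le> C * t\<^sup>2"
proof -
  let ?e = "phase_dir k :: 'a phase_space"
  let ?g = "gen_factor k"
  obtain C where C: "C > 0" "\<And>\<phi> \<psi>. \<phi> \<in> schwartz \<Longrightarrow> \<psi> \<in> schwartz \<Longrightarrow> cmod (S \<phi> \<psi>) \<le> C * L2_norm \<phi> * L2_norm \<psi>"
    using L2_form_bound[OF S] by metis
  define r where "r f t x = tf (t *\<^sub>R ?e) f x - f x - complex_of_real t * (?g * W_op k f x)" for f t x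
  obtain C2 where C2: "\<And>t. \<bar>t\<bar> \<le> 1 \<Longrightarrow> L2_norm (r f t) \<le> C2 * t\<^sup>2"
    using L2_tf_flow_taylor[OF f, of k] unfolding r_def by blast
  obtain C3 where C3: "\<And>t. \<bar>t\<bar> \<le> 1 \<Longrightarrow> L2_norm (r h t) \<le> C3 * t\<^sup>2"
    using L2_tf_flow_taylor[OF h, of k] unfolding r_def by blast
  have rs: "r u t \<in> schwartz" if "u \<in> schwartz" for u t
    unfolding r_def using that by (intro schwartz_intros)
  define N where "N = C * L2_norm (W_op k h)"
  have N: "N \<ge> 0" using C(1) by (simp add: N_def)
  define E where "E = C * C3 * L2_norm f + N * L2_norm (W_op k f) + N * C2 + C * L2_norm h * C2"
  have "cmod (tf_matrix S f h (w + t *\<^sub>R ?e) (w + t *\<^sub>R ?e) - tf_matrix S f h w w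
      + complex_of_real t * (?g * tf_matrix (commutator k S) f h w w)) \<le> E * t\<^sup>2" if t: "\<bar>t\<bar> \<le> 1" for w t
  proof -
    let ?m = "\<lambda>u v. tf_matrix S u v w w"
    note I = schwartz_intros f h rs
    have al: "?m u (\<lambda>x. v x + v' x) = ?m u v + ?m u v'"
      if "u \<in> schwartz" "v \<in> schwartz" "v' \<in> schwartz" for u v v'
      unfolding tf_matrix_def tf_linear by (intro L2_form_add_left[OF S] I that)
    have cl: "?m u (\<lambda>x. c * v x) = c * ?m u v" if "u \<in> schwartz" "v \<in> schwartz" for u v c
      unfolding tf_matrix_def tf_linear by (intro L2_form_cmult_left[OF S] I that)
    have ar: "?m (\<lambda>x. u x + u' x) v = ?m u v + ?m u' v"
      if "u \<in> schwartz" "v \<in> schwartz" "u' \<in> schwartz" for u v u'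
      unfolding tf_matrix_def tf_linear complex_cnj_add by (intro L2_form_add_right[OF S] I that)
    have cr: "?m (\<lambda>x. c * u x) v = cnj c * ?m u v" if "u \<in> schwartz" "v \<in> schwartz" for u v c
      unfolding tf_matrix_def tf_linear complex_cnj_mult by (intro L2_form_cmult_right[OF S] I that)
    have b: "cmod (?m u v) \<le> C * L2_norm v * L2_norm u" if "u \<in> schwartz" "v \<in> schwartz" for u v
      using C(2)[OF schwartz_tf[OF that(2), of w] schwartz_cnj[OF schwartz_tf[OF that(1), of w]]]
      by (simp add: tf_matrix_def L2_norm_cnj L2_norm_tf schwartz_measurable that)
    have tri: "cmod (a + b + c + d) \<le> cmod a + cmod b + cmod c + cmod d" for a b c d
      by (intro norm_triangle_le[OF add_mono] order_refl)
    have com: "tf_matrix (commutator k S) f h w w = ?m (W_op k f) h - ?m f (W_op k h)"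
    proof -
      have "tf_matrix (commutator k S) f h w w =
         (tf_matrix (commutator k S) f h w w - ?m (W_op k f) h + ?m f (W_op k h)) + (?m (W_op k f) h - ?m f (W_op k h))"
        by simp
      then show ?thesis unfolding tf_matrix_commutator[OF S f h, of k w w, symmetric] by simp
    qed
    have th: "tf (t *\<^sub>R ?e) h = (\<lambda>x. h x + ((complex_of_real t * ?g) * W_op k h x + r h t x))"
      by (simp add: r_def fun_eq_iff)
    have tf': "tf (t *\<^sub>R ?e) f = (\<lambda>x. f x + ((complex_of_real t * ?g) * W_op k f x + r f t x))"
      by (simp add: r_def fun_eq_iff)
    have m_tf: "?m (tf (t *\<^sub>R ?e) f) v = ?m f v + (complex_of_real t * cnj ?g * ?m (W_op k f) v + ?m (r f t) v)"
      if "v \<in> schwartz" for v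
      unfolding tf' by (simp add: ar cr I that)
    have "?m (tf (t *\<^sub>R ?e) f) (tf (t *\<^sub>R ?e) h) =
      ?m (tf (t *\<^sub>R ?e) f) h + complex_of_real t * ?g * ?m (tf (t *\<^sub>R ?e) f) (W_op k h) + ?m (tf (t *\<^sub>R ?e) f) (r h t)"
      unfolding th by (simp only: al cl I add.assoc)
    then have eq: "?m (tf (t *\<^sub>R ?e) f) (tf (t *\<^sub>R ?e) h) - ?m f h
      + complex_of_real t * (?g * tf_matrix (commutator k S) f h w w) =
      ?m (tf (t *\<^sub>R ?e) f) (r h t) + complex_of_real t * ?g * (complex_of_real t * cnj ?g * ?m (W_op k f) (W_op k h))
      + complex_of_real t * ?g * ?m (r f t) (W_op k h) + ?m (r f t) h"
      unfolding m_tf[OF h] m_tf[OF schwartz_W_op[OF h]] com cnj_gen_factor by (simp add: algebra_simps)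
    have "cmod (?m (tf (t *\<^sub>R ?e) f) (tf (t *\<^sub>R ?e) h) - ?m f h
      + complex_of_real t * (?g * tf_matrix (commutator k S) f h w w)) \<le>
        cmod (?m (tf (t *\<^sub>R ?e) f) (r h t)) + t\<^sup>2 * cmod (?m (W_op k f) (W_op k h))
        + \<bar>t\<bar> * cmod (?m (r f t) (W_op k h)) + cmod (?m (r f t) h)"
      unfolding eq by (rule order_trans[OF tri])
        (simp add: norm_mult cmod_gen_factor power2_eq_square abs_mult_self_eq flip: mult.assoc)
    also have "\<dots> \<le> C * L2_norm (r h t) * L2_norm (tf (t *\<^sub>R ?e) f) + t\<^sup>2 * (N * L2_norm (W_op k f))
         + 1 * (N * L2_norm (r f t)) + C * L2_norm h * L2_norm (r f t)"
      unfolding N_def using t by (intro add_mono mult_left_mono mult_mono b I) auto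
    also have "\<dots> \<le> C * (C3 * t\<^sup>2) * L2_norm f + t\<^sup>2 * (N * L2_norm (W_op k f))
         + 1 * (N * (C2 * t\<^sup>2)) + C * L2_norm h * (C2 * t\<^sup>2)"
      using C(1) t N unfolding L2_norm_tf[OF schwartz_measurable[OF f]]
      by (intro add_mono mult_left_mono mult_right_mono C2 C3 mult_nonneg_nonneg order_refl) auto
    also have "\<dots> = E * t\<^sup>2"
      by (simp add: E_def algebra_simps)
    finally show ?thesis
      unfolding tf_matrix_diag_tf[OF S f h] .
  qed
  then show ?thesis by blast
qed

lemma has_derivative_quadratic_remainder:
  fixes F :: "'a::real_normed_vector \<Rightarrow> 'b::real_normed_vector"
  assumes L: "bounded_linear L"
    and b: "\<And>v. norm v \<le> 1 \<Longrightarrow> norm (F (x + v) - F x - L v) \<le> C * (norm v)\<^sup>2"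
  shows "(F has_derivative L) (at x)"
  unfolding has_derivative_at
proof (rule conjI[OF L], rule Lim_null_comparison)
  show "\<forall>\<^sub>F v in at 0. norm (norm (F (x + v) - F x - L v) / norm v) \<le> C * norm v"
    unfolding eventually_at
  proof (intro exI[of _ 1] conjI ballI impI)
    fix v :: 'a assume "v \<noteq> 0 \<and> dist v 0 < 1"
    then show "norm (norm (F (x + v) - F x - L v) / norm v) \<le> C * norm v"
      using b[of v] by (simp add: divide_le_eq power2_eq_square mult.assoc)
  qed simp
  show "((\<lambda>v::'a. C * norm v) \<longlongrightarrow> 0) (at 0)"
    by (intro tendsto_mult_right_zero tendsto_norm_zero tendsto_ident_at)
qed

lemma tf_matrix_diag_derivative:
  assumes S: "L2_form S" and f: "f \<in> schwartz" and h: "h \<in> schwartz"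
  shows "((\<lambda>t. tf_matrix S f h (w + t *\<^sub>R phase_dir k) (w + t *\<^sub>R phase_dir k)) has_vector_derivative
    - gen_factor k * tf_matrix (commutator k S) f h (w + s *\<^sub>R phase_dir k) (w + s *\<^sub>R phase_dir k)) (at s within A)"
proof (rule has_vector_derivative_at_within)
  obtain C where C: "\<And>w t. \<bar>t\<bar> \<le> 1 \<Longrightarrow>
    cmod (tf_matrix S f h (w + t *\<^sub>R phase_dir k) (w + t *\<^sub>R phase_dir k) - tf_matrix S f h w w
      + complex_of_real t * (gen_factor k * tf_matrix (commutator k S) f h w w)) \<le> C * t\<^sup>2"
    using tf_matrix_diag_taylor[OF assms, of k] by blast
  show "((\<lambda>t. tf_matrix S f h (w + t *\<^sub>R phase_dir k) (w + t *\<^sub>R phase_dir k)) has_vector_derivative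
    - gen_factor k * tf_matrix (commutator k S) f h (w + s *\<^sub>R phase_dir k) (w + s *\<^sub>R phase_dir k)) (at s)"
    unfolding has_vector_derivative_def
  proof (rule has_derivative_quadratic_remainder[where C = C])
    show "bounded_linear (\<lambda>t. t *\<^sub>R (- gen_factor k * tf_matrix (commutator k S) f h (w + s *\<^sub>R phase_dir k) (w + s *\<^sub>R phase_dir k)))"
      by (rule bounded_linear_scaleR_left)
    fix t :: real assume "norm t \<le> 1"
    then show "cmod (tf_matrix S f h (w + (s + t) *\<^sub>R phase_dir k) (w + (s + t) *\<^sub>R phase_dir k)
       - tf_matrix S f h (w + s *\<^sub>R phase_dir k) (w + s *\<^sub>R phase_dir k)
       - t *\<^sub>R (- gen_factor k * tf_matrix (commutator k S) f h (w + s *\<^sub>R phase_dir k) (w + s *\<^sub>R phase_dir k)))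
       \<le> C * (norm t)\<^sup>2"
      using C[of t "w + s *\<^sub>R phase_dir k"]
      by (simp add: scaleR_conv_of_real[where 'a = complex] scaleR_add_left add.assoc)
  qed
qed

section \<open>The identity operator\<close>

lemma L2_form_dist_of: "L2_form (dist_of :: (real ^ 'n::finite \<Rightarrow> complex) \<Rightarrow> 'n functional)"
  by (rule extends_imp_L2_form)
     (auto simp: extends_to_bounded_L2_operator_def bounded_L2_operator_def intro!: exI[of _ "\<lambda>f. f"] exI[of _ 1])

text \<open>
  \<open>dist_of\<close> is the identity operator, seen as a map into distributions. For momenta the claim is integration by
  parts, which holds because the integral of \<open>h * f\<close> is unchanged when both factors are shifted: its
  derivative along the shift vanishes, and by \<open>tf_matrix_diag_derivative\<close> it is a multiple of the commutator.
\<close>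
lemma commutator_dist_of:
  assumes f: "f \<in> schwartz" and h: "h \<in> schwartz"
  shows "commutator k dist_of h f = 0"
proof -
  let ?f = "\<lambda>x. cnj (f x)"
  have fs: "?f \<in> schwartz" by (intro schwartz_intros f)
  have const: "tf_matrix dist_of ?f h z z = (LBINT x. h x * f x)" for z
  proof -
    have [measurable]: "h \<in> borel_measurable borel" "f \<in> borel_measurable borel"
      using f h by measurable
    have "tf_matrix dist_of ?f h z z = (LBINT x. tf z h x * cnj (tf z ?f x))"
      unfolding tf_matrix_def dist_of_def using fs by (simp add: schwartz_intros)
    also have "\<dots> = (LBINT x. h (- fst z + 1 *\<^sub>R x) * f (- fst z + 1 *\<^sub>R x))"
      by (intro Bochner_Integration.integral_cong refl)
         (simp add: tf_def exp_cnj exp_minus mult_ac)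
    also have "\<dots> = (LBINT x. h x * f x)"
      by (subst integral_lborel_affine) (auto)
    finally show ?thesis .
  qed
  have "((\<lambda>t. tf_matrix dist_of ?f h (0 + t *\<^sub>R phase_dir k) (0 + t *\<^sub>R phase_dir k)) has_vector_derivative
    - gen_factor k * tf_matrix (commutator k dist_of) ?f h (0 + 0 *\<^sub>R phase_dir k) (0 + 0 *\<^sub>R phase_dir k)) (at 0)"
    by (rule tf_matrix_diag_derivative[OF L2_form_dist_of fs h])
  then have "((\<lambda>t::real. \<integral>x. h x * f x \<partial>lborel) has_vector_derivative
    - gen_factor k * commutator k dist_of h f) (at 0)"
    unfolding const by (simp add: tf_matrix_def)
  then have "- gen_factor k * commutator k dist_of h f = 0"
    by (rule vector_derivative_unique_at) (rule has_vector_derivative_const)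
  then show ?thesis by (cases k) auto
qed

lemma beals_dist_of: "beals dist_of"
proof -
  have com: "commutator k S \<phi> \<psi> = 0"
    if "\<And>\<phi> \<psi>. \<phi> \<in> schwartz \<Longrightarrow> \<psi> \<in> schwartz \<Longrightarrow> S \<phi> \<psi> = 0" "\<phi> \<in> schwartz" "\<psi> \<in> schwartz"
    for S k and \<phi> \<psi> :: "real ^ 'a \<Rightarrow> complex"
    using that by (cases k) (simp_all add: commutator_simps schwartz_W_op del: W_op.simps)
  have zero: "multi_commutator (k # ks) dist_of \<phi> \<psi> = 0"
    if "\<phi> \<in> schwartz" "\<psi> \<in> schwartz" for k ks and \<phi> \<psi> :: "real ^ 'a \<Rightarrow> complex"
    using that
  proof (induction ks arbitrary: k \<phi> \<psi>)
    case Nil then show ?case by (simp add: commutator_dist_of)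
  next
    case (Cons k' ks) show ?case
      unfolding multi_commutator_simps(2)[of k "k' # ks"] by (intro com Cons)
  qed
  have "L2_form (multi_commutator ks dist_of)" for ks :: "('a + 'a) list"
  proof (cases ks)
    case Nil then show ?thesis by (simp add: L2_form_dist_of)
  next
    case (Cons k ks')
    show ?thesis
      unfolding Cons L2_form_def linear_on_schwartz_def
      by (auto simp: zero schwartz_add schwartz_cmult simp del: multi_commutator_simps intro!: exI[of _ 0])
  qed
  then show ?thesis by (simp add: beals_def)
qed

section \<open>Off-diagonal decay\<close>

lemma weight_phase: "weight z = (\<Prod>k\<in>UNIV. 1 + (phase_coord k z)\<^sup>2)" for z :: "'n::finite phase_space"
proof -
  have "(\<Prod>k\<in>UNIV. 1 + (phase_coord k z)\<^sup>2)
      = (\<Prod>j\<in>UNIV. 1 + (phase_coord (Inl j) z)\<^sup>2) * (\<Prod>j\<in>UNIV. 1 + (phase_coord (Inr j) z)\<^sup>2)"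
    by (subst UNIV_Plus_UNIV[symmetric], subst prod.Plus) (auto simp: o_def)
  then show ?thesis
    using weight_Pair[of "fst z" "snd z"] by (simp add: weight_vec)
qed

text \<open>
  The bounds for all operators and all windows are treated together, since multiplication by a coordinate
  passes to other operators and other windows.
\<close>
definition decays :: "('n::finite phase_space \<Rightarrow> real) \<Rightarrow> bool" where
  "decays \<rho> \<longleftrightarrow> (\<forall>S f h. beals S \<longrightarrow> f \<in> schwartz \<longrightarrow> h \<in> schwartz \<longrightarrow>
     (\<exists>C. \<forall>z z'. \<rho> (z - z') * cmod (tf_matrix S f h z z') \<le> C))"

lemma decays_coord:
  assumes d: "decays \<rho>" and pos: "\<And>v. \<rho> v \<ge> 0"
  shows "decays (\<lambda>v. \<bar>phase_coord k v\<bar> * \<rho> v)"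
  unfolding decays_def
proof (intro allI impI)
  fix S :: "(real ^ 'a \<Rightarrow> complex) \<Rightarrow> 'a functional" and f h :: "real ^ 'a \<Rightarrow> complex"
  assume S: "beals S" and f: "f \<in> schwartz" and h: "h \<in> schwartz"
  obtain C1 where C1: "\<And>z z'. \<rho> (z - z') * cmod (tf_matrix (commutator k S) f h z z') \<le> C1"
    using d beals_commutator[OF S, of k] f h unfolding decays_def by blast
  obtain C2 where C2: "\<And>z z'. \<rho> (z - z') * cmod (tf_matrix S (W_op k f) h z z') \<le> C2"
    using d S schwartz_W_op[OF f, of k] h unfolding decays_def by blast
  obtain C3 where C3: "\<And>z z'. \<rho> (z - z') * cmod (tf_matrix S f (W_op k h) z z') \<le> C3"
    using d S f schwartz_W_op[OF h, of k] unfolding decays_def by blast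
  have "\<bar>phase_coord k (z - z')\<bar> * \<rho> (z - z') * cmod (tf_matrix S f h z z') \<le> C1 + C2 + C3" for z z'
  proof -
    have "\<bar>phase_coord k (z - z')\<bar> * cmod (tf_matrix S f h z z') =
        cmod (complex_of_real (phase_coord k (z - z')) * tf_matrix S f h z z')"
      by (simp add: norm_mult)
    also have "\<dots> \<le> cmod (tf_matrix (commutator k S) f h z z') + cmod (tf_matrix S (W_op k f) h z z')
         + cmod (tf_matrix S f (W_op k h) z z')"
      unfolding tf_matrix_commutator[OF beals_L2_form[OF S] f h]
      by (rule order_trans[OF norm_triangle_ineq] add_mono norm_triangle_ineq4 order_refl)+
    finally have "\<rho> (z - z') * (\<bar>phase_coord k (z - z')\<bar> * cmod (tf_matrix S f h z z')) \<le>
       \<rho> (z - z') * (cmod (tf_matrix (commutator k S) f h z z') + cmod (tf_matrix S (W_op k f) h z z')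
         + cmod (tf_matrix S f (W_op k h) z z'))"
      by (intro mult_left_mono pos)
    also have "\<dots> \<le> C1 + C2 + C3"
      unfolding distrib_left by (intro add_mono C1 C2 C3)
    finally show ?thesis by (simp add: mult_ac)
  qed
  then show "\<exists>C. \<forall>z z'. \<bar>phase_coord k (z - z')\<bar> * \<rho> (z - z') * cmod (tf_matrix S f h z z') \<le> C"
    by blast
qed

lemma decays_add:
  assumes "decays \<rho>" "decays \<sigma>" shows "decays (\<lambda>v. \<rho> v + \<sigma> v)"
  unfolding decays_def
proof (intro allI impI)
  fix S :: "(real ^ 'a \<Rightarrow> complex) \<Rightarrow> 'a functional" and f h :: "real ^ 'a \<Rightarrow> complex"
  assume *: "beals S" "f \<in> schwartz" "h \<in> schwartz"
  obtain C1 where C1: "\<And>z z'. \<rho> (z - z') * cmod (tf_matrix S f h z z') \<le> C1"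
    using assms(1) * unfolding decays_def by blast
  obtain C2 where C2: "\<And>z z'. \<sigma> (z - z') * cmod (tf_matrix S f h z z') \<le> C2"
    using assms(2) * unfolding decays_def by blast
  show "\<exists>C. \<forall>z z'. (\<rho> (z - z') + \<sigma> (z - z')) * cmod (tf_matrix S f h z z') \<le> C"
    unfolding distrib_right by (intro exI[of _ "C1 + C2"] allI add_mono C1 C2)
qed

text \<open>
  Each factor of the weight is \<open>1 + t\<^sup>2\<close> for a coordinate \<open>t\<close> of phase space, so it is gained by adding the original
  bound to the bound multiplied twice by \<open>\<bar>t\<bar>\<close>.
\<close>
lemma decays_weight: "decays (\<lambda>v. weight v ^ m)"
proof -
  have 0: "decays (\<lambda>_. 1)"
    unfolding decays_def mult_1 using tf_matrix_bounded beals_L2_form by blast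
  have 1: "decays (\<lambda>v. (1 + (phase_coord k v)\<^sup>2) * \<rho> v)" if "decays \<rho>" "\<And>v. \<rho> v \<ge> 0"
    for k :: "'a + 'a" and \<rho>
  proof -
    have "decays (\<lambda>v. \<rho> v + \<bar>phase_coord k v\<bar> * (\<bar>phase_coord k v\<bar> * \<rho> v))"
      using that by (intro decays_add decays_coord) auto
    moreover have "\<rho> v + \<bar>phase_coord k v\<bar> * (\<bar>phase_coord k v\<bar> * \<rho> v) = (1 + (phase_coord k v)\<^sup>2) * \<rho> v" for v
      unfolding mult.assoc[symmetric] abs_mult_self_eq by (simp add: power2_eq_square distrib_right)
    ultimately show ?thesis by simp
  qed
  have 2: "decays (\<lambda>v. (\<Prod>k\<in>K. 1 + (phase_coord k v)\<^sup>2) * \<rho> v)"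
    if "finite K" "decays \<rho>" "\<And>v. \<rho> v \<ge> 0" for K :: "('a + 'a) set" and \<rho>
    using that
  proof (induction K)
    case (insert k K)
    then show ?case
      using 1[of "\<lambda>v. (\<Prod>k\<in>K. 1 + (phase_coord k v)\<^sup>2) * \<rho> v" k] by (simp add: mult.assoc prod_nonneg)
  qed simp
  show ?thesis
  proof (induction m)
    case (Suc m)
    from 2[OF finite this] show ?case by (simp add: weight_phase prod_nonneg)
  qed (simp add: 0)
qed

lemma tf_matrix_decay:
  assumes "beals S" "f \<in> schwartz" "h \<in> schwartz"
  obtains C where "C > 0" "\<And>z z'. cmod (tf_matrix S f h z z') \<le> C / weight (z - z') ^ m"
proof -
  obtain C where C: "\<And>z z'. weight (z - z') ^ m * cmod (tf_matrix S f h z z') \<le> C"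
    using decays_weight[of m] assms unfolding decays_def by blast
  have "cmod (tf_matrix S f h z z') \<le> (\<bar>C\<bar> + 1) / weight (z - z') ^ m" for z z'
    using C[of z z'] by (simp add: field_simps)
  then show ?thesis by (intro that[of "\<bar>C\<bar> + 1"]) auto
qed

section \<open>The symbol of an operator\<close>

text \<open>
  The increment from \<open>x\<close> to \<open>y\<close> is split into steps along the coordinate axes. In each step the function minus
  its linear part at \<open>x\<close> has a small derivative.
\<close>
lemma has_derivative_continuous_partials:
  fixes F :: "'a::euclidean_space \<Rightarrow> 'b::real_normed_vector"
  assumes d: "\<And>x b. b \<in> Basis \<Longrightarrow> ((\<lambda>t. F (x + t *\<^sub>R b)) has_vector_derivative F' b x) (at 0)"
    and cont: "\<And>b. b \<in> Basis \<Longrightarrow> continuous_on UNIV (F' b)"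
  shows "(F has_derivative (\<lambda>v. \<Sum>b\<in>Basis. (v \<bullet> b) *\<^sub>R F' b x)) (at x)"
  unfolding has_derivative_at_alt
proof (intro conjI allI impI)
  show "bounded_linear (\<lambda>v. \<Sum>b\<in>Basis. (v \<bullet> b) *\<^sub>R F' b x)"
    by (intro bounded_linear_sum bounded_linear_scaleR_const bounded_linear_inner_left)
  fix e :: real assume e: "e > 0"
  define e' where "e' = e / DIM('a)"
  have e': "e' > 0" using e by (simp add: e'_def)
  have "continuous_on UNIV (\<lambda>y. \<Sum>b\<in>Basis. norm (F' b y - F' b x))"
    by (intro continuous_intros cont)
  then have "isCont (\<lambda>y. \<Sum>b\<in>Basis. norm (F' b y - F' b x)) x"
    by (simp add: continuous_on_eq_continuous_at)
  then obtain r where r: "r > 0"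
    "\<And>y. dist y x < r \<Longrightarrow> dist (\<Sum>b\<in>Basis. norm (F' b y - F' b x)) (\<Sum>b\<in>Basis. norm (F' b x - F' b x)) < e'"
    using e' unfolding continuous_at_eps_delta by blast
  have close: "norm (F' b y - F' b x) \<le> e'" if "norm (y - x) < r" "b \<in> Basis" for b y
  proof -
    have "norm (F' b y - F' b x) \<le> (\<Sum>b\<in>Basis. norm (F' b y - F' b x))"
      using that(2) by (intro member_le_sum) auto
    also have "\<dots> \<le> e'" using r(2)[of y] that(1) by (simp add: dist_norm sum_nonneg)
    finally show ?thesis .
  qed
  have dt: "((\<lambda>s. F (y + s *\<^sub>R b)) has_vector_derivative F' b (y + s *\<^sub>R b)) (at s)"
    if "b \<in> Basis" for b y s
  proof -
    have 1: "((\<lambda>t. t - s) has_derivative (\<lambda>t. t)) (at s)"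
      by (auto intro!: derivative_eq_intros)
    have 2: "((\<lambda>t. F ((y + s *\<^sub>R b) + t *\<^sub>R b)) has_derivative (\<lambda>t. t *\<^sub>R F' b (y + s *\<^sub>R b))) (at (s - s))"
      using d[OF that, of "y + s *\<^sub>R b"] by (simp add: has_vector_derivative_def)
    show ?thesis
      using has_derivative_compose[OF 1 2]
      by (simp add: has_vector_derivative_def scaleR_diff_left)
  qed
  show "\<exists>r>0. \<forall>y. norm (y - x) < r \<longrightarrow>
     norm (F y - F x - (\<Sum>b\<in>Basis. ((y - x) \<bullet> b) *\<^sub>R F' b x)) \<le> e * norm (y - x)"
  proof (intro exI[of _ r] conjI r(1) allI impI)
    fix y assume y: "norm (y - x) < r"
    define v where "v = y - x"
    \<comment> \<open>The part of the increment that has been made after the coordinates in \<open>B\<close>.\<close>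
    define p where "p B = (\<Sum>b\<in>B. (v \<bullet> b) *\<^sub>R b)" for B :: "'a set"
    have p_inner: "p B \<bullet> c = (if c \<in> B then v \<bullet> c else 0)" if "B \<subseteq> Basis" "c \<in> Basis" for B c
    proof -
      have "p B \<bullet> c = (\<Sum>b\<in>B. if b = c then v \<bullet> b else 0)"
        unfolding p_def inner_sum_left using that
        by (intro sum.cong refl) (auto simp: inner_Basis subset_iff)
      also have "\<dots> = (if c \<in> B then v \<bullet> c else 0)"
        using finite_subset[OF that(1)] by simp
      finally show ?thesis .
    qed
    have "norm (F (x + p B) - F x - (\<Sum>b\<in>B. (v \<bullet> b) *\<^sub>R F' b x)) \<le> card B * (e' * norm v)"
      if "finite B" "B \<subseteq> Basis" for B
      using that
    proof (induction B)
      case (insert b B)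
      have b: "b \<in> Basis" "B \<subseteq> Basis" using insert.prems by auto
      have small: "norm (F' b (x + p B + s *\<^sub>R b) - F' b x) \<le> e'" if "\<bar>s\<bar> \<le> \<bar>v \<bullet> b\<bar>" for s
      proof (rule close[OF _ b(1)])
        have "norm (p B + s *\<^sub>R b) \<le> norm v"
          using that insert.hyps(2)
          by (intro norm_le_componentwise) (auto simp: inner_add_left p_inner[OF b(2)] inner_Basis b)
        then show "norm (x + p B + s *\<^sub>R b - x) < r" using y by (simp add: v_def add.assoc)
      qed
      have "norm ((F (x + p B + (v \<bullet> b) *\<^sub>R b) - (v \<bullet> b) *\<^sub>R F' b x) - (F (x + p B + 0 *\<^sub>R b) - 0 *\<^sub>R F' b x))
         \<le> e' * \<bar>v \<bullet> b\<bar>"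
      proof (rule vector_derivative_first_order_bound)
        show "((\<lambda>s. F (x + p B + s *\<^sub>R b) - s *\<^sub>R F' b x) has_vector_derivative
           F' b (x + p B + s *\<^sub>R b) - F' b x) (at s)" for s
          using dt[OF b(1)] by (auto intro!: derivative_eq_intros)
      qed (rule small)
      then have 1: "norm (F (x + p B + (v \<bullet> b) *\<^sub>R b) - F (x + p B) - (v \<bullet> b) *\<^sub>R F' b x) \<le> e' * \<bar>v \<bullet> b\<bar>"
        by (simp add: algebra_simps)
      have pi: "p (insert b B) = p B + (v \<bullet> b) *\<^sub>R b"
        using insert.hyps by (simp add: p_def)
      have "F (x + p (insert b B)) - F x - (\<Sum>b\<in>insert b B. (v \<bullet> b) *\<^sub>R F' b x)
         = (F (x + p B) - F x - (\<Sum>b\<in>B. (v \<bullet> b) *\<^sub>R F' b x))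
         + (F (x + p B + (v \<bullet> b) *\<^sub>R b) - F (x + p B) - (v \<bullet> b) *\<^sub>R F' b x)"
        using insert.hyps by (simp add: pi add.assoc)
      also have "norm \<dots> \<le> card B * (e' * norm v) + e' * \<bar>v \<bullet> b\<bar>"
        by (intro norm_triangle_le[OF add_mono] insert.IH[OF b(2)] 1)
      also have "\<dots> \<le> card B * (e' * norm v) + e' * norm v"
        using Basis_le_norm[OF b(1), of v] e' by simp
      also have "\<dots> = card (insert b B) * (e' * norm v)"
        using insert.hyps by (simp add: algebra_simps)
      finally show ?case .
    qed (simp add: p_def)
    from this[of Basis]
    show "norm (F y - F x - (\<Sum>b\<in>Basis. ((y - x) \<bullet> b) *\<^sub>R F' b x)) \<le> e * norm (y - x)"
      by (simp add: p_def euclidean_representation e'_def flip: v_def) (simp add: v_def)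
  qed
qed

text \<open>
  With \<open>z = w + u\<close> this is \<open>\<langle>g\<^sub>z, S P\<^sub>w g\<^sub>z\<rangle>\<close> (see \<open>symbol_integrand_parity\<close>). In the variable \<open>u\<close> the point \<open>w\<close> occurs
  only in the outer shifts, and the reflection is the one about the origin.
\<close>
definition symbol_integrand ::
  "(real ^ 'n::finite \<Rightarrow> complex) \<Rightarrow> ((real ^ 'n \<Rightarrow> complex) \<Rightarrow> 'n functional) \<Rightarrow>
   'n phase_space \<Rightarrow> 'n phase_space \<Rightarrow> complex" where
  "symbol_integrand g S w u = tf_matrix S (tf u g) (\<lambda>x. tf u g (- x)) w w"

text \<open>
  Formally, up to a constant factor, the trace of \<open>S P\<^sub>w\<close>, evaluated with coherent states.
\<close>
definition parity_symbol ::
  "(real ^ 'n::finite \<Rightarrow> complex) \<Rightarrow> ((real ^ 'n \<Rightarrow> complex) \<Rightarrow> 'n functional) \<Rightarrow>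
   'n phase_space \<Rightarrow> complex" where
  "parity_symbol g S w = (LBINT u. symbol_integrand g S w u)"

lemma tf_reflect: "(\<lambda>x. tf u g (- x)) = tf (- u) (\<lambda>x. g (- x))"
  by (rule ext) (simp add: tf_def)

lemma symbol_integrand_eq:
  assumes "L2_form S" "g \<in> schwartz"
  shows "symbol_integrand g S w u =
    iexp (2 * (snd u \<bullet> fst w)) * tf_matrix S g (\<lambda>x. g (- x)) (w + u) (w - u)"
  unfolding symbol_integrand_def tf_reflect
  by (subst tf_matrix_tf) (simp_all add: assms schwartz_reflect)

lemma continuous_on_symbol_integrand [continuous_intros]:
  assumes "L2_form S" "g \<in> schwartz" "continuous_on A w" "continuous_on A u"
  shows "continuous_on A (\<lambda>x. symbol_integrand g S (w x) (u x))"
  unfolding symbol_integrand_eq[OF assms(1,2)] using assms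
  by (intro continuous_intros schwartz_reflect)

text \<open>
  The two coherent states sit at \<open>w + u\<close> and \<open>w - u\<close>, which are \<open>2u\<close> apart, independently of \<open>w\<close>.
\<close>
lemma symbol_integrand_bound:
  assumes S: "beals S" and g: "g \<in> schwartz"
  obtains C where "C > 0" "\<And>w u. cmod (symbol_integrand g S w u) \<le> C / weight u"
proof -
  obtain C where C: "C > 0"
    "\<And>z z'. cmod (tf_matrix S g (\<lambda>x. g (- x)) z z') \<le> C / weight (z - z') ^ 1"
    using tf_matrix_decay[OF S g schwartz_reflect[OF g]] by metis
  have "cmod (symbol_integrand g S w u) \<le> C / weight u" for w u
  proof -
    have "cmod (symbol_integrand g S w u) \<le> C / weight (2 *\<^sub>R u)"
      using C(2)[of "w + u" "w - u"]
      by (simp add: symbol_integrand_eq[OF beals_L2_form[OF S] g] norm_mult scaleR_2)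
    also have "\<dots> \<le> C / weight u"
      using C(1) weight_mono_scale[of 2 u] by (intro divide_left_mono) auto
    finally show ?thesis .
  qed
  with C(1) that show ?thesis by blast
qed

lemma symbol_integrand_measurable:
  assumes "L2_form S" "g \<in> schwartz"
  shows "(\<lambda>u. symbol_integrand g S w u) \<in> borel_measurable borel"
  using assms by (intro borel_measurable_continuous_onI continuous_intros)

lemma symbol_integrand_integrable:
  assumes S: "beals S" and g: "g \<in> schwartz"
  shows "integrable lborel (symbol_integrand g S w)"
proof -
  obtain C where "\<And>w u. cmod (symbol_integrand g S w u) \<le> C / weight u"
    using symbol_integrand_bound[OF assms] by metis
  then show ?thesis
    by (intro integrable_weight_bound symbol_integrand_measurable beals_L2_form[OF S] g)
qed

lemma parity_symbol_bounded:
  assumes S: "beals S" and g: "g \<in> schwartz"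
  shows "\<exists>C. \<forall>w. cmod (parity_symbol g S w) \<le> C"
proof -
  obtain C where C: "\<And>w u. cmod (symbol_integrand g S w u) \<le> C / weight u"
    using symbol_integrand_bound[OF assms] by metis
  have "cmod (parity_symbol g S w) \<le> (LBINT u. C * (1 / weight (u :: 'a phase_space)))" for w
    unfolding parity_symbol_def
  proof (rule order_trans[OF integral_norm_bound], rule integral_mono)
    show "integrable lborel (\<lambda>u. cmod (symbol_integrand g S w u))"
      by (intro integrable_norm symbol_integrand_integrable assms)
    show "integrable lborel (\<lambda>u. C * (1 / weight (u :: 'a phase_space)))"
      by (intro integrable_mult_right integrable_inverse_weight)
  qed (simp add: C)
  then show ?thesis by blast
qed

lemma continuous_on_parity_symbol:
  assumes S: "beals S" and g: "g \<in> schwartz"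
  shows "continuous_on A (parity_symbol g S)"
proof (rule continuous_on_sequentiallyI)
  fix W :: "nat \<Rightarrow> 'a phase_space" and w assume W: "W \<longlonglongrightarrow> w"
  obtain C where C: "\<And>w u. cmod (symbol_integrand g S w u) \<le> C / weight u"
    using symbol_integrand_bound[OF assms] by metis
  note meas = symbol_integrand_measurable[OF beals_L2_form[OF S] g]
  show "(\<lambda>n. parity_symbol g S (W n)) \<longlonglongrightarrow> parity_symbol g S w"
    unfolding parity_symbol_def
  proof (rule integral_dominated_convergence)
    show "integrable lborel (\<lambda>u. C * (1 / weight (u :: 'a phase_space)))"
      by (intro integrable_mult_right integrable_inverse_weight)
    show "AE u in lborel. (\<lambda>n. symbol_integrand g S (W n) u) \<longlonglongrightarrow> symbol_integrand g S w u"
    proof (rule AE_I2)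
      fix u
      have "continuous_on UNIV (\<lambda>w. symbol_integrand g S w u)"
        by (intro continuous_intros beals_L2_form[OF S] g)
      from continuous_on_tendsto_compose[OF this W]
      show "(\<lambda>n. symbol_integrand g S (W n) u) \<longlonglongrightarrow> symbol_integrand g S w u" by simp
    qed
  qed (use meas C in auto)
qed

lemma symbol_integrand_derivative:
  assumes S: "beals S" and g: "g \<in> schwartz"
  shows "((\<lambda>t. symbol_integrand g S (w + t *\<^sub>R phase_dir k) u) has_vector_derivative
     - gen_factor k * symbol_integrand g (commutator k S) (w + s *\<^sub>R phase_dir k) u) (at s within A)"
  unfolding symbol_integrand_def
  by (intro tf_matrix_diag_derivative beals_L2_form S schwartz_tf schwartz_reflect g)

text \<open>
  The second order remainder of the integrand involves the double commutator and is therefore bounded by an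
  integrable function of \<open>u\<close>, so that the Taylor expansion can be integrated.
\<close>
lemma parity_symbol_derivative:
  assumes S: "beals S" and g: "g \<in> schwartz"
  shows "((\<lambda>t. parity_symbol g S (w + t *\<^sub>R phase_dir k)) has_vector_derivative
     - gen_factor k * parity_symbol g (commutator k S) w) (at 0)"
proof -
  let ?e = "phase_dir k :: 'a phase_space"
  let ?S1 = "commutator k S"
  let ?S2 = "commutator k ?S1"
  have S1: "beals ?S1" by (intro beals_commutator S)
  have S2: "beals ?S2" by (intro beals_commutator S)
  obtain C where C: "C > 0" "\<And>w u. cmod (symbol_integrand g ?S2 w u) \<le> C / weight u"
    using symbol_integrand_bound[OF S2 g] by metis
  have tay: "cmod (symbol_integrand g S (w + t *\<^sub>R ?e) u - symbol_integrand g S w u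
      - t *\<^sub>R (- gen_factor k * symbol_integrand g ?S1 w u)) \<le> C * t\<^sup>2 * (1 / weight u)" for t u
  proof -
    have "cmod (symbol_integrand g S (w + t *\<^sub>R ?e) u - symbol_integrand g S (w + 0 *\<^sub>R ?e) u
      - t *\<^sub>R (- gen_factor k * symbol_integrand g ?S1 (w + 0 *\<^sub>R ?e) u)) \<le> C / weight u * t\<^sup>2"
    proof (rule vector_derivative_second_order_bound[OF symbol_integrand_derivative[OF S g]])
      show "((\<lambda>s. - gen_factor k * symbol_integrand g ?S1 (w + s *\<^sub>R ?e) u) has_vector_derivative
         - gen_factor k * (- gen_factor k * symbol_integrand g ?S2 (w + s *\<^sub>R ?e) u)) (at s)" for s
        by (intro has_vector_derivative_mult_right symbol_integrand_derivative S1 g)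
    qed (simp add: norm_mult cmod_gen_factor C)
    then show ?thesis by simp
  qed
  note int = symbol_integrand_integrable
  define K where "K = C * (LBINT u. 1 / weight (u :: 'a phase_space))"
  show ?thesis
    unfolding has_vector_derivative_def
  proof (rule has_derivative_quadratic_remainder[where C = K])
    show "bounded_linear (\<lambda>t. t *\<^sub>R (- gen_factor k * parity_symbol g ?S1 w))"
      by (rule bounded_linear_scaleR_left)
    fix t :: real
    have i: "integrable lborel (\<lambda>u. symbol_integrand g S (w + t *\<^sub>R ?e) u - symbol_integrand g S w u
       - t *\<^sub>R (- gen_factor k * symbol_integrand g ?S1 w u))"
      by (intro Bochner_Integration.integrable_diff int S S1 g integrable_scaleR_right integrable_mult_right)
    have "parity_symbol g S (w + t *\<^sub>R ?e) - parity_symbol g S w - t *\<^sub>R (- gen_factor k * parity_symbol g ?S1 w)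
      = (LBINT u. symbol_integrand g S (w + t *\<^sub>R ?e) u - symbol_integrand g S w u
       - t *\<^sub>R (- gen_factor k * symbol_integrand g ?S1 w u))"
      unfolding parity_symbol_def
      by (simp add: int S S1 g)
    also have "cmod \<dots> \<le> (LBINT u. C * t\<^sup>2 * (1 / weight (u :: 'a phase_space)))"
      by (rule order_trans[OF integral_norm_bound], rule integral_mono[OF integrable_norm[OF i]])
         (use tay in \<open>auto intro!: integrable_mult_right integrable_inverse_weight simp del: times_divide_eq_right\<close>)
    also have "\<dots> = K * (norm t)\<^sup>2" by (simp add: K_def del: times_divide_eq_right)
    finally show "cmod (parity_symbol g S (w + (0 + t) *\<^sub>R ?e) - parity_symbol g S (w + 0 *\<^sub>R ?e)
      - t *\<^sub>R (- gen_factor k * parity_symbol g ?S1 w)) \<le> K * (norm t)\<^sup>2" by simp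
  qed
qed

lemma Basis_phase_dir:
  assumes "b \<in> (Basis :: ('n::finite phase_space) set)" obtains k where "b = phase_dir k"
proof -
  from assms consider c where "c \<in> Basis" "b = (c, 0)" | c where "c \<in> Basis" "b = (0, c)"
    by (auto simp: Basis_prod_def)
  then show ?thesis
  proof cases
    case 1 then show ?thesis by (metis Basis_axis phase_dir.simps(2) that)
  next
    case 2 then show ?thesis by (metis Basis_axis phase_dir.simps(1) that)
  qed
qed

lemma parity_symbol_has_derivative:
  assumes S: "beals S" and g: "g \<in> schwartz"
  shows "parity_symbol g S differentiable (at w)"
    and "partial_deriv (phase_dir k) (parity_symbol g S) w = - gen_factor k * parity_symbol g (commutator k S) w"
proof -
  define F' where "F' b w = vector_derivative (\<lambda>t. parity_symbol g S (w + t *\<^sub>R b)) (at 0)" for b w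
  have F': "F' (phase_dir k) w = - gen_factor k * parity_symbol g (commutator k S) w" for k w
    unfolding F'_def by (rule vector_derivative_at[OF parity_symbol_derivative[OF S g]])
  have "(parity_symbol g S has_derivative (\<lambda>v. \<Sum>b\<in>Basis. (v \<bullet> b) *\<^sub>R F' b w)) (at w)"
  proof (rule has_derivative_continuous_partials)
    fix b :: "'a phase_space" assume "b \<in> Basis"
    then obtain k where b: "b = phase_dir k" by (rule Basis_phase_dir)
    show "((\<lambda>t. parity_symbol g S (x + t *\<^sub>R b)) has_vector_derivative F' b x) (at 0)" for x
      unfolding b F' by (rule parity_symbol_derivative[OF S g])
    have "F' b = (\<lambda>w. - gen_factor k * parity_symbol g (commutator k S) w)"
      unfolding b by (rule ext) (rule F')
    then show "continuous_on UNIV (F' b)"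
      by (simp only:) (intro continuous_intros continuous_on_parity_symbol beals_commutator S g)
  qed
  then show "parity_symbol g S differentiable (at w)"
    unfolding differentiable_def by blast
  show "partial_deriv (phase_dir k) (parity_symbol g S) w = - gen_factor k * parity_symbol g (commutator k S) w"
    using F' by (simp add: F'_def partial_deriv_def)
qed

text \<open>
  Multiples of symbols of operators with bounded commutators form a class of bounded differentiable functions
  that is closed under partial derivatives.
\<close>
theorem parity_symbol_in_S000:
  assumes S: "beals S" and g: "g \<in> schwartz"
  shows "(\<lambda>w. c * parity_symbol g S w) \<in> S000"
proof -
  define A where "A = {\<lambda>w. c * parity_symbol g S w | c S. beals S}"
  have diff: "f differentiable_on UNIV" if "f \<in> A" for f
    using that parity_symbol_has_derivative(1)[OF _ g] unfolding A_def differentiable_on_def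
    by (auto intro!: differentiable_mult differentiable_const)
  have bdd: "bounded (range f)" if f: "f \<in> A" for f
  proof -
    obtain c S where S: "beals S" and f: "f = (\<lambda>w. c * parity_symbol g S w)"
      using f unfolding A_def by blast
    obtain C where "\<And>w. cmod (parity_symbol g S w) \<le> C"
      using parity_symbol_bounded[OF S g] by blast
    then have "cmod (f w) \<le> cmod c * C" for w
      unfolding f norm_mult by (intro mult_left_mono) auto
    then show ?thesis unfolding bounded_iff by blast
  qed
  have pd: "partial_deriv b f \<in> A" if f: "f \<in> A" and "b \<in> Basis" for f b
  proof -
    obtain c S where S: "beals S" and f: "f = (\<lambda>w. c * parity_symbol g S w)"
      using f unfolding A_def by blast
    obtain k where b: "b = phase_dir k" using \<open>b \<in> Basis\<close> by (rule Basis_phase_dir)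
    have "partial_deriv b f w = (c * - gen_factor k) * parity_symbol g (commutator k S) w" for w
    proof -
      have "((\<lambda>t. c * parity_symbol g S (w + t *\<^sub>R phase_dir k)) has_vector_derivative
          c * (- gen_factor k * parity_symbol g (commutator k S) w)) (at 0)"
        by (intro has_vector_derivative_mult_right parity_symbol_derivative S g)
      from vector_derivative_at[OF this] show ?thesis by (simp add: f b partial_deriv_def)
    qed
    then show ?thesis unfolding A_def using beals_commutator[OF S] by blast
  qed
  have "(\<lambda>w. c * parity_symbol g S w) \<in> A" unfolding A_def using S by blast
  from iter_deriv_in[OF this pd] show ?thesis
    unfolding S000_def smooth_def using diff bdd by blast
qed

section \<open>Fourier inversion\<close>

lemma
  fixes f :: "'a::euclidean_space \<times> 'b::euclidean_space \<Rightarrow> 'c::{banach, second_countable_topology}"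
  assumes "integrable lborel f"
  shows lborel_integral_fst: "(LBINT x. (LBINT y. f (x, y))) = (LBINT z. f z)"
    and lborel_integral_snd: "(LBINT y. (LBINT x. f (x, y))) = (LBINT z. f z)"
    and lborel_integral_swap: "(LBINT x. (LBINT y. f (x, y))) = (LBINT y. (LBINT x. f (x, y)))"
proof -
  have i: "integrable (lborel \<Otimes>\<^sub>M lborel) (\<lambda>(x, y). f (x, y))"
    using assms by (simp add: lborel_prod)
  show 1: "(LBINT x. (LBINT y. f (x, y))) = (LBINT z. f z)"
    using lborel_pair.integral_fst[OF i] by (simp add: lborel_prod)
  show "(LBINT y. (LBINT x. f (x, y))) = (LBINT z. f z)"
    using lborel_pair.integral_snd[OF i] by (simp add: lborel_prod)
  with 1 show "(LBINT x. (LBINT y. f (x, y))) = (LBINT y. (LBINT x. f (x, y)))"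
    by simp
qed

lemma lborel_integrable_product_bound:
  fixes f :: "'a::euclidean_space \<times> 'b::euclidean_space \<Rightarrow> 'c::{banach, second_countable_topology}"
  assumes f: "f \<in> borel_measurable borel"
    and a: "integrable lborel a" and b: "integrable lborel b"
    and le: "\<And>x y. norm (f (x, y)) \<le> a x * b y"
  shows "integrable lborel f"
proof -
  have "integrable (lborel \<Otimes>\<^sub>M lborel) (\<lambda>(x, y). \<bar>a x\<bar> * \<bar>b y\<bar>)"
  proof (rule lborel_pair.Fubini_integrable)
    have [measurable]: "a \<in> borel_measurable lborel" "b \<in> borel_measurable lborel"
      using a b by auto
    show "(\<lambda>(x, y). \<bar>a x\<bar> * \<bar>b y\<bar>) \<in> borel_measurable (lborel \<Otimes>\<^sub>M lborel)" by measurable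
    show "integrable lborel (\<lambda>x. \<integral>y. norm (case (x, y) of (x, y) \<Rightarrow> \<bar>a x\<bar> * \<bar>b y\<bar>) \<partial>lborel)"
      using a by (auto simp: abs_mult)
    show "AE x in lborel. integrable lborel (\<lambda>y. case (x, y) of (x, y) \<Rightarrow> \<bar>a x\<bar> * \<bar>b y\<bar>)"
      using b by auto
  qed
  then have "integrable lborel (\<lambda>(x, y). \<bar>a x\<bar> * \<bar>b y\<bar>)" by (simp add: lborel_prod)
  then show ?thesis
  proof (rule Bochner_Integration.integrable_bound)
    have "norm (f z) \<le> norm (case z of (x, y) \<Rightarrow> \<bar>a x\<bar> * \<bar>b y\<bar>)" for z
    proof -
      have "norm (f z) \<le> \<bar>a (fst z) * b (snd z)\<bar>"
        using le[of "fst z" "snd z"] by simp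
      then show ?thesis by (simp add: abs_mult case_prod_beta)
    qed
    then show "AE z in lborel. norm (f z) \<le> norm (case z of (x, y) \<Rightarrow> \<bar>a x\<bar> * \<bar>b y\<bar>)" by blast
  qed (use f in simp)
qed

lemma
  fixes f :: "'a::euclidean_space \<Rightarrow> real \<Rightarrow> complex"
  assumes f: "\<And>b. b \<in> Basis \<Longrightarrow> integrable lborel (f b)"
    and meas: "\<And>b. b \<in> Basis \<Longrightarrow> f b \<in> borel_measurable borel"
  shows integral_lborel_prod_Basis: "(LBINT x. (\<Prod>b\<in>Basis. f b (x \<bullet> b))) = (\<Prod>b\<in>Basis. (LBINT t. f b t))"
    and integrable_lborel_prod_Basis: "integrable lborel (\<lambda>x. \<Prod>b\<in>Basis. f b (x \<bullet> b))"
proof -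
  interpret product_sigma_finite "\<lambda>_::'a. lborel :: real measure" ..
  have m: "(\<lambda>x. \<Prod>b\<in>Basis. f b (x \<bullet> b)) \<in> borel_measurable borel"
    by (intro borel_measurable_prod measurable_compose[OF _ meas]) auto
  have t: "(\<lambda>v. \<Sum>b\<in>Basis. v b *\<^sub>R b) \<in> measurable (\<Pi>\<^sub>M b\<in>Basis. lborel) (borel :: 'a measure)"
    by measurable
  have eq: "(\<Prod>c\<in>Basis. f c ((\<Sum>b\<in>Basis. v b *\<^sub>R b) \<bullet> c)) = (\<Prod>c\<in>Basis. f c (v c))" for v
    by (intro prod.cong refl) (simp add: inner_sum_left inner_Basis sum.delta if_distrib cong: if_cong)
  have "(LBINT x. (\<Prod>b\<in>Basis. f b (x \<bullet> b))) = (\<integral>v. (\<Prod>c\<in>Basis. f c (v c)) \<partial>(\<Pi>\<^sub>M b\<in>Basis. lborel))"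
    by (subst lborel_eq, subst integral_distr[OF t m]) (simp add: eq)
  also have "\<dots> = (\<Prod>b\<in>Basis. (LBINT t. f b t))"
    by (rule product_integral_prod) (auto intro: f)
  finally show "(LBINT x. (\<Prod>b\<in>Basis. f b (x \<bullet> b))) = (\<Prod>b\<in>Basis. (LBINT t. f b t))" .
  show "integrable lborel (\<lambda>x. \<Prod>b\<in>Basis. f b (x \<bullet> b))"
    by (subst lborel_eq, subst integrable_distr_eq[OF t m])
       (simp add: eq, rule product_integrable_prod, auto intro: f)
qed

definition gaussian :: "'a::euclidean_space \<Rightarrow> real" where
  "gaussian x = exp (- (norm x)\<^sup>2 / 2)"

lemma gaussian_props: "gaussian 0 = 1" "gaussian x \<le> 1" "gaussian x \<ge> 0"
  by (simp_all add: gaussian_def)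

lemma continuous_on_gaussian [continuous_intros]:
  "continuous_on A f \<Longrightarrow> continuous_on A (\<lambda>x. gaussian (f x))"
  unfolding gaussian_def by (intro continuous_intros) auto

text \<open>
  The integrand factorises over the coordinates, and in one dimension the integral is the characteristic
  function of the standard normal distribution.
\<close>
lemma
  fixes \<xi> :: "'a::euclidean_space"
  shows gaussian_fourier:
    "(LBINT x. complex_of_real (gaussian x) * iexp (\<xi> \<bullet> x)) =
      complex_of_real (sqrt (2 * pi) ^ DIM('a) * gaussian \<xi>)"
    and integrable_gaussian: "integrable lborel (gaussian :: 'a \<Rightarrow> real)"
proof -
  define f where "f b t = complex_of_real (exp (- t\<^sup>2 / 2)) * iexp ((\<xi> \<bullet> b) * t)" for b t
  have dens: "exp (- t\<^sup>2 / 2) = sqrt (2 * pi) * std_normal_density t" for t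
    by (simp add: std_normal_density_def field_simps)
  have [measurable]: "f b \<in> borel_measurable borel" for b
    unfolding f_def by (intro borel_measurable_continuous_onI continuous_intros) auto
  have nd: "integrable lborel (\<lambda>t. sqrt (2 * pi) * std_normal_density t)"
    by (intro integrable_mult_right integrable_normal_density) simp
  have int: "integrable lborel (f b)" for b
    by (rule Bochner_Integration.integrable_bound[OF nd])
       (auto simp: f_def norm_mult std_normal_density_def)
  have fd: "f b = (\<lambda>t. complex_of_real (sqrt (2 * pi)) * (std_normal_density t *\<^sub>R iexp ((\<xi> \<bullet> b) * t)))" for b
    by (rule ext) (simp add: f_def std_normal_density_def scaleR_conv_of_real)
  have val: "(LBINT t. f b t) = complex_of_real (sqrt (2 * pi) * exp (- (\<xi> \<bullet> b)\<^sup>2 / 2))" for b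
  proof -
    have "complex_of_real (exp (- (\<xi> \<bullet> b)\<^sup>2 / 2)) = char std_normal_distribution (\<xi> \<bullet> b)"
      by (simp add: char_std_normal_distribution)
    also have "\<dots> = (LBINT t. std_normal_density t *\<^sub>R iexp ((\<xi> \<bullet> b) * t))"
      unfolding char_def by (subst integral_density) auto
    also have "complex_of_real (sqrt (2 * pi)) * \<dots> = (LBINT t. f b t)"
      unfolding fd by (rule integral_mult_right_zero[symmetric])
    finally show ?thesis by simp
  qed
  have prod: "(\<Prod>b\<in>Basis. f b (x \<bullet> b)) = complex_of_real (gaussian x) * iexp (\<xi> \<bullet> x)" for x
  proof -
    have "(\<Prod>b\<in>Basis. f b (x \<bullet> b)) = exp (\<Sum>b\<in>Basis. - (x \<bullet> b)\<^sup>2 / 2 + \<i> * complex_of_real ((\<xi> \<bullet> b) * (x \<bullet> b)))"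
      unfolding exp_sum[OF finite_Basis] by (intro prod.cong refl) (simp add: f_def exp_of_real[symmetric] flip: exp_add)
    also have "(\<Sum>b\<in>Basis. - (x \<bullet> b)\<^sup>2 / 2 + \<i> * complex_of_real ((\<xi> \<bullet> b) * (x \<bullet> b)))
       = complex_of_real (- (\<Sum>b\<in>Basis. (x \<bullet> b)\<^sup>2) / 2) + \<i> * complex_of_real (\<Sum>b\<in>Basis. (\<xi> \<bullet> b) * (x \<bullet> b))"
      by (simp add: sum.distrib sum_subtractf sum_distrib_left sum_negf sum_divide_distrib)
    also have "(\<Sum>b\<in>Basis. (x \<bullet> b)\<^sup>2) = (norm x)\<^sup>2"
      unfolding power2_norm_eq_inner euclidean_inner[of x x] by (simp add: power2_eq_square)
    also have "(\<Sum>b\<in>Basis. (\<xi> \<bullet> b) * (x \<bullet> b)) = \<xi> \<bullet> x"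
      by (simp add: euclidean_inner[of \<xi> x])
    finally show ?thesis by (simp add: gaussian_def exp_of_real[symmetric] flip: exp_add)
  qed
  have g\<xi>: "(\<Prod>b\<in>Basis. complex_of_real (sqrt (2 * pi) * exp (- (\<xi> \<bullet> b)\<^sup>2 / 2))) = complex_of_real (sqrt (2 * pi) ^ DIM('a) * gaussian \<xi>)"
  proof -
    have "(\<Prod>b\<in>Basis. exp (- (\<xi> \<bullet> b)\<^sup>2 / 2)) = gaussian \<xi>"
      unfolding exp_sum[OF finite_Basis, symmetric]
      unfolding gaussian_def power2_norm_eq_inner euclidean_inner[of \<xi> \<xi>]
      by (simp add: power2_eq_square sum_negf sum_divide_distrib)
    then show ?thesis by (simp add: prod.distrib flip: of_real_prod)
  qed
  show "(LBINT x. complex_of_real (gaussian x) * iexp (\<xi> \<bullet> x)) =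
      complex_of_real (sqrt (2 * pi) ^ DIM('a) * gaussian \<xi>)"
    using integral_lborel_prod_Basis[of f, OF int] unfolding prod val g\<xi> by simp
  have "integrable lborel (\<lambda>x::'a. complex_of_real (gaussian x) * iexp (\<xi> \<bullet> x))"
    using integrable_lborel_prod_Basis[of f, OF int] unfolding prod by simp
  from integrable_norm[OF this] show "integrable lborel (gaussian :: 'a \<Rightarrow> real)"
    by (simp add: norm_mult gaussian_props)
qed

lemma integral_gaussian: "(LBINT x. gaussian (x::'a::euclidean_space)) = sqrt (2 * pi) ^ DIM('a)"
proof -
  have "complex_of_real (LBINT x. gaussian (x::'a)) = complex_of_real (sqrt (2 * pi) ^ DIM('a))"
    using gaussian_fourier[of "0::'a"] by (simp add: gaussian_props)
  then show ?thesis by (simp only: of_real_eq_iff)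
qed

text \<open>
  The Gaussian factor \<open>e\<^bsup>-|\<epsilon>\<xi>|\<^sup>2/2\<^esup>\<close> makes the double integral absolutely convergent. Exchanging the integrals
  then gives \<open>(2\<pi>)\<^sup>d\<close> times the average of \<open>F\<close> over a Gaussian of width \<open>\<epsilon>\<close> around \<open>x\<close>, and both sides converge as \<open>\<epsilon> \<rightarrow> 0\<close>.
\<close>
theorem fourier_inversion:
  fixes F :: "'a::euclidean_space \<Rightarrow> complex"
  assumes F: "continuous_on UNIV F" and b: "\<And>x. cmod (F x) \<le> C / weight x"
    and G_def: "\<And>\<xi>. G \<xi> = (LBINT y. F y * iexp (\<xi> \<bullet> y))"
    and G: "integrable lborel G"
  shows "(LBINT \<xi>. G \<xi> * exp (- \<i> * complex_of_real (\<xi> \<bullet> x))) = (2 * pi) ^ DIM('a) * F x"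
proof -
  \<comment> \<open>Widths of the Gaussian regularisation.\<close>
  define e where "e n = inverse (real (Suc n))" for n
  have e: "e n > 0" for n by (simp add: e_def)
  have e0: "e \<longlonglongrightarrow> 0" unfolding e_def by (rule LIMSEQ_inverse_real_of_nat)
  have [measurable]: "F \<in> borel_measurable borel" "G \<in> borel_measurable borel"
    using F G by (auto intro: borel_measurable_continuous_onI)
  have [measurable]: "gaussian \<in> borel_measurable (borel :: 'a measure)"
    by (intro borel_measurable_continuous_onI continuous_intros)
  have expm: "(\<lambda>\<xi>. exp (- \<i> * complex_of_real (\<xi> \<bullet> x))) \<in> borel_measurable (borel :: 'a measure)"
    by (intro borel_measurable_continuous_onI continuous_intros)
  note [measurable] = expm
  have C: "C \<ge> 0" using order_trans[OF norm_ge_zero b[of 0]] by simp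
  have bC: "cmod (F y) \<le> C" for y
    using order_trans[OF b[of y]] C weight_ge_1[of y] by (simp add: divide_le_eq mult_le_cancel_left1)
  define I where "I n = (LBINT \<xi>. G \<xi> * exp (- \<i> * complex_of_real (\<xi> \<bullet> x)) * gaussian (e n *\<^sub>R \<xi>))" for n
  have lim1: "I \<longlonglongrightarrow> (LBINT \<xi>. G \<xi> * exp (- \<i> * complex_of_real (\<xi> \<bullet> x)))"
    unfolding I_def
  proof (rule integral_dominated_convergence[where w = "\<lambda>\<xi>. cmod (G \<xi>)"])
    show "AE \<xi> in lborel. (\<lambda>n. G \<xi> * exp (- \<i> * complex_of_real (\<xi> \<bullet> x)) * gaussian (e n *\<^sub>R \<xi>))
       \<longlonglongrightarrow> G \<xi> * exp (- \<i> * complex_of_real (\<xi> \<bullet> x))"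
    proof (rule AE_I2)
      fix \<xi> :: 'a
      have "isCont (\<lambda>r. complex_of_real (gaussian (r *\<^sub>R \<xi>))) 0"
        by (rule continuous_on_interior[of UNIV]) (auto intro!: continuous_intros)
      then have "(\<lambda>n. complex_of_real (gaussian (e n *\<^sub>R \<xi>))) \<longlonglongrightarrow> 1"
        using isCont_tendsto_compose[OF _ e0] by (fastforce simp: gaussian_props)
      from tendsto_mult[OF tendsto_const this]
      show "(\<lambda>n. G \<xi> * exp (- \<i> * complex_of_real (\<xi> \<bullet> x)) * gaussian (e n *\<^sub>R \<xi>))
         \<longlonglongrightarrow> G \<xi> * exp (- \<i> * complex_of_real (\<xi> \<bullet> x))" by fastforce
    qed
    show "AE \<xi> in lborel. cmod (G \<xi> * exp (- \<i> * complex_of_real (\<xi> \<bullet> x)) * gaussian (e n *\<^sub>R \<xi>)) \<le> cmod (G \<xi>)" for n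
    proof (rule AE_I2)
      fix \<xi> :: 'a
      have "\<bar>gaussian (e n *\<^sub>R \<xi>)\<bar> \<le> 1" using gaussian_props(2,3)[of "e n *\<^sub>R \<xi>"] by simp
      then show "cmod (G \<xi> * exp (- \<i> * complex_of_real (\<xi> \<bullet> x)) * gaussian (e n *\<^sub>R \<xi>)) \<le> cmod (G \<xi>)"
        by (simp add: norm_mult mult_left_le)
    qed
  qed (use G in auto)
  have I: "I n = sqrt (2 * pi) ^ DIM('a) * (LBINT t. F (x + e n *\<^sub>R t) * gaussian t)" for n
  proof -
    let ?f = "\<lambda>(\<xi>, y). F y * iexp (\<xi> \<bullet> (y - x)) * complex_of_real (gaussian (e n *\<^sub>R \<xi>))"
    have int: "integrable lborel ?f"
    proof (rule lborel_integrable_product_bound)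
      show "?f \<in> borel_measurable borel"
        unfolding case_prod_beta
        by (intro borel_measurable_continuous_onI continuous_intros continuous_on_compose2[OF F]) auto
      show "integrable lborel (\<lambda>\<xi>. gaussian (e n *\<^sub>R \<xi> :: 'a))"
        using integrable_lborel_affine[of "e n" gaussian "0::'a"] e[of n] integrable_gaussian by simp
      show "integrable lborel (\<lambda>y. C * (1 / weight (y::'a)))"
        by (intro integrable_mult_right integrable_inverse_weight)
      show "norm (?f (\<xi>, y)) \<le> gaussian (e n *\<^sub>R \<xi>) * (C * (1 / weight y))" for \<xi> y
        using mult_left_mono[OF b[of y] gaussian_props(3)[of "e n *\<^sub>R \<xi>"]] gaussian_props(3)[of "e n *\<^sub>R \<xi>"]
        by (simp add: norm_mult mult.commute[of "cmod (F y)"])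
    qed
    have "I n = (LBINT \<xi>. (LBINT y. ?f (\<xi>, y)))"
      unfolding I_def
    proof (intro Bochner_Integration.integral_cong refl)
      fix \<xi>
      have "G \<xi> * exp (- \<i> * complex_of_real (\<xi> \<bullet> x)) * gaussian (e n *\<^sub>R \<xi>) =
         (exp (- \<i> * complex_of_real (\<xi> \<bullet> x)) * gaussian (e n *\<^sub>R \<xi>)) * G \<xi>" by simp
      also have "\<dots> = (LBINT y. (exp (- \<i> * complex_of_real (\<xi> \<bullet> x)) * gaussian (e n *\<^sub>R \<xi>)) * (F y * iexp (\<xi> \<bullet> y)))"
        unfolding G_def by (rule integral_mult_right_zero[symmetric])
      also have "\<dots> = (LBINT y. ?f (\<xi>, y))"
        by (intro Bochner_Integration.integral_cong refl)
           (simp add: inner_diff_right right_diff_distrib exp_diff exp_minus field_simps)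
      finally show "G \<xi> * exp (- \<i> * complex_of_real (\<xi> \<bullet> x)) * gaussian (e n *\<^sub>R \<xi>) = (LBINT y. ?f (\<xi>, y))" .
    qed
    also have "\<dots> = (LBINT y. (LBINT \<xi>. ?f (\<xi>, y)))"
      by (rule lborel_integral_swap[OF int])
    also have "\<dots> = (LBINT y. F y * ((1 / e n ^ DIM('a)) *\<^sub>R complex_of_real (sqrt (2 * pi) ^ DIM('a) * gaussian ((1 / e n) *\<^sub>R (y - x)))))"
    proof (intro Bochner_Integration.integral_cong refl)
      fix y
      let ?H = "\<lambda>\<eta>. complex_of_real (gaussian \<eta>) * iexp (((1 / e n) *\<^sub>R (y - x)) \<bullet> \<eta>)"
      have [measurable]: "?H \<in> borel_measurable borel"
        by (intro borel_measurable_continuous_onI continuous_intros)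
      have "(LBINT \<xi>. ?f (\<xi>, y)) = (LBINT \<xi>. F y * ?H (0 + e n *\<^sub>R \<xi>))"
        using e[of n] by (intro Bochner_Integration.integral_cong refl) (simp add: inner_commute mult_ac)
      also have "\<dots> = F y * (LBINT \<xi>. ?H (0 + e n *\<^sub>R \<xi>))"
        by (rule integral_mult_right_zero)
      also have "(LBINT \<xi>. ?H (0 + e n *\<^sub>R \<xi>)) = (1 / \<bar>e n\<bar> ^ DIM('a)) *\<^sub>R (LBINT \<xi>. ?H \<xi>)"
        using e[of n] by (intro integral_lborel_affine) auto
      finally show "(LBINT \<xi>. ?f (\<xi>, y)) =
         F y * ((1 / e n ^ DIM('a)) *\<^sub>R complex_of_real (sqrt (2 * pi) ^ DIM('a) * gaussian ((1 / e n) *\<^sub>R (y - x))))"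
        using e[of n] by (simp only: gaussian_fourier abs_of_pos)
    qed
    also have "\<dots> = (LBINT y. (1 / e n ^ DIM('a)) *\<^sub>R (sqrt (2 * pi) ^ DIM('a) * (F y * gaussian ((1 / e n) *\<^sub>R (y - x)))))"
      by (intro Bochner_Integration.integral_cong refl) (simp add: scaleR_conv_of_real mult_ac)
    also have "\<dots> = (1 / \<bar>e n\<bar> ^ DIM('a)) *\<^sub>R (LBINT y. sqrt (2 * pi) ^ DIM('a) * (F y * gaussian ((1 / e n) *\<^sub>R (y - x))))"
      using e[of n] by (simp only: integral_scaleR_right abs_of_pos)
    also have "\<dots> = (LBINT t. sqrt (2 * pi) ^ DIM('a) * (F (x + e n *\<^sub>R t) * gaussian ((1 / e n) *\<^sub>R (x + e n *\<^sub>R t - x))))"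
      using e[of n] by (intro integral_lborel_affine[symmetric]) auto
    also have "\<dots> = (LBINT t. sqrt (2 * pi) ^ DIM('a) * (F (x + e n *\<^sub>R t) * gaussian t))"
      using e[of n] by simp
    finally show ?thesis by simp
  qed
  have lim2: "(\<lambda>n. \<integral>t. F (x + e n *\<^sub>R t) * complex_of_real (gaussian t) \<partial>lborel) \<longlonglongrightarrow> (LBINT t. F x * complex_of_real (gaussian (t::'a)))"
  proof (rule integral_dominated_convergence[where w = "\<lambda>t. C * gaussian t"])
    show "AE t in lborel. (\<lambda>n. F (x + e n *\<^sub>R t) * complex_of_real (gaussian t)) \<longlonglongrightarrow> F x * complex_of_real (gaussian t)"
    proof (rule AE_I2, rule tendsto_mult[OF _ tendsto_const])
      fix t :: 'a
      have "isCont (\<lambda>r. F (x + r *\<^sub>R t)) 0"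
        by (rule continuous_on_interior[of UNIV]) (auto intro!: continuous_intros continuous_on_compose2[OF F])
      from isCont_tendsto_compose[OF this e0] show "(\<lambda>n. F (x + e n *\<^sub>R t)) \<longlonglongrightarrow> F x" by simp
    qed
    show "integrable lborel (\<lambda>t::'a. C * gaussian t)" by (intro integrable_mult_right integrable_gaussian)
    show "AE t in lborel. cmod (F (x + e n *\<^sub>R t) * complex_of_real (gaussian t)) \<le> C * gaussian t" for n
      using bC by (intro AE_I2) (simp add: norm_mult gaussian_props(3) mult_right_mono)
  qed auto
  have "(LBINT t. F x * complex_of_real (gaussian (t::'a))) = F x * complex_of_real (sqrt (2 * pi) ^ DIM('a))"
    by (subst integral_mult_right_zero) (simp add: integral_gaussian)
  note eq = this
  have "I \<longlonglongrightarrow> sqrt (2 * pi) ^ DIM('a) * (F x * complex_of_real (sqrt (2 * pi) ^ DIM('a)))"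
    unfolding I eq[symmetric] by (intro tendsto_mult tendsto_const lim2)
  from LIMSEQ_unique[OF lim1 this]
  have "(LBINT \<xi>. G \<xi> * exp (- \<i> * complex_of_real (\<xi> \<bullet> x))) =
      complex_of_real (sqrt (2 * pi) ^ DIM('a) * sqrt (2 * pi) ^ DIM('a)) * F x"
    by simp
  also have "sqrt (2 * pi) ^ DIM('a) * sqrt (2 * pi) ^ DIM('a) = (2 * pi) ^ DIM('a)"
    unfolding power_mult_distrib[symmetric] by simp
  finally show ?thesis by simp
qed

section \<open>The short-time Fourier transform\<close>

text \<open>
  Defined without a complex conjugate, so that it is bilinear like the pairing of distributions.
\<close>
definition stft :: "(real ^ 'n::finite \<Rightarrow> complex) \<Rightarrow> (real ^ 'n \<Rightarrow> complex) \<Rightarrow> 'n phase_space \<Rightarrow> complex" where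
  "stft f h z = (LBINT x. f x * tf z h x)"

lemma stft_eq_tf_matrix:
  assumes f: "f \<in> schwartz" and h: "h \<in> schwartz"
  shows "stft f h z = tf_matrix dist_of (\<lambda>x. cnj (f x)) h 0 z"
  using assms by (simp add: stft_def tf_matrix_def dist_of_def mult.commute)

text \<open>
  The short-time Fourier transform is a matrix element of the identity operator between a fixed and a
  shifted function, so the general decay estimate applies.
\<close>
lemma stft_decay:
  assumes f: "f \<in> schwartz" and h: "h \<in> schwartz"
  obtains C where "C > 0" "\<And>z. cmod (stft f h z) \<le> C / weight z ^ m"
proof -
  obtain C where C: "C > 0"
    "\<And>z z'. cmod (tf_matrix dist_of (\<lambda>x. cnj (f x)) h z z') \<le> C / weight (z - z') ^ m"
    using tf_matrix_decay[OF beals_dist_of schwartz_cnj[OF f] h] by metis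
  show ?thesis
    by (rule that[OF C(1)]) (use C(2)[of 0] in \<open>simp add: stft_eq_tf_matrix f h\<close>)
qed

lemma continuous_on_stft [continuous_intros]:
  assumes "f \<in> schwartz" "h \<in> schwartz" "continuous_on A u"
  shows "continuous_on A (\<lambda>x. stft f h (u x))"
  unfolding stft_eq_tf_matrix[OF assms(1,2)] using assms
  by (intro continuous_intros L2_form_dist_of schwartz_cnj)

text \<open>
  For fixed \<open>s\<close> this is Fourier inversion for the function \<open>y \<mapsto> f y * h (y - s)\<close>.
\<close>
lemma stft_inversion:
  fixes f h :: "real ^ 'n::finite \<Rightarrow> complex"
  assumes f: "f \<in> schwartz" and h: "h \<in> schwartz"
  shows "(LBINT \<zeta>. stft f h (s, \<zeta>) * exp (- \<i> * complex_of_real (\<zeta> \<bullet> x))) = (2 * pi) ^ CARD('n) * (f x * h (x - s))"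
proof -
  obtain C1 where C1: "C1 > 0" "\<And>x. cmod (f x) \<le> C1 / weight x ^ 1"
    using schwartz_bound[OF f] by metis
  obtain C2 where C2: "C2 > 0" "\<And>x. cmod (h x) \<le> C2 / weight x ^ 0"
    using schwartz_bound[OF h] by metis
  obtain C3 where C3: "C3 > 0" "\<And>z. cmod (stft f h z) \<le> C3 / weight z ^ 1"
    using stft_decay[OF f h] by metis
  have "(LBINT \<zeta>. stft f h (s, \<zeta>) * exp (- \<i> * complex_of_real (\<zeta> \<bullet> x))) = (2 * pi) ^ DIM(real^'n) * (f x * h (x - s))"
  proof (rule fourier_inversion[where C = "C1 * C2"])
    show "continuous_on UNIV (\<lambda>x. f x * h (x - s))"
      using f h by (intro continuous_intros)
    show "cmod (f x * h (x - s)) \<le> C1 * C2 / weight x" for x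
      using mult_mono[OF C1(2)[of x] C2(2)[of "x - s"]] C1(1) C2(1) by (simp add: norm_mult)
    show "stft f h (s, \<zeta>) = (LBINT y. f y * h (y - s) * iexp (\<zeta> \<bullet> y))" for \<zeta>
      by (simp add: stft_def tf_def mult_ac)
    show "integrable lborel (\<lambda>\<zeta>. stft f h (s, \<zeta>))"
    proof (rule integrable_weight_bound)
      show "(\<lambda>\<zeta>. stft f h (s, \<zeta>)) \<in> borel_measurable borel"
        by (intro borel_measurable_continuous_onI continuous_intros f h)
      fix \<zeta> :: "real ^ 'n"
      have "C3 / (weight s * weight \<zeta>) \<le> C3 / (1 * weight \<zeta>)"
        using C3(1) weight_ge_1[of s] by (intro divide_left_mono mult_right_mono) auto
      then show "cmod (stft f h (s, \<zeta>)) \<le> C3 / weight \<zeta>"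
        using C3(2)[of "(s, \<zeta>)"] by (simp add: weight_Pair)
    qed
  qed
  then show ?thesis by simp
qed

section \<open>Bounded operators commute with integrals\<close>

lemma
  fixes C :: real assumes "C \<ge> 0" "a > 0" "b \<ge> 1"
  shows divide_mult_right_le: "C / (a * b) \<le> C / a" and divide_mult_left_le: "C / (b * a) \<le> C / a"
proof -
  have "a * 1 \<le> a * b" using assms by (intro mult_left_mono) auto
  then show "C / (a * b) \<le> C / a" using assms by (intro divide_left_mono) auto
  then show "C / (b * a) \<le> C / a" by (simp add: mult.commute)
qed

instance bcontfun :: (metric_space, banach) banach ..

text \<open>
  Multiplied by the weight in \<open>x\<close>, the integrand becomes a continuous curve in the Banach space of bounded continuous
  functions. Undoing the multiplication, applying the operator and pairing with \<open>\<psi>\<close> is a bounded functional there,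
  because the inverse weight is square integrable. On boxes
  the claim is linearity of the Henstock-Kurzweil integral in that Banach space. The passage to the whole space
  uses dominated convergence and the continuity of the operator in \<open>L\<^sup>2\<close>.
\<close>
lemma L2_pull_out:
  fixes f :: "'e::euclidean_space \<Rightarrow> 'a::euclidean_space \<Rightarrow> complex"
  assumes B: "bounded_L2_operator B" and \<psi>: "\<psi> \<in> L2"
    and cont: "continuous_on UNIV (\<lambda>(w, x). f w x)"
    and bound: "\<And>w x. cmod (f w x) \<le> C / (weight w * (weight x)\<^sup>2)"
  shows "(LBINT w. (LBINT x. B (f w) x * \<psi> x)) = (LBINT x. B (\<lambda>x. \<integral>w. f w x \<partial>lborel) x * \<psi> x)"
proof -
  define l where "l h = (LBINT x. B h x * \<psi> x)" for h
  have ladd: "l (\<lambda>y. h y + g y) = l h + l g" if "h \<in> L2" "g \<in> L2" for h g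
    unfolding l_def by (rule L2_functional_add[OF B \<psi> that])
  have lcm: "l (\<lambda>y. c * h y) = c * l h" if "h \<in> L2" for h c
    unfolding l_def by (rule L2_functional_cmult[OF B \<psi> that])
  obtain K where K: "K \<ge> 0" "\<And>h. h \<in> L2 \<Longrightarrow> cmod (l h) \<le> K * L2_norm h"
  proof -
    obtain K where K: "K \<ge> 0" "\<And>f \<psi>. f \<in> L2 \<Longrightarrow> \<psi> \<in> L2 \<Longrightarrow> cmod (LBINT x. B f x * \<psi> x) \<le> K * L2_norm f * L2_norm \<psi>"
      using L2_functional_bound[OF B] by metis
    show ?thesis
      by (rule that[of "K * L2_norm \<psi>"]) (use K(1) K(2)[OF _ \<psi>] in \<open>auto simp: l_def mult_ac\<close>)
  qed
  define M where "M = sqrt (LBINT x. 1 / weight (x::'a) ^ 2)"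
  have M: "M \<ge> 0" by (simp add: M_def integral_nonneg_AE)
  have C: "C \<ge> 0" using order_trans[OF norm_ge_zero bound[of 0 0]] by simp
  have inv_le: "1 / weight y \<le> 1" for y :: "'b::euclidean_space"
    using weight_ge_1[of y] by simp
  have contx: "continuous_on A (\<lambda>x. f (u x) (v x))" if "continuous_on A u" "continuous_on A v" for u v and A :: "'z::topological_space set"
    using continuous_on_compose2[OF cont continuous_on_Pair[OF that]] by simp

  \<comment> \<open>The weighted functions form a continuous curve in a Banach space of bounded functions.\<close>
  define G where "G w x = complex_of_real (weight x) * f w x" for w x
  have G_bound: "cmod (G w x) \<le> C / (weight w * weight x)" for w x
  proof -
    have "cmod (G w x) = weight x * cmod (f w x)" by (simp add: G_def norm_mult)
    also have "\<dots> \<le> weight x * (C / (weight w * (weight x)\<^sup>2))"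
      by (intro mult_left_mono bound) simp
    finally show ?thesis by (simp add: power2_eq_square field_simps)
  qed
  have G_bound1: "cmod (G w x) \<le> C / weight w" for w x
    by (rule order_trans[OF G_bound]) (rule divide_mult_right_le[OF C weight_pos weight_ge_1])
  have G_bound2: "cmod (G w x) \<le> C / weight x" for w x
    by (rule order_trans[OF G_bound]) (rule divide_mult_left_le[OF C weight_pos weight_ge_1])
  have G_cont: "continuous_on A (\<lambda>p. G (fst p) (snd p))" for A
    unfolding G_def by (intro continuous_intros contx)
  define \<Phi> where "\<Phi> w = Bcontfun (G w)" for w
  have G_in: "G w \<in> bcontfun" for w
  proof (rule bcontfun_normI[where b = "C / weight w"])
    show "continuous_on UNIV (G w)" unfolding G_def by (intro continuous_intros contx)
  qed (rule G_bound1)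
  have \<Phi>: "apply_bcontfun (\<Phi> w) = G w" for w
    unfolding \<Phi>_def by (rule Bcontfun_inverse[OF G_in])
  have \<Phi>_cont: "continuous_on UNIV \<Phi>"
    unfolding continuous_on_iff
  proof (intro ballI allI impI)
    fix w :: 'e and e :: real assume e: "e > 0"
    define R where "R = real DIM('a) * (4 * C / e + 1)"
    have far: "cmod (G w' x) \<le> e / 4" if "norm x \<ge> R" for w' x
    proof -
      have "R \<le> DIM('a) * weight x" using that norm_le_weight[of x] by linarith
      then have "4 * C / e + 1 \<le> weight x" by (simp add: R_def)
      then have "4 * C / e \<le> weight x" by simp
      then have "C / weight x \<le> e / 4" using e by (simp add: field_simps)
      then show ?thesis using G_bound2[of w' x] by linarith
    qed
    have "uniformly_continuous_on (cball w 1 \<times> cball 0 R) (\<lambda>p. G (fst p) (snd p))"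
      by (intro compact_uniformly_continuous G_cont compact_Times compact_cball)
    then obtain d where d: "d > 0" "\<And>p p'. p \<in> cball w 1 \<times> cball 0 R \<Longrightarrow> p' \<in> cball w 1 \<times> cball 0 R \<Longrightarrow>
        dist p' p < d \<Longrightarrow> dist (G (fst p') (snd p')) (G (fst p) (snd p)) < e / 2"
      unfolding uniformly_continuous_on_def using half_gt_zero[OF e] by meson
    show "\<exists>d>0. \<forall>w'\<in>UNIV. dist w' w < d \<longrightarrow> dist (\<Phi> w') (\<Phi> w) < e"
    proof (intro exI[of _ "min d 1"] conjI ballI impI)
      fix w' assume w': "dist w' w < min d 1"
      have "dist (G w' x) (G w x) \<le> e / 2" for x
      proof (cases "norm x \<le> R")
        case True
        then have "dist (G (fst (w', x)) (snd (w', x))) (G (fst (w, x)) (snd (w, x))) < e / 2"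
          using w' by (intro d(2)) (auto simp: dist_commute dist_Pair_Pair)
        then show ?thesis by simp
      next
        case False
        then have "cmod (G w' x) \<le> e / 4" "cmod (G w x) \<le> e / 4" using far by simp_all
        then show ?thesis using norm_triangle_ineq4[of "G w' x" "G w x"] by (simp add: dist_norm)
      qed
      then have "dist (\<Phi> w') (\<Phi> w) \<le> e / 2"
        by (intro dist_bound) (simp add: \<Phi>)
      then show "dist (\<Phi> w') (\<Phi> w) < e" using e by simp
    qed (use d in auto)
  qed

  define L where "L F = l (\<lambda>x. apply_bcontfun F x / weight x)" for F :: "'a \<Rightarrow>\<^sub>C complex"
  have FL2: "(\<lambda>x. apply_bcontfun F x / weight x) \<in> L2"
    and FL2n: "L2_norm (\<lambda>x. apply_bcontfun F x / weight x) \<le> norm F * M" for F :: "'a \<Rightarrow>\<^sub>C complex"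
  proof -
    have 1: "(\<lambda>x. apply_bcontfun F x / weight x) \<in> borel_measurable borel"
      by (intro borel_measurable_continuous_onI continuous_intros) auto
    have 2: "cmod (apply_bcontfun F x / weight x) \<le> norm F / weight x" for x
      using norm_bounded[of F x] by (simp add: norm_divide divide_right_mono)
    show "(\<lambda>x. apply_bcontfun F x / weight x) \<in> L2" by (rule L2_weightI[OF 1 2])
    show "L2_norm (\<lambda>x. apply_bcontfun F x / weight x) \<le> norm F * M"
      unfolding M_def by (rule L2_norm_weight_le[OF 1 2])
  qed
  have L_lin: "bounded_linear L"
  proof (rule bounded_linear_intro[where K = "K * M"])
    show "L (F + F') = L F + L F'" for F F'
      unfolding L_def by (simp add: add_divide_distrib ladd FL2)
    show "L (r *\<^sub>R F) = r *\<^sub>R L F" for r F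
      using lcm[OF FL2[of F], of r] by (simp add: L_def scaleR_conv_of_real)
    show "norm (L F) \<le> norm F * (K * M)" for F
    proof -
      have "norm (L F) \<le> K * L2_norm (\<lambda>x. apply_bcontfun F x / weight x)"
        unfolding L_def by (rule K(2)[OF FL2])
      also have "\<dots> \<le> K * (norm F * M)" by (intro mult_left_mono FL2n K)
      finally show ?thesis by (simp add: mult_ac)
    qed
  qed
  have L\<Phi>: "L (\<Phi> w) = l (f w)" for w
    by (simp add: L_def \<Phi> G_def)
  have lf_cont: "continuous_on A (\<lambda>w. l (f w))" for A
    using bounded_linear.continuous_on[OF L_lin continuous_on_subset[OF \<Phi>_cont subset_UNIV]]
    by (simp add: L\<Phi>)
  have fwx_int: "integrable lborel (\<lambda>w. f w x)" for x
  proof (rule integrable_weight_bound)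
    show "(\<lambda>w. f w x) \<in> borel_measurable borel"
      by (intro borel_measurable_continuous_onI contx continuous_intros)
    show "cmod (f w x) \<le> C / (weight x)\<^sup>2 / weight w" for w
      using bound[of w x] by (simp add: mult.commute)
  qed
  have lf_int: "integrable lborel (\<lambda>w. l (f w))"
  proof (rule integrable_weight_bound)
    show "(\<lambda>w. l (f w)) \<in> borel_measurable borel"
      by (intro borel_measurable_continuous_onI lf_cont)
    fix w
    have "norm (\<Phi> w) \<le> C / weight w" by (rule norm_bound) (simp add: \<Phi> G_bound1)
    then have "K * M * norm (\<Phi> w) \<le> K * M * (C / weight w)"
      using K(1) M by (intro mult_left_mono) auto
    moreover have "cmod (l (f w)) \<le> K * (norm (\<Phi> w) * M)"
      using order_trans[OF K(2)[OF FL2] mult_left_mono[OF FL2n K(1)], of "\<Phi> w"] L\<Phi>[of w]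
      by (simp add: L_def)
    ultimately show "cmod (l (f w)) \<le> K * M * C / weight w" by (simp add: mult_ac)
  qed

  \<comment> \<open>On a box the integral can be taken in the Banach space; then the box grows.\<close>
  define Q where "Q n = cbox (- (real n *\<^sub>R One)) (real n *\<^sub>R One :: 'e)" for n :: nat
  define H where "H n x = (LBINT w. indicator (Q n) w *\<^sub>R f w x)" for n x
  define H\<^sub>0 where "H\<^sub>0 x = (LBINT w. f w x)" for x
  have Q_lim: "(\<lambda>n. indicator (Q n) w :: real) \<longlonglongrightarrow> 1" for w
  proof (rule tendsto_eventually)
    obtain N where N: "norm w \<le> real N" using real_arch_simple by blast
    have "w \<in> Q n" if "n \<ge> N" for n
    proof -
      have "\<bar>w \<bullet> b\<bar> \<le> real n" if "b \<in> Basis" for b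
        using Basis_le_norm[OF that, of w] N \<open>n \<ge> N\<close> by linarith
      then show ?thesis by (auto simp: Q_def mem_box abs_le_iff minus_le_iff)
    qed
    then show "\<forall>\<^sub>F n in sequentially. (indicator (Q n) w :: real) = 1"
      unfolding eventually_sequentially by (intro exI[of _ N] allI impI) simp
  qed
  have Q_meas[measurable]: "Q n \<in> sets borel" for n by (simp add: Q_def)
  have box: "(LBINT w. indicator (Q n) w *\<^sub>R l (f w)) = l (H n)" for n
  proof -
    have \<Phi>_int: "\<Phi> integrable_on Q n"
      unfolding Q_def by (intro integrable_continuous continuous_on_subset[OF \<Phi>_cont subset_UNIV])
    have "(LBINT w. indicator (Q n) w *\<^sub>R l (f w)) = integral (Q n) (\<lambda>w. l (f w))"
      using set_borel_integral_eq_integral(2)[of "Q n" "\<lambda>w. l (f w)"] integrable_mult_indicator[OF _ lf_int, of "Q n"]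
      by (simp add: set_lebesgue_integral_def set_integrable_def)
    also have "\<dots> = L (integral (Q n) \<Phi>)"
      using integral_linear[OF \<Phi>_int L_lin] by (simp add: o_def L\<Phi>)
    also have "\<dots> = l (H n)"
      unfolding L_def
    proof (rule arg_cong[where f = l], rule ext)
      fix x
      have ev: "bounded_linear (\<lambda>F :: 'a \<Rightarrow>\<^sub>C complex. apply_bcontfun F x)"
        by (rule bounded_linear_intro[where K = 1]) (auto simp: norm_bounded)
      have "apply_bcontfun (integral (Q n) \<Phi>) x = integral (Q n) (\<lambda>w. complex_of_real (weight x) * f w x)"
        using integral_linear[OF \<Phi>_int ev] by (simp add: o_def \<Phi> G_def)
      also have "\<dots> = complex_of_real (weight x) * integral (Q n) (\<lambda>w. f w x)"
        by simp
      also have "integral (Q n) (\<lambda>w. f w x) = H n x"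
        using set_borel_integral_eq_integral(2)[of "Q n" "\<lambda>w. f w x"] integrable_mult_indicator[OF _ fwx_int, of "Q n"]
        by (simp add: set_lebesgue_integral_def set_integrable_def H_def)
      finally show "apply_bcontfun (integral (Q n) \<Phi>) x / weight x = H n x" by simp
    qed
    finally show ?thesis .
  qed
  have lim1: "(\<lambda>n. l (H n)) \<longlonglongrightarrow> (LBINT w. l (f w))"
    unfolding box[symmetric]
  proof (rule integral_dominated_convergence[where w = "\<lambda>w. cmod (l (f w))"])
    show "AE w in lborel. (\<lambda>n. indicator (Q n) w *\<^sub>R l (f w)) \<longlonglongrightarrow> l (f w)"
      using tendsto_scaleR[OF Q_lim tendsto_const] by fastforce
    show "AE w in lborel. cmod (indicator (Q n) w *\<^sub>R l (f w)) \<le> cmod (l (f w))" for n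
      by (auto simp: indicator_def)
  qed (use lf_int in auto)
  define D where "D = C * (LBINT w. 1 / weight (w::'e))"
  have H_meas: "H n \<in> borel_measurable borel" "H\<^sub>0 \<in> borel_measurable borel" for n
  proof -
    have m: "(\<lambda>p. f (snd p) (fst p)) \<in> borel_measurable (borel \<Otimes>\<^sub>M borel :: ('a \<times> 'e) measure)"
      unfolding borel_prod by (intro borel_measurable_continuous_onI contx continuous_intros)
    have "(\<lambda>(x, w). f w x) \<in> borel_measurable (borel \<Otimes>\<^sub>M lborel :: ('a \<times> 'e) measure)"
      using m by (simp add: case_prod_beta cong: measurable_cong_sets)
    note [measurable] = this
    show "H\<^sub>0 \<in> borel_measurable borel" "H n \<in> borel_measurable borel"
      unfolding H\<^sub>0_def H_def by measurable
  qed
  have fw_le: "cmod (f w x) \<le> C * (1 / weight w) * (1 / weight x)" for w x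
  proof -
    have "C / (weight w * (weight x)\<^sup>2) \<le> C / (weight w * weight x)"
      using C weight_ge_1[of x] by (intro divide_left_mono mult_left_mono) (auto simp: power2_eq_square)
    then show ?thesis using bound[of w x] by simp
  qed
  have Dint: "integrable lborel (\<lambda>w. C * (1 / weight w) * (1 / weight x))" for x :: 'a and C
    by (intro integrable_mult_left integrable_mult_right integrable_inverse_weight)
  have H_le: "cmod (H n x) \<le> D / weight x" "cmod (H\<^sub>0 x) \<le> D / weight x" for n x
  proof -
    have D: "(LBINT w. C * (1 / weight (w::'e)) * (1 / weight x)) = D / weight x"
      by (simp only: integral_mult_left_zero integral_mult_right_zero D_def) simp
    show "cmod (H\<^sub>0 x) \<le> D / weight x"
      unfolding H\<^sub>0_def D[symmetric]
      by (rule order_trans[OF integral_norm_bound], rule integral_mono)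
         (use fwx_int Dint fw_le in auto)
    have "cmod (indicator (Q n) w *\<^sub>R f w x) \<le> C * (1 / weight w) * (1 / weight x)" for w
      using fw_le[of w x] C by (auto simp: indicator_def)
    then show "cmod (H n x) \<le> D / weight x"
      unfolding H_def D[symmetric]
      by (intro order_trans[OF integral_norm_bound] integral_mono integrable_norm integrable_mult_indicator)
         (use fwx_int Dint in auto)
  qed
  have HL2: "H n \<in> L2" "H\<^sub>0 \<in> L2" for n
    using L2_weightI[OF H_meas(1) H_le(1)] L2_weightI[OF H_meas(2) H_le(2)] by auto
  have H_lim: "(\<lambda>n. H n x) \<longlonglongrightarrow> H\<^sub>0 x" for x
    unfolding H_def H\<^sub>0_def
  proof (rule integral_dominated_convergence[where w = "\<lambda>w. cmod (f w x)"])
    show "AE w in lborel. (\<lambda>n. indicator (Q n) w *\<^sub>R f w x) \<longlonglongrightarrow> f w x"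
      using tendsto_scaleR[OF Q_lim tendsto_const] by fastforce
    show "AE w in lborel. cmod (indicator (Q n) w *\<^sub>R f w x) \<le> cmod (f w x)" for n
      by (auto simp: indicator_def)
  qed (use fwx_int in auto)
  have norm_lim: "(\<lambda>n. L2_norm (\<lambda>x. H n x - H\<^sub>0 x)) \<longlonglongrightarrow> 0"
  proof (rule L2_norm_tendsto_0[where C = "2 * D"])
    show "cmod (H n x - H\<^sub>0 x) \<le> 2 * D / weight x" for n x
      using norm_triangle_ineq4[of "H n x" "H\<^sub>0 x"] H_le(1)[of n x] H_le(2)[of x] by simp
    show "(\<lambda>n. H n x - H\<^sub>0 x) \<longlonglongrightarrow> 0" for x
      using H_lim[of x] by (simp add: LIM_zero)
  qed (use H_meas in auto)
  have "(\<lambda>n. l (H n) - l H\<^sub>0) \<longlonglongrightarrow> 0"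
  proof (rule Lim_null_comparison[OF always_eventually[OF allI]])
    fix n
    have m: "(\<lambda>x. - 1 * H\<^sub>0 x) \<in> L2"
      by (rule L2_weightI[where C = D]) (use H_meas H_le in auto)
    have m2: "(\<lambda>x. H n x - H\<^sub>0 x) \<in> L2"
    proof (rule L2_weightI[where C = "2 * D"])
      show "cmod (H n x - H\<^sub>0 x) \<le> 2 * D / weight x" for x
        using norm_triangle_ineq4[of "H n x" "H\<^sub>0 x"] H_le(1)[of n x] H_le(2)[of x] by simp
    qed (use H_meas in auto)
    have "l (\<lambda>x. H n x - H\<^sub>0 x) = l (H n) - l H\<^sub>0"
      using ladd[OF HL2(1) m, of n] lcm[OF HL2(2), of "-1"] by simp
    then show "norm (l (H n) - l H\<^sub>0) \<le> K * L2_norm (\<lambda>x. H n x - H\<^sub>0 x)"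
      using K(2)[OF m2] by simp
  qed (use tendsto_mult_right_zero[OF norm_lim] in auto)
  then have "(\<lambda>n. l (H n)) \<longlonglongrightarrow> l H\<^sub>0" by (simp add: LIM_zero_iff)
  from LIMSEQ_unique[OF lim1 this] show ?thesis by (simp add: l_def H\<^sub>0_def[abs_def])
qed

section \<open>Parity operators and the Wigner transform\<close>

text \<open>
  The reflection about the phase space point \<open>w\<close>, also known as Grossmann-Royer operator.
\<close>
definition parity :: "'n::finite phase_space \<Rightarrow> (real ^ 'n \<Rightarrow> complex) \<Rightarrow> real ^ 'n \<Rightarrow> complex" where
  "parity w f x = iexp (2 * (snd w \<bullet> (x - fst w))) * f (2 *\<^sub>R fst w - x)"

lemma parity_eq_tf:
  "parity w f = (\<lambda>x. exp (- \<i> * complex_of_real (2 * (snd w \<bullet> fst w))) * tf (2 *\<^sub>R w) (\<lambda>x. f (- x)) x)"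
  by (rule ext) (simp add: parity_def tf_def inner_diff_right algebra_simps flip: exp_add)

lemma schwartz_parity: "f \<in> schwartz \<Longrightarrow> parity w f \<in> schwartz"
  unfolding parity_eq_tf by (intro schwartz_intros)

lemma cmod_parity: "cmod (parity w f x) = cmod (f (2 *\<^sub>R fst w - x))"
  by (simp add: parity_def norm_mult)

text \<open>
  Composing the shifts by \<open>w\<close> and \<open>z - w\<close> produces the same phase in both entries of the form, where
  one of them is conjugated.
\<close>
lemma symbol_integrand_parity:
  assumes S: "L2_form S" and g: "g \<in> schwartz"
  shows "symbol_integrand g S w (z - w) = S (parity w (tf z g)) (\<lambda>x. cnj (tf z g x))"
proof -
  define c where "c = exp (- \<i> * complex_of_real (snd (z - w) \<bullet> fst w))"
  have 1: "tf w (tf (z - w) g) = (\<lambda>x. c * tf z g x)"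
    unfolding tf_tf c_def by simp
  have 2: "tf w (\<lambda>x. tf (z - w) g (- x)) = (\<lambda>x. c * parity w (tf z g) x)"
  proof
    fix x
    have arg: "- (x - fst w) - fst (z - w) = 2 *\<^sub>R fst w - x - fst z"
      by (simp add: scaleR_2)
    have ex: "iexp (snd w \<bullet> x) * iexp (snd (z - w) \<bullet> (- (x - fst w))) =
       c * (iexp (2 * (snd w \<bullet> (x - fst w))) * iexp (snd z \<bullet> (2 *\<^sub>R fst w - x)))"
      unfolding c_def exp_add[symmetric]
      by (rule arg_cong[where f = exp]) (simp add: inner_diff_left inner_diff_right algebra_simps)
    show "tf w (\<lambda>x. tf (z - w) g (- x)) x = c * parity w (tf z g) x"
      unfolding tf_def[of w] tf_def[of "z - w"] parity_def tf_def[of z] arg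
      using ex by (simp only: mult.assoc[symmetric])
  qed
  have "symbol_integrand g S w (z - w) = c * (cnj c * S (parity w (tf z g)) (\<lambda>x. cnj (tf z g x)))"
    unfolding symbol_integrand_def tf_matrix_def 1 2 complex_cnj_mult
    by (simp only: L2_form_cmult_left[OF S] L2_form_cmult_right[OF S] schwartz_intros schwartz_parity g)
  moreover have "c * cnj c = 1"
    by (simp add: c_def exp_cnj flip: exp_add)
  ultimately show ?thesis by (simp flip: mult.assoc)
qed

lemma parity_symbol_eq:
  assumes S: "L2_form S" and g: "g \<in> schwartz"
  shows "parity_symbol g S w = (LBINT z. S (parity w (tf z g)) (\<lambda>x. cnj (tf z g x)))"
proof -
  have "parity_symbol g S w = (LBINT z. symbol_integrand g S w (- w + 1 *\<^sub>R z))"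
    unfolding parity_symbol_def
    by (subst integral_lborel_affine) (simp_all add: symbol_integrand_measurable[OF S g])
  then show ?thesis
    by (simp add: symbol_integrand_parity[OF S g] del: minus_add_distrib)
qed

text \<open>
  The cross Wigner function \<open>2\<^sup>d \<integral> \<psi> (P\<^sub>w \<phi>)\<close>, expressed by a short-time Fourier transform at \<open>2w\<close>, from which it
  inherits its decay.
\<close>
definition wigner :: "(real ^ 'n::finite \<Rightarrow> complex) \<Rightarrow> (real ^ 'n \<Rightarrow> complex) \<Rightarrow> 'n phase_space \<Rightarrow> complex" where
  "wigner \<psi> \<phi> w = 2 ^ CARD('n) * exp (- \<i> * complex_of_real (2 * (snd w \<bullet> fst w))) * stft \<psi> (\<lambda>x. \<phi> (- x)) (2 *\<^sub>R w)"

lemma wigner_decay: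
  assumes "\<psi> \<in> schwartz" "\<phi> \<in> schwartz"
  obtains C where "C > 0" "\<And>w. cmod (wigner \<psi> \<phi> w) \<le> C / weight (2 *\<^sub>R w) ^ m"
proof -
  obtain C where C: "C > 0" "\<And>z. cmod (stft \<psi> (\<lambda>x. \<phi> (- x)) z) \<le> C / weight z ^ m"
    using stft_decay[OF assms(1) schwartz_reflect[OF assms(2)]] by metis
  have "cmod (wigner \<psi> \<phi> w) \<le> 2 ^ CARD('a) * C / weight (2 *\<^sub>R w) ^ m" for w
    using mult_left_mono[OF C(2)[of "2 *\<^sub>R w"], of "2 ^ CARD('a)"] by (simp add: wigner_def norm_mult norm_power)
  then show ?thesis using C(1) by (intro that[of "2 ^ CARD('a) * C"]) auto
qed

lemma continuous_on_wigner [continuous_intros]: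
  assumes "\<psi> \<in> schwartz" "\<phi> \<in> schwartz" "continuous_on A u"
  shows "continuous_on A (\<lambda>x. wigner \<psi> \<phi> (u x))"
  unfolding wigner_def using assms by (intro continuous_intros schwartz_reflect)

lemma wigner_decay_unscaled:
  assumes "\<psi> \<in> schwartz" "\<phi> \<in> schwartz"
  obtains C where "C > 0" "\<And>w. cmod (wigner \<psi> \<phi> w) \<le> C / weight w ^ m"
proof -
  obtain C where C: "C > 0" "\<And>w. cmod (wigner \<psi> \<phi> w) \<le> C / weight (2 *\<^sub>R w) ^ m"
    using wigner_decay[OF assms] by metis
  have "C / weight (2 *\<^sub>R w) ^ m \<le> C / weight w ^ m" for w :: "'a phase_space"
    using C(1) weight_mono_scale[of 2 w] by (intro divide_left_mono power_mono) auto
  with C show ?thesis by (meson order_trans that)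
qed

text \<open>
  For fixed \<open>x\<close> substitute the midpoint \<open>q = (x + x') / 2\<close> for \<open>x'\<close>, which contributes the factor \<open>2\<^sup>d\<close>.
  The remaining integral over \<open>x\<close> is the Wigner function.
\<close>
lemma weyl_double_integral:
  fixes a :: "'n::finite phase_space \<Rightarrow> complex"
  assumes \<psi>: "\<psi> \<in> schwartz" and \<phi>: "\<phi> \<in> schwartz"
    and a: "continuous_on UNIV a" and K: "\<And>w. cmod (a w) \<le> K"
  shows "(LBINT (x, x'). iexp (\<xi> \<bullet> (x - x')) * \<psi> x * a ((1 / 2) *\<^sub>R (x + x'), \<xi>) * \<phi> x')
    = (LBINT q. wigner \<psi> \<phi> (q, \<xi>) * a (q, \<xi>))"
proof -
  have K0: "K \<ge> 0" using order_trans[OF norm_ge_zero K] .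
  obtain C1 where C1: "C1 > 0" "\<And>x. cmod (\<psi> x) \<le> C1 / weight x ^ 2"
    using schwartz_bound[OF \<psi>] by metis
  obtain C2 where C2: "C2 > 0" "\<And>x. cmod (\<phi> x) \<le> C2 / weight x ^ 1"
    using schwartz_bound[OF \<phi>] by metis
  have a_comp: "continuous_on A (\<lambda>p. a (u p))" if "continuous_on A u" for u and A :: "'z::topological_space set"
    using continuous_on_compose2[OF a that] by simp
  define F where "F = (\<lambda>(x, x'). iexp (\<xi> \<bullet> (x - x')) * \<psi> x * a ((1 / 2) *\<^sub>R (x + x'), \<xi>) * \<phi> x')"
  have F_cont: "continuous_on UNIV F"
    unfolding F_def case_prod_beta using \<psi> \<phi> by (intro continuous_intros a_comp)
  have F_int: "integrable lborel F"
  proof (rule lborel_integrable_product_bound)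
    show "F \<in> borel_measurable borel" by (rule borel_measurable_continuous_onI[OF F_cont])
    show "integrable lborel (\<lambda>x::real^'n. (C1 * K) * (1 / weight x ^ 2))"
      by (intro integrable_mult_right integrable_inverse_weight_power) simp
    show "integrable lborel (\<lambda>x::real^'n. C2 * (1 / weight x))"
      by (intro integrable_mult_right integrable_inverse_weight)
    fix x x' :: "real ^ 'n"
    have "norm (F (x, x')) = cmod (\<psi> x) * cmod (a ((1 / 2) *\<^sub>R (x + x'), \<xi>)) * cmod (\<phi> x')"
      by (simp add: F_def norm_mult)
    also have "\<dots> \<le> (C1 / weight x ^ 2) * K * (C2 / weight x' ^ 1)"
      using C1 C2 K K0 by (intro mult_mono mult_nonneg_nonneg) auto
    finally show "norm (F (x, x')) \<le> (C1 * K) * (1 / weight x ^ 2) * (C2 * (1 / weight x'))" by simp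
  qed
  define F2 where "F2 = (\<lambda>(x, q). 2 ^ CARD('n) * F (x, - x + 2 *\<^sub>R q))"
  have F2_cont: "continuous_on UNIV F2"
    unfolding F2_def case_prod_beta by (intro continuous_intros continuous_on_compose2[OF F_cont]) auto
  have F2_int: "integrable lborel F2"
  proof (rule lborel_integrable_product_bound)
    show "F2 \<in> borel_measurable borel" by (rule borel_measurable_continuous_onI[OF F2_cont])
    show "integrable lborel (\<lambda>x::real^'n. (4 ^ CARD('n) * C1 * K * C2) * (1 / weight x))"
      by (intro integrable_mult_right integrable_inverse_weight)
    show "integrable lborel (\<lambda>q::real^'n. 1 / weight q)"
      by (rule integrable_inverse_weight)
    fix x q :: "real ^ 'n"
    have w: "1 / (weight x * weight (- x + 2 *\<^sub>R q)) \<le> 2 ^ CARD('n) / weight q"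
    proof -
      have "weight q \<le> weight (2 *\<^sub>R q)" by (rule weight_mono_scale) simp
      also have "\<dots> \<le> 2 ^ CARD('n) * weight x * weight (- x + 2 *\<^sub>R q)"
        using weight_add_le[of x "- x + 2 *\<^sub>R q"] by simp
      finally show ?thesis by (simp add: field_simps)
    qed
    have "norm (F2 (x, q)) = 2 ^ CARD('n) * (cmod (\<psi> x) * cmod (a (q, \<xi>)) * cmod (\<phi> (- x + 2 *\<^sub>R q)))"
      by (simp add: F_def F2_def norm_mult norm_power)
    also have "\<dots> \<le> 2 ^ CARD('n) * ((C1 / weight x ^ 2) * K * (C2 / weight (- x + 2 *\<^sub>R q) ^ 1))"
      using C1 C2 K K0 by (intro mult_left_mono mult_mono mult_nonneg_nonneg) auto
    also have "\<dots> = (2 ^ CARD('n) * C1 * K * C2 / weight x) * (1 / (weight x * weight (- x + 2 *\<^sub>R q)))"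
      by (simp add: power2_eq_square)
    also have "\<dots> \<le> (2 ^ CARD('n) * C1 * K * C2 / weight x) * (2 ^ CARD('n) / weight q)"
      using C1 C2 K0 by (intro mult_left_mono w) auto
    also have "\<dots> = (4 ^ CARD('n) * C1 * K * C2) * (1 / weight x) * (1 / weight q)"
      by (simp flip: power_mult_distrib)
    finally show "norm (F2 (x, q)) \<le> (4 ^ CARD('n) * C1 * K * C2) * (1 / weight x) * (1 / weight q)" .
  qed
  have "(LBINT z. F z) = (LBINT x. (LBINT x'. F (x, x')))"
    by (rule lborel_integral_fst[OF F_int, symmetric])
  also have "\<dots> = (LBINT x. (LBINT q. F2 (x, q)))"
  proof (rule Bochner_Integration.integral_cong[OF refl])
    fix x
    have m: "(\<lambda>x'. F (x, x')) \<in> borel_measurable borel"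
      by (intro borel_measurable_continuous_onI continuous_on_compose2[OF F_cont] continuous_intros) auto
    show "(LBINT x'. F (x, x')) = (LBINT q. F2 (x, q))"
      using integral_lborel_affine[OF _ m, of 2 "- x"] by (simp add: F2_def scaleR_conv_of_real)
  qed
  also have "\<dots> = (LBINT q. (LBINT x. F2 (x, q)))"
    by (rule lborel_integral_swap[OF F2_int])
  also have "\<dots> = (LBINT q. wigner \<psi> \<phi> (q, \<xi>) * a (q, \<xi>))"
  proof (intro Bochner_Integration.integral_cong refl)
    fix q
    have "F2 (x, q) = (2 ^ CARD('n) * exp (- \<i> * complex_of_real (2 * (\<xi> \<bullet> q))) * a (q, \<xi>))
      * (\<psi> x * tf (2 *\<^sub>R (q, \<xi>)) (\<lambda>x. \<phi> (- x)) x)" for x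
    proof -
      have arg: "x - (- x + 2 *\<^sub>R q) = 2 *\<^sub>R x - 2 *\<^sub>R q" by (simp add: scaleR_2)
      have "iexp (\<xi> \<bullet> (x - (- x + 2 *\<^sub>R q))) =
        exp (- \<i> * complex_of_real (2 * (\<xi> \<bullet> q))) * iexp (2 * (\<xi> \<bullet> x))"
        unfolding exp_add[symmetric] arg
        by (rule arg_cong[where f = exp]) (simp add: inner_diff_right right_diff_distrib)
      then show ?thesis by (simp add: F2_def F_def tf_def mult_ac)
    qed
    then have "(LBINT x. F2 (x, q)) = (2 ^ CARD('n) * exp (- \<i> * complex_of_real (2 * (\<xi> \<bullet> q))) * a (q, \<xi>))
      * stft \<psi> (\<lambda>x. \<phi> (- x)) (2 *\<^sub>R (q, \<xi>))"
      unfolding stft_def by (simp only: integral_mult_right_zero)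
    then show "(LBINT x. F2 (x, q)) = wigner \<psi> \<phi> (q, \<xi>) * a (q, \<xi>)"
      by (simp add: wigner_def mult_ac)
  qed
  finally show ?thesis unfolding F_def .
qed

lemma weyl_formula_wigner:
  fixes a :: "'n::finite phase_space \<Rightarrow> complex"
  assumes \<psi>: "\<psi> \<in> schwartz" and \<phi>: "\<phi> \<in> schwartz"
    and a: "continuous_on UNIV a" and K: "\<And>w. cmod (a w) \<le> K"
  shows "(LBINT \<xi>. (LBINT (x, x'). iexp (\<xi> \<bullet> (x - x')) * \<psi> x * a ((1 / 2) *\<^sub>R (x + x'), \<xi>) * \<phi> x'))
    = (LBINT w. wigner \<psi> \<phi> w * a w)"
proof -
  obtain C where C: "C > 0" "\<And>w. cmod (wigner \<psi> \<phi> w) \<le> C / weight w ^ 1"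
    using wigner_decay_unscaled[OF \<psi> \<phi>] by metis
  have "integrable lborel (\<lambda>w. wigner \<psi> \<phi> w * a w)"
  proof (rule integrable_weight_bound)
    show "(\<lambda>w. wigner \<psi> \<phi> w * a w) \<in> borel_measurable borel"
      by (intro borel_measurable_continuous_onI continuous_intros a \<psi> \<phi>)
    show "norm (wigner \<psi> \<phi> w * a w) \<le> C * K / weight w" for w
      using mult_mono[OF C(2)[of w] K[of w]] C(1) by (simp add: norm_mult)
  qed
  from lborel_integral_snd[OF this] show ?thesis
    unfolding weyl_double_integral[OF assms] .
qed

text \<open>
  The Weyl quantization of the Wigner function of \<open>\<psi>\<close> and \<open>\<phi>\<close> is the rank one operator \<open>f \<mapsto> (\<integral> \<psi> f) \<phi>\<close>. Integrating
  over the frequency first inverts the short-time Fourier transform at the point \<open>2q - x\<close>. What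
  remains is an integral of \<open>\<psi> f\<close> over \<open>q\<close>.
\<close>
lemma wigner_parity_inversion:
  fixes f :: "real ^ 'n::finite \<Rightarrow> complex"
  assumes \<psi>: "\<psi> \<in> schwartz" and \<phi>: "\<phi> \<in> schwartz" and f: "f \<in> schwartz"
  shows "(LBINT w. wigner \<psi> \<phi> w * parity w f x) = (pi ^ CARD('n) * (LBINT y. \<psi> y * f y)) * \<phi> x"
proof -
  obtain C where C: "C > 0" "\<And>w. cmod (wigner \<psi> \<phi> w) \<le> C / weight w ^ 1"
    using wigner_decay_unscaled[OF \<psi> \<phi>] by metis
  obtain C2 where C2: "C2 > 0" "\<And>x. cmod (f x) \<le> C2 / weight x ^ 0"
    using schwartz_bound[OF f] by metis
  have int: "integrable lborel (\<lambda>w. wigner \<psi> \<phi> w * parity w f x)"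
  proof (rule integrable_weight_bound)
    show "(\<lambda>w. wigner \<psi> \<phi> w * parity w f x) \<in> borel_measurable borel"
      unfolding parity_def by (intro borel_measurable_continuous_onI continuous_intros \<psi> \<phi> f)
    show "norm (wigner \<psi> \<phi> w * parity w f x) \<le> C * C2 / weight w" for w
      using mult_mono[OF C(2)[of w] C2(2)[of "2 *\<^sub>R fst w - x"]] C(1) C2(1) by (simp add: norm_mult cmod_parity)
  qed
  have inner: "(LBINT \<xi>. wigner \<psi> \<phi> (q, \<xi>) * parity (q, \<xi>) f x) =
     ((2 * pi) ^ CARD('n) * \<phi> x) * (\<psi> (- x + 2 *\<^sub>R q) * f (- x + 2 *\<^sub>R q))" for q
  proof -
    define H where "H \<zeta> = stft \<psi> (\<lambda>x. \<phi> (- x)) (2 *\<^sub>R q, \<zeta>) * exp (- \<i> * complex_of_real (\<zeta> \<bullet> (- x + 2 *\<^sub>R q)))" for \<zeta>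
    have [measurable]: "H \<in> borel_measurable borel"
      unfolding H_def by (intro borel_measurable_continuous_onI continuous_intros \<psi> schwartz_reflect \<phi>)
    have "wigner \<psi> \<phi> (q, \<xi>) * parity (q, \<xi>) f x = (2 ^ CARD('n) * f (- x + 2 *\<^sub>R q)) * H (0 + 2 *\<^sub>R \<xi>)" for \<xi>
    proof -
      have "exp (- \<i> * complex_of_real (2 * (\<xi> \<bullet> q))) * iexp (2 * (\<xi> \<bullet> (x - q))) =
        exp (- \<i> * complex_of_real ((2 *\<^sub>R \<xi>) \<bullet> (- x + 2 *\<^sub>R q)))"
        unfolding exp_add[symmetric]
        by (rule arg_cong[where f = exp]) (simp add: inner_diff_right inner_add_right algebra_simps)
      then show ?thesis by (simp add: wigner_def parity_def H_def mult_ac)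
    qed
    then have "(LBINT \<xi>. wigner \<psi> \<phi> (q, \<xi>) * parity (q, \<xi>) f x) =
       (2 ^ CARD('n) * f (- x + 2 *\<^sub>R q)) * (LBINT \<xi>. H (0 + 2 *\<^sub>R \<xi>))"
      by (simp only: integral_mult_right_zero)
    also have "(LBINT \<xi>. H (0 + 2 *\<^sub>R \<xi>)) = (1 / 2 ^ CARD('n)) *\<^sub>R (LBINT \<zeta>. H \<zeta>)"
      by (subst integral_lborel_affine) auto
    also have "(LBINT \<zeta>. H \<zeta>) = (2 * pi) ^ CARD('n) * (\<psi> (- x + 2 *\<^sub>R q) * \<phi> (- ((- x + 2 *\<^sub>R q) - 2 *\<^sub>R q)))"
      unfolding H_def by (rule stft_inversion[OF \<psi> schwartz_reflect[OF \<phi>]])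
    finally show ?thesis by (simp add: scaleR_conv_of_real mult_ac)
  qed
  have [measurable]: "(\<lambda>y. \<psi> y * f y) \<in> borel_measurable borel"
    using \<psi> f by measurable
  have "(LBINT w. wigner \<psi> \<phi> w * parity w f x) = (LBINT q. (LBINT \<xi>. wigner \<psi> \<phi> (q, \<xi>) * parity (q, \<xi>) f x))"
    by (rule lborel_integral_fst[OF int, symmetric])
  also have "\<dots> = ((2 * pi) ^ CARD('n) * \<phi> x) * (LBINT q. \<psi> (- x + 2 *\<^sub>R q) * f (- x + 2 *\<^sub>R q))"
    unfolding inner by (rule integral_mult_right_zero)
  also have "(LBINT q. \<psi> (- x + 2 *\<^sub>R q) * f (- x + 2 *\<^sub>R q)) = (1 / 2 ^ CARD('n)) *\<^sub>R (LBINT y. \<psi> y * f y)"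
    using integral_lborel_affine[of 2 "\<lambda>y. \<psi> y * f y" "- x"] by simp
  finally show ?thesis by (simp add: scaleR_conv_of_real power_mult_distrib mult_ac)
qed

text \<open>
  The resolution of the identity by coherent states, tested against a function that is merely square
  integrable. The integral over \<open>z\<close> converges pointwise in \<open>x\<close>, where it is evaluated by \<open>stft_inversion\<close>.
\<close>
lemma stft_reconstruction:
  fixes u :: "real ^ 'n::finite \<Rightarrow> complex"
  assumes \<psi>: "\<psi> \<in> schwartz" and g: "g \<in> schwartz" and u: "u \<in> L2"
  shows "(LBINT z. stft \<psi> g z * (LBINT x. u x * cnj (tf z g x)))
    = ((2 * pi) ^ CARD('n) * (L2_norm g)\<^sup>2) * (LBINT x. u x * \<psi> x)"
proof -
  obtain C1 where C1: "C1 > 0" "\<And>z. cmod (stft \<psi> g z) \<le> C1 / weight z ^ 2"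
    using stft_decay[OF \<psi> g] by metis
  obtain C2 where C2: "C2 > 0" "\<And>x. cmod (g x) \<le> C2 / weight x ^ 1"
    using schwartz_bound[OF g] by metis
  have prod_le: "cmod (stft \<psi> g z) * cmod (tf z g x) \<le> C1 * C2 * 2 ^ CARD('n) * (1 / weight z) * (1 / weight x)" for z x
  proof -
    have wf: "weight (fst z) \<le> weight z"
      by (rule weight_fst_le)
    have "cmod (stft \<psi> g z) * cmod (tf z g x) \<le>
       C1 / weight z ^ 2 * (C2 * (2 ^ CARD('n) * weight (fst z)) ^ 1 / weight x ^ 1)"
      using C1(1) by (intro mult_mono C1 tf_bound[OF C2(2)]) auto
    also have "\<dots> \<le> C1 / weight z ^ 2 * (C2 * (2 ^ CARD('n) * weight z) ^ 1 / weight x ^ 1)"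
      using C1(1) C2(1) wf by (intro mult_left_mono divide_right_mono power_mono) auto
    also have "\<dots> = C1 * C2 * 2 ^ CARD('n) * (1 / weight z) * (1 / weight x)"
      by (simp add: power2_eq_square)
    finally show ?thesis .
  qed
  have tf_cont: "continuous_on A (\<lambda>p. cnj (tf (v p) g (y p)))" if "continuous_on A v" "continuous_on A y"
    for v y and A :: "'z::topological_space set"
    unfolding tf_def using that g by (intro continuous_intros)

  have synth: "(LBINT z. stft \<psi> g z * cnj (tf z g x)) = ((2 * pi) ^ CARD('n) * (L2_norm g)\<^sup>2) * \<psi> x" for x
  proof -
    have int: "integrable lborel (\<lambda>z. stft \<psi> g z * cnj (tf z g x))"
    proof (rule integrable_weight_bound)
      show "(\<lambda>z. stft \<psi> g z * cnj (tf z g x)) \<in> borel_measurable borel"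
        by (intro borel_measurable_continuous_onI continuous_intros tf_cont \<psi> g)
      show "norm (stft \<psi> g z * cnj (tf z g x)) \<le> (C1 * C2 * 2 ^ CARD('n) * (1 / weight x)) / weight z" for z
        using prod_le[of z x] by (simp add: norm_mult mult_ac)
    qed
    have inner: "(LBINT \<zeta>. stft \<psi> g (s, \<zeta>) * cnj (tf (s, \<zeta>) g x)) =
       ((2 * pi) ^ CARD('n) * \<psi> x) * complex_of_real ((cmod (g (x + (-1) *\<^sub>R s)))\<^sup>2)" for s
    proof -
      have "stft \<psi> g (s, \<zeta>) * cnj (tf (s, \<zeta>) g x) =
        cnj (g (x - s)) * (stft \<psi> g (s, \<zeta>) * exp (- \<i> * complex_of_real (\<zeta> \<bullet> x)))" for \<zeta>
        by (simp add: tf_def exp_cnj mult_ac)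
      then have "(LBINT \<zeta>. stft \<psi> g (s, \<zeta>) * cnj (tf (s, \<zeta>) g x)) =
         cnj (g (x - s)) * (LBINT \<zeta>. stft \<psi> g (s, \<zeta>) * exp (- \<i> * complex_of_real (\<zeta> \<bullet> x)))"
        by (simp only: integral_mult_right_zero)
      also have "\<dots> = cnj (g (x - s)) * ((2 * pi) ^ CARD('n) * (\<psi> x * g (x - s)))"
        unfolding stft_inversion[OF \<psi> g] ..
      also have "\<dots> = ((2 * pi) ^ CARD('n) * \<psi> x) * (g (x - s) * cnj (g (x - s)))"
        by (simp add: mult_ac)
      finally show ?thesis by (simp add: complex_norm_square del: of_real_power)
    qed
    have [measurable]: "g \<in> borel_measurable borel" using g by measurable
    have "(LBINT z. stft \<psi> g z * cnj (tf z g x)) = (LBINT s. (LBINT \<zeta>. stft \<psi> g (s, \<zeta>) * cnj (tf (s, \<zeta>) g x)))"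
      by (rule lborel_integral_fst[OF int, symmetric])
    also have "\<dots> = ((2 * pi) ^ CARD('n) * \<psi> x) * complex_of_real (LBINT s. (cmod (g (x + (-1) *\<^sub>R s)))\<^sup>2)"
      unfolding inner by (simp only: integral_mult_right_zero integral_complex_of_real)
    also have "(LBINT s. (cmod (g (x + (-1) *\<^sub>R s)))\<^sup>2) = (L2_norm g)\<^sup>2"
      by (subst integral_lborel_affine[where f = "\<lambda>s. (cmod (g s))\<^sup>2"]) (auto simp: L2_norm_def integral_nonneg_AE)
    finally show ?thesis by (simp add: mult_ac)
  qed

  let ?F = "\<lambda>(z, x). stft \<psi> g z * (u x * cnj (tf z g x))"
  have [measurable]: "u \<in> borel_measurable borel" by (rule L2_measurable[OF u])
  have F_int: "integrable lborel ?F"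
  proof (rule lborel_integrable_product_bound)
    have m1: "(\<lambda>p. stft \<psi> g (fst p) * cnj (tf (fst p) g (snd p))) \<in> borel_measurable borel"
      by (intro borel_measurable_continuous_onI continuous_intros tf_cont \<psi> g)
    have m2: "(\<lambda>p. u (snd p)) \<in> borel_measurable (borel :: (('n phase_space) \<times> (real^'n)) measure)"
      by (rule measurable_compose[OF _ \<open>u \<in> borel_measurable borel\<close>])
         (intro borel_measurable_continuous_onI continuous_intros)
    show "?F \<in> borel_measurable borel"
      using borel_measurable_times[OF m1 m2] by (simp add: case_prod_beta mult_ac)
    show "integrable lborel (\<lambda>z::'n phase_space. (C1 * C2 * 2 ^ CARD('n)) * (1 / weight z))"
      by (intro integrable_mult_right integrable_inverse_weight)
    have "(\<lambda>x::real^'n. complex_of_real (1 / weight x)) \<in> L2"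
      by (rule L2_weightI[where C = 1]) (auto simp: norm_divide)
    from integrable_norm[OF L2_integrable_mult[OF u this]]
    show "integrable lborel (\<lambda>x. cmod (u x) * (1 / weight x))" by (simp add: norm_mult norm_divide)
    fix z :: "'n phase_space" and x :: "real ^ 'n"
    have "norm (?F (z, x)) = cmod (u x) * (cmod (stft \<psi> g z) * cmod (tf z g x))"
      by (simp add: norm_mult)
    also have "\<dots> \<le> cmod (u x) * (C1 * C2 * 2 ^ CARD('n) * (1 / weight z) * (1 / weight x))"
      by (intro mult_left_mono prod_le) simp
    finally show "norm (?F (z, x)) \<le> (C1 * C2 * 2 ^ CARD('n)) * (1 / weight z) * (cmod (u x) * (1 / weight x))"
      by (simp add: mult_ac)
  qed
  have "(LBINT z. stft \<psi> g z * (LBINT x. u x * cnj (tf z g x))) = (LBINT z. (LBINT x. ?F (z, x)))"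
    by simp
  also have "\<dots> = (LBINT x. (LBINT z. ?F (z, x)))"
    by (rule lborel_integral_swap[OF F_int])
  also have "\<dots> = (LBINT x. ((2 * pi) ^ CARD('n) * (L2_norm g)\<^sup>2) * (u x * \<psi> x))"
  proof (intro Bochner_Integration.integral_cong refl)
    fix x
    have "(LBINT z. ?F (z, x)) = (LBINT z. u x * (stft \<psi> g z * cnj (tf z g x)))"
      by (simp add: mult_ac)
    also have "\<dots> = u x * (LBINT z. stft \<psi> g z * cnj (tf z g x))"
      by (rule integral_mult_right_zero)
    finally show "(LBINT z. ?F (z, x)) = ((2 * pi) ^ CARD('n) * (L2_norm g)\<^sup>2) * (u x * \<psi> x)"
      unfolding synth by (simp add: mult_ac)
  qed
  also have "\<dots> = ((2 * pi) ^ CARD('n) * (L2_norm g)\<^sup>2) * (LBINT x. u x * \<psi> x)"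
    by (rule integral_mult_right_zero)
  finally show ?thesis .
qed

section \<open>The Weyl formula\<close>

text \<open>
  Fubini brings the integral over \<open>w\<close> inside, where \<open>S\<close> can be applied after the integration. The Wigner
  function then leaves \<open>S \<phi>\<close> paired with \<open>g\<^sub>z\<close>, and the integral over \<open>z\<close> resolves the identity.
\<close>
lemma wigner_parity_symbol:
  fixes S :: "(real ^ 'n::finite \<Rightarrow> complex) \<Rightarrow> 'n functional"
  assumes S: "beals S" and B: "bounded_L2_operator B" and SB: "\<And>\<phi>. \<phi> \<in> schwartz \<Longrightarrow> S \<phi> = dist_of (B \<phi>)"
    and g: "g \<in> schwartz" and \<psi>: "\<psi> \<in> schwartz" and \<phi>: "\<phi> \<in> schwartz"
  shows "(LBINT w. wigner \<psi> \<phi> w * parity_symbol g S w)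
    = ((2 * pi) ^ CARD('n) * pi ^ CARD('n) * (L2_norm g)\<^sup>2) * S \<phi> \<psi>"
proof -
  note SL = beals_L2_form[OF S]
  have Sv: "S f h = (LBINT x. B f x * h x)" if "f \<in> schwartz" "h \<in> schwartz" for f h
    using that by (simp add: SB dist_of_def)
  have B\<phi>: "B \<phi> \<in> L2" using B schwartz_L2[OF \<phi>] by (auto simp: bounded_L2_operator_def)
  obtain C1 where C1: "C1 > 0" "\<And>w. cmod (wigner \<psi> \<phi> w) \<le> C1 / weight w ^ 2"
    using wigner_decay_unscaled[OF \<psi> \<phi>] by metis
  obtain C2 where C2: "C2 > 0" "\<And>w u. cmod (symbol_integrand g S w u) \<le> C2 / weight u"
    using symbol_integrand_bound[OF S g] by metis
  obtain C3 where C3: "C3 > 0" "\<And>w. cmod (wigner \<psi> \<phi> w) \<le> C3 / weight (2 *\<^sub>R w) ^ 3"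
    using wigner_decay[OF \<psi> \<phi>] by metis
  let ?d = "2 ^ DIM('n phase_space) :: real"
  let ?F = "\<lambda>(w, z). wigner \<psi> \<phi> w * symbol_integrand g S w (z - w)"
  have F_int: "integrable lborel ?F"
  proof (rule lborel_integrable_product_bound)
    show "?F \<in> borel_measurable borel"
      unfolding case_prod_beta by (intro borel_measurable_continuous_onI continuous_intros \<psi> \<phi> SL g)
    show "integrable lborel (\<lambda>w::'n phase_space. (C1 * C2 * ?d) * (1 / weight w))"
      by (intro integrable_mult_right integrable_inverse_weight)
    show "integrable lborel (\<lambda>z::'n phase_space. 1 / weight z)"
      by (rule integrable_inverse_weight)
    fix w z :: "'n phase_space"
    \<comment> \<open>One of the two powers of \<open>weight w\<close> turns decay in \<open>z - w\<close> into decay in \<open>z\<close>.\<close>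
    have le: "1 / (weight w * weight (z - w)) \<le> ?d / weight z"
      using weight_add_le[of w "z - w"] by (simp add: field_simps)
    have "norm (?F (w, z)) \<le> C1 / weight w ^ 2 * (C2 / weight (z - w))"
      using C1 C2(1) by (simp only: prod.case norm_mult) (intro mult_mono C2 C1, auto)
    also have "\<dots> = (C1 * C2 / weight w) * (1 / (weight w * weight (z - w)))"
      by (simp add: power2_eq_square)
    also have "\<dots> \<le> (C1 * C2 / weight w) * (?d / weight z)"
      using C1(1) C2(1) by (intro mult_left_mono le) auto
    finally show "norm (?F (w, z)) \<le> (C1 * C2 * ?d) * (1 / weight w) * (1 / weight z)" by simp
  qed
  have inner: "(LBINT w. ?F (w, z)) = pi ^ CARD('n) * (stft \<psi> g z * (LBINT x. B \<phi> x * cnj (tf z g x)))" for z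
  proof -
    let ?g = "tf z g"
    have gs: "?g \<in> schwartz" "(\<lambda>x. cnj (?g x)) \<in> schwartz" by (intro schwartz_intros g)+
    obtain C4 where C4: "C4 > 0" "\<And>x. cmod (?g x) \<le> C4 / weight x ^ 2"
      using schwartz_bound[OF gs(1)] by metis
    let ?f = "\<lambda>w x. wigner \<psi> \<phi> w * parity w ?g x"
    have "(LBINT w. ?F (w, z)) = (LBINT w. (LBINT x. B (?f w) x * cnj (?g x)))"
    proof (intro Bochner_Integration.integral_cong refl)
      fix w
      have "?F (w, z) = S (?f w) (\<lambda>x. cnj (?g x))"
        by (simp add: symbol_integrand_parity[OF SL g] L2_form_cmult_left[OF SL] schwartz_parity gs)
      also have "\<dots> = (LBINT x. B (?f w) x * cnj (?g x))"
        by (intro Sv schwartz_cmult schwartz_parity gs)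
      finally show "?F (w, z) = (LBINT x. B (?f w) x * cnj (?g x))" .
    qed
    also have "\<dots> = (LBINT x. B (\<lambda>x. \<integral>w. ?f w x \<partial>lborel) x * cnj (?g x))"
    proof (rule L2_pull_out[OF B schwartz_L2[OF gs(2)]])
      show "continuous_on UNIV (\<lambda>(w, x). ?f w x)"
        unfolding case_prod_beta parity_def using gs(1) by (intro continuous_intros \<psi> \<phi>)
      fix w :: "'n phase_space" and x :: "real^'n"
      \<comment> \<open>Of the three powers of \<open>?W\<close>, two pay for moving the decay of \<open>?g\<close> from \<open>2 *\<^sub>R fst w - x\<close> to \<open>x\<close>.\<close>
      let ?W = "weight (2 *\<^sub>R w)"
      have wf: "weight (2 *\<^sub>R fst w) \<le> ?W"
        using weight_fst_le[of "2 *\<^sub>R w"] by simp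
      have "1 / weight (2 *\<^sub>R fst w - x) \<le> 2 ^ CARD('n) * weight (2 *\<^sub>R fst w) / weight x"
        using inverse_weight_shift[of x "2 *\<^sub>R fst w"] by (simp add: weight_minus_commute)
      also have "\<dots> \<le> 2 ^ CARD('n) * ?W / weight x"
        using wf by (intro divide_right_mono mult_left_mono) auto
      finally have q: "(1 / weight (2 *\<^sub>R fst w - x))\<^sup>2 \<le> (2 ^ CARD('n) * ?W / weight x)\<^sup>2"
        by (intro power_mono) auto
      have p: "C4 / (weight (2 *\<^sub>R fst w - x))\<^sup>2 \<le> C4 * (2 ^ CARD('n) * ?W / weight x)\<^sup>2"
        using mult_left_mono[OF q, of C4] C4(1) by (simp add: power_divide)
      have "cmod (?f w x) \<le> C3 / ?W ^ 3 * (C4 * (2 ^ CARD('n) * ?W / weight x)\<^sup>2)"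
        unfolding norm_mult cmod_parity
        using C3(1) by (intro mult_mono C3 order_trans[OF C4(2) p]) auto
      also have "\<dots> = C3 * C4 * (2 ^ CARD('n))\<^sup>2 / (?W * (weight x)\<^sup>2)"
        by (simp add: power_divide power_mult_distrib power3_eq_cube power2_eq_square)
      also have "\<dots> \<le> C3 * C4 * (2 ^ CARD('n))\<^sup>2 / (weight w * (weight x)\<^sup>2)"
        using C3(1) C4(1) weight_mono_scale[of 2 w] by (intro divide_left_mono mult_right_mono) auto
      finally show "cmod (?f w x) \<le> C3 * C4 * (2 ^ CARD('n))\<^sup>2 / (weight w * (weight x)\<^sup>2)" .
    qed
    also have "\<dots> = (LBINT x. B (\<lambda>x. (pi ^ CARD('n) * stft \<psi> g z) * \<phi> x) x * cnj (?g x))"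
      unfolding wigner_parity_inversion[OF \<psi> \<phi> gs(1)] stft_def ..
    also have "\<dots> = (pi ^ CARD('n) * stft \<psi> g z) * (LBINT x. B \<phi> x * cnj (?g x))"
      by (rule L2_functional_cmult[OF B schwartz_L2[OF gs(2)] schwartz_L2[OF \<phi>]])
    finally show ?thesis by (simp add: mult.assoc)
  qed
  have "(LBINT w. wigner \<psi> \<phi> w * parity_symbol g S w) = (LBINT w. (LBINT z. ?F (w, z)))"
    unfolding parity_symbol_eq[OF SL g] by (simp add: symbol_integrand_parity[OF SL g])
  also have "\<dots> = (LBINT z. (LBINT w. ?F (w, z)))"
    by (rule lborel_integral_swap[OF F_int])
  also have "\<dots> = pi ^ CARD('n) * (LBINT z. stft \<psi> g z * (LBINT x. B \<phi> x * cnj (tf z g x)))"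
    unfolding inner by (rule integral_mult_right_zero)
  also have "\<dots> = pi ^ CARD('n) * (((2 * pi) ^ CARD('n) * (L2_norm g)\<^sup>2) * S \<phi> \<psi>)"
    unfolding stft_reconstruction[OF \<psi> g B\<phi>] Sv[OF \<phi> \<psi>] ..
  finally show ?thesis by (simp add: mult_ac)
qed

theorem theorem1p1:
  fixes T :: "(real ^ 'n::finite \<Rightarrow> complex) \<Rightarrow> (real ^ 'n \<Rightarrow> complex) \<Rightarrow> complex"
  assumes "continuous_linear_operator T"
    and "extends_to_bounded_L2_operator T"
    and "\<And>ks :: ('n + 'n) list. length ks \<ge> 1 \<Longrightarrow>
           extends_to_bounded_L2_operator (multi_commutator ks T)"
  shows "\<exists>a\<^sub>0 \<in> S000. \<forall>\<Psi>\<in>schwartz. \<forall>\<Phi>\<in>schwartz.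
           L2_inner \<Psi> (L2_function (T \<Phi>)) =
             complex_of_real (1 / (2 * pi) ^ CARD('n)) *
             (\<integral>\<xi>. (\<integral>(x, x'). exp (\<i> * complex_of_real (\<xi> \<bullet> (x - x'))) * cnj (\<Psi> x) *
                            a\<^sub>0 ((1 / 2) *\<^sub>R (x + x'), \<xi>) * \<Phi> x' \<partial>lborel) \<partial>lborel)"
proof -
  have T: "beals T"
    unfolding beals_def
  proof
    fix ks :: "('n + 'n) list"
    show "L2_form (multi_commutator ks T)"
      using assms(2,3) by (cases ks) (auto intro!: extends_imp_L2_form simp del: multi_commutator_simps(2))
  qed
  obtain B where B: "bounded_L2_operator B" and TB: "\<And>\<phi>. \<phi> \<in> schwartz \<Longrightarrow> T \<phi> = dist_of (B \<phi>)"
    using assms(2) unfolding extends_to_bounded_L2_operator_def by blast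
  have lhs: "L2_inner \<Psi> (L2_function (T \<Phi>)) = T \<Phi> (\<lambda>x. cnj (\<Psi> x))"
    if "\<Psi> \<in> schwartz" "\<Phi> \<in> schwartz" for \<Psi> \<Phi>
  proof -
    have "B \<Phi> \<in> L2" using B schwartz_L2[OF that(2)] by (auto simp: bounded_L2_operator_def)
    then have "\<exists>g. g \<in> L2 \<and> T \<Phi> = dist_of g" using TB[OF that(2)] by blast
    from someI_ex[OF this] have "T \<Phi> = dist_of (L2_function (T \<Phi>))"
      unfolding L2_function_def by blast
    then have "T \<Phi> (\<lambda>x. cnj (\<Psi> x)) = dist_of (L2_function (T \<Phi>)) (\<lambda>x. cnj (\<Psi> x))" by simp
    then show ?thesis
      using schwartz_cnj[OF that(1)] by (simp add: L2_inner_def dist_of_def mult.commute)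
  qed
  \<comment> \<open>Every Schwartz function of nonzero norm can serve as the window.\<close>
  show ?thesis
  proof (cases "\<exists>g\<in>schwartz. L2_norm (g :: real ^ 'n \<Rightarrow> complex) \<noteq> 0")
    case True
    then obtain g :: "real ^ 'n \<Rightarrow> complex" where g: "g \<in> schwartz" and ng: "L2_norm g \<noteq> 0" by blast
    \<comment> \<open>This constant is \<open>2\<^sup>d\<close> from the trace formula times \<open>(2\<pi>)\<^bsup>-d\<^esup> \<parallel>g\<parallel>\<^bsup>-2\<^esup>\<close> from the resolution of the identity.\<close>
    define c where "c = complex_of_real (1 / (pi ^ CARD('n) * (L2_norm g)\<^sup>2))"
    define a where "a w = c * parity_symbol g T w" for w
    have a: "a \<in> S000" unfolding a_def[abs_def] by (rule parity_symbol_in_S000[OF T g])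
    have a_cont: "continuous_on UNIV a"
      unfolding a_def[abs_def] by (intro continuous_intros continuous_on_parity_symbol[OF T g])
    obtain K where "\<And>w. cmod (parity_symbol g T w) \<le> K"
      using parity_symbol_bounded[OF T g] by blast
    then have a_bound: "cmod (a w) \<le> cmod c * K" for w
      unfolding a_def norm_mult by (intro mult_left_mono) auto
    have main: "T \<Phi> \<psi> = complex_of_real (1 / (2 * pi) ^ CARD('n)) *
        (\<integral>\<xi>. (\<integral>(x, x'). exp (\<i> * complex_of_real (\<xi> \<bullet> (x - x'))) * \<psi> x *
             a ((1 / 2) *\<^sub>R (x + x'), \<xi>) * \<Phi> x' \<partial>lborel) \<partial>lborel)"
      if "\<psi> \<in> schwartz" "\<Phi> \<in> schwartz" for \<psi> \<Phi>
    proof -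
      have "(\<integral>w. wigner \<psi> \<Phi> w * a w \<partial>lborel) = (\<integral>w. c * (wigner \<psi> \<Phi> w * parity_symbol g T w) \<partial>lborel)"
        by (simp add: a_def mult_ac)
      also have "\<dots> = c * (\<integral>w. wigner \<psi> \<Phi> w * parity_symbol g T w \<partial>lborel)"
        by (rule integral_mult_right_zero)
      also have "\<dots> = c * (((2 * pi) ^ CARD('n) * pi ^ CARD('n) * (L2_norm g)\<^sup>2) * T \<Phi> \<psi>)"
        by (rule arg_cong[where f = "\<lambda>r. c * r", OF wigner_parity_symbol[OF T B TB g that]])
      also have "\<dots> = complex_of_real ((2 * pi) ^ CARD('n)) * T \<Phi> \<psi>"
        using ng by (simp add: c_def)
      finally show ?thesis
        unfolding weyl_formula_wigner[OF that a_cont a_bound] by simp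
    qed
    show ?thesis
    proof (intro bexI[of _ a] ballI a)
      fix \<Psi> \<Phi> :: "real ^ 'n \<Rightarrow> complex" assume *: "\<Psi> \<in> schwartz" "\<Phi> \<in> schwartz"
      show "L2_inner \<Psi> (L2_function (T \<Phi>)) = complex_of_real (1 / (2 * pi) ^ CARD('n)) *
        (\<integral>\<xi>. (\<integral>(x, x'). exp (\<i> * complex_of_real (\<xi> \<bullet> (x - x'))) * cnj (\<Psi> x) *
             a ((1 / 2) *\<^sub>R (x + x'), \<xi>) * \<Phi> x' \<partial>lborel) \<partial>lborel)"
        unfolding lhs[OF *] by (rule main[OF schwartz_cnj[OF *(1)] *(2)])
    qed
  next
    case False
    \<comment> \<open>If every Schwartz function had norm zero, then \<open>T\<close> would vanish by its \<open>L\<^sup>2\<close> bound.\<close>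
    obtain C where C: "\<And>\<phi> \<psi>. \<phi> \<in> schwartz \<Longrightarrow> \<psi> \<in> schwartz \<Longrightarrow> cmod (T \<phi> \<psi>) \<le> C * L2_norm \<phi> * L2_norm \<psi>"
      using L2_form_bound[OF beals_L2_form[OF T]] by metis
    have zero: "T \<phi> \<psi> = 0" if "\<phi> \<in> schwartz" "\<psi> \<in> schwartz" for \<phi> \<psi>
      using C[OF that] False that by auto
    show ?thesis
    proof (intro bexI[of _ "\<lambda>w. 0"] ballI)
      show "(\<lambda>w. 0) \<in> (S000 :: ('n phase_space \<Rightarrow> complex) set)"
        using parity_symbol_in_S000[OF T schwartz_0, of 0] by simp
    qed (simp add: lhs zero schwartz_cnj case_prod_beta')
  qed
qed

end
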